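(* Let $\ell,k\in\{1,2,\dots\}\cup\{\infty\}$ and let $M$ be a $C^\ell$ Finsler manifold in the sense of Neeb-Upmeier satisfying one of the following conditions: (1) $M$ is $K$-weak-uniform (for some $K\ge1$) and it is modeled on a Banach space $X$ which admits property $( *^k)$ with a constant $C_0$ that does not depend on the (equivalent) norm considered on $X$; (2) $M$ is $K$-uniform (for some $K\ge1$) and it is modeled on a Banach space $X$ which admits property $( *^k)$. Then $M$ is $C^m$-uniformly bumpable, with $m:=\min\{\ell,k\}$.
   Context: Let $M$ be a paracompact $C^\ell$ Banach manifold ($\ell\ge1$) modeled on a real Banach space $(X,\|\cdot\|)$, with tangent bundle $TM$, and let $\|\cdot\|_M:TM\to[0,\infty)$ be a continuous map; write $\|\cdot\|_x$ for its restriction to $T_xM$. Condition (P1): for every $x\in M$, $\|\cdot\|_x$ is a norm on $T_xM$ such that for every chart $\varphi:U\to X$ with $x\in U$, the norm $v\in X\mapsto\|d\varphi^{-1}(\varphi(x))(v)\|_x$ is equivalent to $\|\cdot\|$ on $X$. $(M,\|\cdot\|_M)$ is a $C^\ell$ Finsler manifold in the sense of Neeb-Upmeier if (P1) holds and for every $x_0\in M$ there are a chart $\varphi:U\to X$ with $x_0\in U$ and $K_{x_0}\ge1$ such that $\frac1{K_{x_0}}\|v\|_x\le\|d\varphi(x)(v)\|\le K_{x_0}\|v\|_x$ for every $x\in U$, $v\in T_xM$. It is $K$-weak-uniform if (P1) holds and for every $x_0\in M$ there is a chart $\varphi:U\to X$ with $x_0\in U$ such that for every $x\in U$ and $v\in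 X$, $\frac1K\|d\varphi^{-1}(\varphi(x_0))(v)\|_{x_0}\le\|d\varphi^{-1}(\varphi(x))(v)\|_x\le K\|d\varphi^{-1}(\varphi(x_0))(v)\|_{x_0}$. It is $K$-uniform if (P1) holds and for every $x_0\in M$ there is a chart $\varphi:U\to X$ with $x_0\in U$ such that $\frac1K\|v\|_x\le\|d\varphi(x)(v)\|\le K\|v\|_x$ for every $x\in U$, $v\in T_xM$. The Finsler metric $d_M(p,q)$ is the infimum of the lengths $\int_a^b\|c'(t)\|_{c(t)}\,dt$ of piecewise $C^1$ paths $c:[a,b]\to M$ joining $p$ to $q$ (with value $+\infty$ if $p,q$ lie in different connected components). For a differentiable $b:M\to\mathbb{R}$, $\|db(p)\|_p=\sup\{|db(p)(v)|: v\in T_pM,\ \|v\|_p\le1\}$. $M$ is $C^m$-uniformly bumpable (with $m\le\ell$) if there are $R>1$ and $r>0$ such that for every $p\in M$ and $\delta\in(0,r)$ there exists a $C^m$-smooth function $b:M\to[0,1]$ with $b(p)=1$, $b(q)=0$ whenever $d_M(p,q)\ge\delta$, and $\sup_{q\in M}\|db(q)\|_q\le R/\delta$. Property $( *^k)$: a Banach space $(X,\|\cdot\|)$ satisfies property $( *^k)$ with constant $C_0\ge1$ (depending only on $(X,\|\cdot\|)$) if for every Lipschitz function $f:X\to\mathbb{R}$ and every $\varepsilon>0$ there is a Lipschitz, $C^k$-smooth function $h:X\to\mathbb{R}$ with $|f(x)-h(x)|<\varepsilon$ for all $x\in X$ and $\operatorname{Lip}(h)\le C_0\operatorname{Lip}(f)$.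 "The constant $C_0$ does not depend on the norm" means that for every norm $|\cdot|$ on $X$ equivalent to $\|\cdot\|$, the space $(X,|\cdot|)$ satisfies property $( *^k)$ with the same constant $C_0$. *)

theory Defs
  imports "HOL-Analysis.Analysis"
begin

section \<open>Smooth maps between normed spaces\<close>

text \<open>
  Since the iterated derivative lives in a type depending on its order, the derivative
  of order \<open>n\<close> at a point is encoded as a bounded \<open>n\<close>-linear map acting on lists of length
  \<open>n\<close>, via the isometry \<open>L(X, L\<^sup>n(X;Y)) = L\<^sup>n\<^sup>+\<^sup>1(X;Y)\<close>: the head of the list is the direction of
  the outermost differentiation. Values on lists of any other length are irrelevant.
\<close>

definition bounded_multilinear ::
    "nat \<Rightarrow> ('a::real_normed_vector list \<Rightarrow> 'b::real_normed_vector) \<Rightarrow> bool" where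
  "bounded_multilinear n T \<longleftrightarrow>
     (\<forall>us ws. length us + Suc (length ws) = n \<longrightarrow> linear (\<lambda>v. T (us @ v # ws))) \<and>
     (\<exists>C. \<forall>vs. length vs = n \<longrightarrow> norm (T vs) \<le> C * prod_list (map norm vs))"

definition unit_lists :: "nat \<Rightarrow> 'a::real_normed_vector list set" where
  "unit_lists n = {vs. length vs = n \<and> (\<forall>v\<in>set vs. norm v \<le> 1)}"

text \<open>
  \<open>D n\<close> is the Frechet derivative of order \<open>n\<close>. Convergence in the operator norm of \<open>n\<close>-linear
  maps is uniform convergence on \<open>unit_lists n\<close>. The case \<open>k = \<infinity>\<close> is included.
  Only used for open \<open>U\<close>.
\<close>

definition Ck_on ::
    "enat \<Rightarrow> 'a::real_normed_vector set \<Rightarrow> ('a \<Rightarrow> 'b::real_normed_vector) \<Rightarrow> bool" where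
  "Ck_on k U f \<longleftrightarrow> (\<exists>D :: nat \<Rightarrow> 'a \<Rightarrow> 'a list \<Rightarrow> 'b.
     (\<forall>x\<in>U. D 0 x [] = f x) \<and>
     (\<forall>n x. enat n \<le> k \<and> x \<in> U \<longrightarrow>
        bounded_multilinear n (D n x) \<and>
        uniform_limit (unit_lists n) (D n) (D n x) (at x within U)) \<and>
     (\<forall>n x. enat n < k \<and> x \<in> U \<longrightarrow>
        uniform_limit (unit_lists n)
          (\<lambda>y vs. (D n y vs - D n x vs - D (Suc n) x ((y - x) # vs)) /\<^sub>R norm (y - x))
          (\<lambda>vs. 0) (at x within U)))"


section \<open>Norms and the approximation property\<close>

definition is_norm :: "('a::real_vector \<Rightarrow> real) \<Rightarrow> bool" where
  "is_norm \<nu> \<longleftrightarrow>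
     (\<forall>v. 0 \<le> \<nu> v \<and> (\<nu> v = 0 \<longleftrightarrow> v = 0)) \<and>
     (\<forall>r v. \<nu> (r *\<^sub>R v) = \<bar>r\<bar> * \<nu> v) \<and>
     (\<forall>v w. \<nu> (v + w) \<le> \<nu> v + \<nu> w)"

definition equivalent_norm :: "('a::real_normed_vector \<Rightarrow> real) \<Rightarrow> bool" where
  "equivalent_norm \<nu> \<longleftrightarrow> is_norm \<nu> \<and>
     (\<exists>c>0. \<exists>C>0. \<forall>v. c * norm v \<le> \<nu> v \<and> \<nu> v \<le> C * norm v)"

definition lipschitz_wrt :: "('a::real_vector \<Rightarrow> real) \<Rightarrow> real \<Rightarrow> ('a \<Rightarrow> real) \<Rightarrow> bool" where
  "lipschitz_wrt \<nu> L f \<longleftrightarrow> 0 \<le> L \<and> (\<forall>x y. \<bar>f x - f y\<bar> \<le> L * \<nu> (x - y))"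

definition Lip :: "('a::real_vector \<Rightarrow> real) \<Rightarrow> ('a \<Rightarrow> real) \<Rightarrow> real" where
  "Lip \<nu> f = Inf {L. lipschitz_wrt \<nu> L f}"

text \<open>
  Property \<open>(*\<^sup>k)\<close> of the space \<open>(X, \<nu>)\<close> for a norm \<open>\<nu>\<close> equivalent to the given one. Smoothness
  does not change when passing to an equivalent norm, so \<open>Ck_on\<close> refers to the given norm.
\<close>

definition star_property :: "enat \<Rightarrow> ('a::real_normed_vector \<Rightarrow> real) \<Rightarrow> real \<Rightarrow> bool" where
  "star_property k \<nu> C\<^sub>0 \<longleftrightarrow>
     (\<forall>f \<epsilon>. (\<exists>L. lipschitz_wrt \<nu> L f) \<and> \<epsilon> > 0 \<longrightarrow>
        (\<exists>h. (\<exists>L. lipschitz_wrt \<nu> L h) \<and> Ck_on k UNIV h \<and>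
             (\<forall>x. \<bar>f x - h x\<bar> < \<epsilon>) \<and> Lip \<nu> h \<le> C\<^sub>0 * Lip \<nu> f))"


section \<open>Banach manifolds\<close>

text \<open>
  The manifold is the whole type \<open>'m\<close>. A chart is a pair of its domain and a map; the values
  of the map outside the domain are irrelevant.
\<close>

type_synonym ('m, 'x) chart = "'m set \<times> ('m \<Rightarrow> 'x)"

definition cinv :: "('m, 'x) chart \<Rightarrow> 'x \<Rightarrow> 'm" where
  "cinv c = inv_into (fst c) (snd c)"

definition cimage :: "('m, 'x) chart \<Rightarrow> 'x set" where
  "cimage c = snd c ` fst c"

definition is_chart :: "('m::topological_space, 'x::topological_space) chart \<Rightarrow> bool" where
  "is_chart c \<longleftrightarrow> open (fst c) \<and> open (cimage c) \<and>
     homeomorphism (fst c) (cimage c) (snd c) (cinv c)"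

definition transition :: "('m, 'x) chart \<Rightarrow> ('m, 'x) chart \<Rightarrow> 'x \<Rightarrow> 'x" where
  "transition c d = snd d \<circ> cinv c"

definition compatible ::
    "enat \<Rightarrow> ('m, 'x::real_normed_vector) chart \<Rightarrow> ('m, 'x) chart \<Rightarrow> bool" where
  "compatible l c d \<longleftrightarrow>
     Ck_on l (snd c ` (fst c \<inter> fst d)) (transition c d) \<and>
     Ck_on l (snd d ` (fst c \<inter> fst d)) (transition d c)"

definition smooth_structure ::
    "enat \<Rightarrow> ('m::topological_space, 'x::banach) chart set \<Rightarrow> bool" where
  "smooth_structure l A \<longleftrightarrow>
     (\<forall>c\<in>A. is_chart c) \<and> (\<Union>c\<in>A. fst c) = UNIV \<and>
     (\<forall>c\<in>A. \<forall>d\<in>A. compatible l c d) \<and>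
     (\<forall>c. is_chart c \<and> (\<forall>d\<in>A. compatible l c d) \<longrightarrow> c \<in> A)"

definition paracompact :: "'m::topological_space itself \<Rightarrow> bool" where
  "paracompact _ \<longleftrightarrow>
     (\<forall>\<U> :: 'm set set. (\<forall>U\<in>\<U>. open U) \<and> \<Union>\<U> = UNIV \<longrightarrow>
        (\<exists>\<V>. (\<forall>V\<in>\<V>. open V) \<and> \<Union>\<V> = UNIV \<and>
             (\<forall>V\<in>\<V>. \<exists>U\<in>\<U>. V \<subseteq> U) \<and>
             locally_finite_in euclidean \<V>))"

definition banach_manifold ::
    "enat \<Rightarrow> ('m::t2_space, 'x::banach) chart set \<Rightarrow> bool" where
  "banach_manifold l A \<longleftrightarrow> smooth_structure l A \<and> paracompact TYPE('m)"

definition smooth_fun ::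
    "enat \<Rightarrow> ('m, 'x::real_normed_vector) chart set \<Rightarrow> ('m \<Rightarrow> real) \<Rightarrow> bool" where
  "smooth_fun m A b \<longleftrightarrow> (\<forall>c\<in>A. Ck_on m (cimage c) (b \<circ> cinv c))"


section \<open>Tangent bundle\<close>

text \<open>
  A tangent vector at \<open>p\<close> is an equivalence class of pairs (chart at \<open>p\<close>, vector of \<open>X\<close>), two pairs
  being identified if the derivative of the transition map takes one vector to the other.
  Such a class is the graph of a function on the set of charts at \<open>p\<close>, so that the vector space
  operations of the tangent space can be written down without choosing a chart.
\<close>

type_synonym ('m, 'x) tvec = "(('m, 'x) chart \<times> 'x) set"

definition tangent_rel ::
    "('m, 'x::real_normed_vector) chart set \<Rightarrow> 'm
       \<Rightarrow> ((('m, 'x) chart \<times> 'x) \<times> (('m, 'x) chart \<times> 'x)) set" where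
  "tangent_rel A p = {((c, v), (d, w)). c \<in> A \<and> d \<in> A \<and> p \<in> fst c \<and> p \<in> fst d \<and>
     w = frechet_derivative (transition c d) (at (snd c p)) v}"

definition tangent_space ::
    "('m, 'x::real_normed_vector) chart set \<Rightarrow> 'm \<Rightarrow> ('m, 'x) tvec set" where
  "tangent_space A p = ({c\<in>A. p \<in> fst c} \<times> UNIV) // tangent_rel A p"

definition tangent_bundle ::
    "('m, 'x::real_normed_vector) chart set \<Rightarrow> ('m \<times> ('m, 'x) tvec) set" where
  "tangent_bundle A = Sigma UNIV (tangent_space A)"

definition tadd :: "('m, 'x::real_vector) tvec \<Rightarrow> ('m, 'x) tvec \<Rightarrow> ('m, 'x) tvec" where
  "tadd a b = {(c, v + w) | c v w. (c, v) \<in> a \<and> (c, w) \<in> b}"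

definition tscale :: "real \<Rightarrow> ('m, 'x::real_vector) tvec \<Rightarrow> ('m, 'x) tvec" where
  "tscale r a = {(c, r *\<^sub>R v) | c v. (c, v) \<in> a}"

definition tzero :: "('m, 'x::real_vector) chart set \<Rightarrow> 'm \<Rightarrow> ('m, 'x) tvec" where
  "tzero A p = {(c, 0) | c. c \<in> A \<and> p \<in> fst c}"

text \<open>For a chart \<open>c\<close> at \<open>p\<close>: \<open>dchart c\<close> is \<open>dc(p)\<close> and \<open>dchart_inv A c p\<close> is \<open>dc\<^sup>-\<^sup>1(c(p))\<close>.\<close>

definition dchart :: "('m, 'x) chart \<Rightarrow> ('m, 'x) tvec \<Rightarrow> 'x" where
  "dchart c a = (THE v. (c, v) \<in> a)"

definition dchart_inv ::
    "('m, 'x::real_normed_vector) chart set \<Rightarrow> ('m, 'x) chart \<Rightarrow> 'm \<Rightarrow> 'x \<Rightarrow> ('m, 'x) tvec" where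
  "dchart_inv A c p v = tangent_rel A p `` {(c, v)}"

text \<open>
  The topology of the tangent bundle: the finest one making all bundle chart inverses
  \<open>(y, v) \<mapsto> (c\<^sup>-\<^sup>1(y), dc\<^sup>-\<^sup>1(y)(v))\<close> on \<open>c(U) \<times> X\<close> continuous.
\<close>

definition bundle_preimage ::
    "('m, 'x::real_normed_vector) chart set \<Rightarrow> ('m, 'x) chart
       \<Rightarrow> ('m \<times> ('m, 'x) tvec) set \<Rightarrow> ('x \<times> 'x) set" where
  "bundle_preimage A c W =
     {(y, v). y \<in> cimage c \<and> (cinv c y, dchart_inv A c (cinv c y) v) \<in> W}"

definition tangent_topology ::
    "('m, 'x::real_normed_vector) chart set \<Rightarrow> ('m \<times> ('m, 'x) tvec) topology" where
  "tangent_topology A =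
     topology (\<lambda>W. W \<subseteq> tangent_bundle A \<and> (\<forall>c\<in>A. open (bundle_preimage A c W)))"

lemma openin_tangent_topology:
  "openin (tangent_topology A) W \<longleftrightarrow>
     W \<subseteq> tangent_bundle A \<and> (\<forall>c\<in>A. open (bundle_preimage A c W))"
proof -
  have inter: "bundle_preimage A c (S \<inter> T) = bundle_preimage A c S \<inter> bundle_preimage A c T"
    for c S T by (auto simp: bundle_preimage_def)
  have union: "bundle_preimage A c (\<Union>\<K>) = (\<Union>K\<in>\<K>. bundle_preimage A c K)"
    for c \<K> by (auto simp: bundle_preimage_def)
  have "istopology (\<lambda>W. W \<subseteq> tangent_bundle A \<and> (\<forall>c\<in>A. open (bundle_preimage A c W)))"
    unfolding istopology_def inter union by (blast intro: open_Int open_UN)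
  then show ?thesis
    by (simp add: tangent_topology_def topology_inverse')
qed

lemma topspace_tangent_topology:
  assumes "\<And>c. c \<in> A \<Longrightarrow> open (cimage c)"
  shows "topspace (tangent_topology A) = tangent_bundle A"
proof -
  have "bundle_preimage A c (tangent_bundle A) = cimage c \<times> UNIV" if "c \<in> A" for c
  proof -
    have "cinv c y \<in> fst c" if "y \<in> cimage c" for y
      using that by (simp add: cinv_def cimage_def inv_into_into)
    then have "dchart_inv A c (cinv c y) v \<in> tangent_space A (cinv c y)"
      if "y \<in> cimage c" for y v
      using that \<open>c \<in> A\<close> by (auto simp: dchart_inv_def tangent_space_def intro!: quotientI)
    then show ?thesis
      by (auto simp: bundle_preimage_def tangent_bundle_def)
  qed
  then have "openin (tangent_topology A) (tangent_bundle A)"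
    using assms by (simp add: openin_tangent_topology open_Times)
  then show ?thesis
    by (meson openin_subset openin_tangent_topology openin_topspace subset_antisym)
qed

text \<open>The differential of a real function, computed in any chart.\<close>

definition dfun ::
    "('m \<Rightarrow> real) \<Rightarrow> 'm \<Rightarrow> ('m, 'x::real_normed_vector) tvec \<Rightarrow> real" where
  "dfun b p a = (THE y. \<forall>(c, v)\<in>a. y = frechet_derivative (b \<circ> cinv c) (at (snd c p)) v)"


section \<open>Finsler structures\<close>

text \<open>\<open>F (x, v)\<close> is \<open>\<parallel>v\<parallel>\<^sub>x\<close>; only its values on the tangent bundle matter.\<close>

type_synonym ('m, 'x) finsler = "'m \<times> ('m, 'x) tvec \<Rightarrow> real"

definition tangent_norm ::
    "('m, 'x::real_normed_vector) chart set \<Rightarrow> ('m, 'x) finsler \<Rightarrow> 'm \<Rightarrow> bool" where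
  "tangent_norm A F x \<longleftrightarrow>
     (\<forall>a\<in>tangent_space A x. 0 \<le> F (x, a) \<and> (F (x, a) = 0 \<longleftrightarrow> a = tzero A x)) \<and>
     (\<forall>r. \<forall>a\<in>tangent_space A x. F (x, tscale r a) = \<bar>r\<bar> * F (x, a)) \<and>
     (\<forall>a\<in>tangent_space A x. \<forall>b\<in>tangent_space A x. F (x, tadd a b) \<le> F (x, a) + F (x, b))"

definition P1 ::
    "('m, 'x::real_normed_vector) chart set \<Rightarrow> ('m, 'x) finsler \<Rightarrow> bool" where
  "P1 A F \<longleftrightarrow> (\<forall>x. tangent_norm A F x \<and>
     (\<forall>c\<in>A. x \<in> fst c \<longrightarrow> equivalent_norm (\<lambda>v. F (x, dchart_inv A c x v))))"

definition neeb_upmeier ::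
    "('m, 'x::real_normed_vector) chart set \<Rightarrow> ('m, 'x) finsler \<Rightarrow> bool" where
  "neeb_upmeier A F \<longleftrightarrow> P1 A F \<and>
     (\<forall>x\<^sub>0. \<exists>c\<in>A. x\<^sub>0 \<in> fst c \<and> (\<exists>K\<ge>1. \<forall>x\<in>fst c. \<forall>a\<in>tangent_space A x.
        1 / K * F (x, a) \<le> norm (dchart c a) \<and> norm (dchart c a) \<le> K * F (x, a)))"

definition weak_uniform ::
    "real \<Rightarrow> ('m, 'x::real_normed_vector) chart set \<Rightarrow> ('m, 'x) finsler \<Rightarrow> bool" where
  "weak_uniform K A F \<longleftrightarrow> P1 A F \<and>
     (\<forall>x\<^sub>0. \<exists>c\<in>A. x\<^sub>0 \<in> fst c \<and> (\<forall>x\<in>fst c. \<forall>v.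
        1 / K * F (x\<^sub>0, dchart_inv A c x\<^sub>0 v) \<le> F (x, dchart_inv A c x v) \<and>
        F (x, dchart_inv A c x v) \<le> K * F (x\<^sub>0, dchart_inv A c x\<^sub>0 v)))"

definition uniform ::
    "real \<Rightarrow> ('m, 'x::real_normed_vector) chart set \<Rightarrow> ('m, 'x) finsler \<Rightarrow> bool" where
  "uniform K A F \<longleftrightarrow> P1 A F \<and>
     (\<forall>x\<^sub>0. \<exists>c\<in>A. x\<^sub>0 \<in> fst c \<and> (\<forall>x\<in>fst c. \<forall>a\<in>tangent_space A x.
        1 / K * F (x, a) \<le> norm (dchart c a) \<and> norm (dchart c a) \<le> K * F (x, a)))"

definition finsler_manifold ::
    "enat \<Rightarrow> ('m::t2_space, 'x::banach) chart set \<Rightarrow> ('m, 'x) finsler \<Rightarrow> bool" where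
  "finsler_manifold l A F \<longleftrightarrow> banach_manifold l A \<and>
     continuous_map (tangent_topology A) euclideanreal F \<and> neeb_upmeier A F"


section \<open>Finsler metric and bump functions\<close>

definition C1_path_on ::
    "('m::topological_space, 'x::real_normed_vector) chart set
       \<Rightarrow> real \<Rightarrow> real \<Rightarrow> (real \<Rightarrow> 'm) \<Rightarrow> bool" where
  "C1_path_on A s t \<gamma> \<longleftrightarrow> continuous_on {s..t} \<gamma> \<and>
     (\<forall>c\<in>A. \<exists>u. continuous_on ({s..t} \<inter> \<gamma> -` fst c) u \<and>
        (\<forall>r \<in> {s..t} \<inter> \<gamma> -` fst c.
           ((snd c \<circ> \<gamma>) has_vector_derivative u r) (at r within {s..t})))"

text \<open>
  The pieces are required to be \<open>C\<^sup>1\<close> on closed intervals, with one-sided derivatives at the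
  end points; this is stronger than \<open>piecewise_C1_differentiable_on\<close>, which allows derivatives
  that are unbounded near a break point.
\<close>

definition piecewise_C1_path ::
    "('m::topological_space, 'x::real_normed_vector) chart set
       \<Rightarrow> real \<Rightarrow> real \<Rightarrow> (real \<Rightarrow> 'm) \<Rightarrow> bool" where
  "piecewise_C1_path A a b \<gamma> \<longleftrightarrow>
     (\<exists>n \<tau>. \<tau> 0 = a \<and> \<tau> n = b \<and>
        (\<forall>i<n. \<tau> i < \<tau> (Suc i) \<and> C1_path_on A (\<tau> i) (\<tau> (Suc i)) \<gamma>))"

text \<open>
  At a break point the velocity may be the empty set instead of a tangent vector; these
  finitely many points do not contribute to the length.
\<close>

definition velocity ::
    "('m, 'x::real_normed_vector) chart set \<Rightarrow> real \<Rightarrow> real \<Rightarrow> (real \<Rightarrow> 'm) \<Rightarrow> real \<Rightarrow> ('m, 'x) tvec" where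
  "velocity A a b \<gamma> t = {(c, v). c \<in> A \<and> \<gamma> t \<in> fst c \<and>
     ((snd c \<circ> \<gamma>) has_vector_derivative v) (at t within {a..b})}"

definition path_len ::
    "('m, 'x::real_normed_vector) chart set \<Rightarrow> ('m, 'x) finsler
       \<Rightarrow> real \<Rightarrow> real \<Rightarrow> (real \<Rightarrow> 'm) \<Rightarrow> real" where
  "path_len A F a b \<gamma> = integral {a..b} (\<lambda>t. F (\<gamma> t, velocity A a b \<gamma> t))"

text \<open>If no path joins \<open>p\<close> to \<open>q\<close>, the infimum of the empty set is \<open>\<infinity>\<close>.\<close>

definition finsler_dist ::
    "('m::topological_space, 'x::real_normed_vector) chart set \<Rightarrow> ('m, 'x) finsler
       \<Rightarrow> 'm \<Rightarrow> 'm \<Rightarrow> ennreal" where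
  "finsler_dist A F p q = Inf {ennreal (path_len A F a b \<gamma>) | a b \<gamma>.
     a < b \<and> piecewise_C1_path A a b \<gamma> \<and> \<gamma> a = p \<and> \<gamma> b = q}"

definition dfun_norm ::
    "('m, 'x::real_normed_vector) chart set \<Rightarrow> ('m, 'x) finsler \<Rightarrow> ('m \<Rightarrow> real) \<Rightarrow> 'm \<Rightarrow> ennreal" where
  "dfun_norm A F b p =
     (SUP a \<in> {a \<in> tangent_space A p. F (p, a) \<le> 1}. ennreal \<bar>dfun b p a\<bar>)"

definition uniformly_bumpable ::
    "enat \<Rightarrow> ('m::topological_space, 'x::real_normed_vector) chart set \<Rightarrow> ('m, 'x) finsler \<Rightarrow> bool" where
  "uniformly_bumpable m A F \<longleftrightarrow>
     (\<exists>R>1. \<exists>r>0. \<forall>p. \<forall>\<delta>. 0 < \<delta> \<and> \<delta> < r \<longrightarrow>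
        (\<exists>b. smooth_fun m A b \<and> (\<forall>q. 0 \<le> b q \<and> b q \<le> 1) \<and> b p = 1 \<and>
             (\<forall>q. finsler_dist A F p q \<ge> ennreal \<delta> \<longrightarrow> b q = 0) \<and>
             (SUP q. dfun_norm A F b q) \<le> ennreal (R / \<delta>)))"

end

theory Submission
  imports Defs "HOL-Computational_Algebra.Polynomial"
begin

text \<open>
  Both alternatives of the hypothesis give, around every point, a chart and an equivalent norm on the
  model space that is comparable to the Finsler norm up to a fixed constant and has the approximation
  property with a fixed constant. Call a function on the manifold Lipschitz if it is so, with one constant, in
  all these patches. Tents on the patches, indexed along a well-order, yield as in Rudin's proof of
  Stone's theorem a cover consisting of countably many layers of pairwise separated open sets, given
  by Lipschitz functions. Smoothing those functions in the patches gives a smooth partition of unity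
  whose \<open>n\<close>-th members have Lipschitz constants bounded in terms of \<open>n\<close> only. The function
  \<open>f = min \<delta> d(p, \<cdot>)\<close> is Lipschitz, as a path to \<open>y\<close> can be extended by a segment in a patch; replacing
  it in the \<open>n\<close>-th layer by a smooth approximation with an error small compared to those constants and
  gluing gives a smooth \<open>g\<close> close to \<open>f\<close> with a Lipschitz constant independent of \<open>p\<close> and \<open>\<delta>\<close>. A smooth
  step function of \<open>g/\<delta>\<close> is the bump function.
\<close>

section \<open>Calculus of smooth maps\<close>

text \<open>The obstacle is quantitative. A locally finite partition of unity comes without bounds
  on its derivatives, as neither the number of overlapping patches nor their radii are controlled,
  whereas the bump constant must not depend on the point. What survives arbitrary overlap is a
  supremum: the tents of smaller index may be infinitely many, yet their supremum keeps Lipschitz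
  constant 1. Hence the layer \<open>n\<close> is separated at the scale \<open>(1/2) ^ n\<close>,
  and near a given point at most one of its members contributes. The Lipschitz constants of the
  weights then depend on \<open>n\<close> alone, and the approximation errors can be chosen against
  them in advance.

  As the weights sum to 1, their differences get multiplied by errors instead of values of
  \<open>f\<close>, and the sum of error times constant is made at most 1. The resulting constant is
  \<open>K * (2 * Ls * (kap * C0 * K + 1)) + 2\<close>, where \<open>Ls\<close> belongs to the step
  function and \<open>kap = K * K + 1\<close> is the price of changing patches. Paracompactness
  enters through regularity, by which a tent can be extended by zero beyond its patch.\<close>

definition multilin :: "nat \<Rightarrow> ('a::real_vector list \<Rightarrow> 'b::real_vector) \<Rightarrow> bool" where
  "multilin n T \<longleftrightarrow> (\<forall>us ws. length us + Suc (length ws) = n \<longrightarrow> linear (\<lambda>v. T (us @ v # ws)))"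

lemma multilin_Cons:
  assumes "multilin (Suc n) T"
  shows "multilin n (\<lambda>vs. T (v # vs))"
  unfolding multilin_def
proof (intro allI impI)
  fix us ws :: "'a list"
  assume "length us + Suc (length ws) = n"
  then have "linear (\<lambda>w. T ((v # us) @ w # ws))"
    using assms unfolding multilin_def by (metis add_Suc length_Cons)
  then show "linear (\<lambda>w. T (v # us @ w # ws))" by simp
qed

lemma multilin_head:
  assumes "multilin (Suc n) T" "length ws = n"
  shows "linear (\<lambda>v. T (v # ws))"
proof -
  have "linear (\<lambda>v. T ([] @ v # ws))"
    using assms unfolding multilin_def by (metis add_0 list.size(3))
  then show ?thesis by simp
qed

lemma multilin_diff:
  assumes "multilin n S" "multilin n T"
  shows "multilin n (\<lambda>vs. S vs - T vs)"
  using assms unfolding multilin_def by (auto intro: linear_compose_sub)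

lemma linear_unit_bound:
  fixes f :: "'a::real_normed_vector \<Rightarrow> 'b::real_normed_vector"
  assumes "linear f" and b: "\<And>v. norm v \<le> 1 \<Longrightarrow> norm (f v) \<le> C"
  shows "norm (f v) \<le> C * norm v"
proof (cases "v = 0")
  case True
  then show ?thesis using linear_0[OF assms(1)] by simp
next
  case False
  have "f v = norm v *\<^sub>R f (v /\<^sub>R norm v)"
    using False by (simp add: linear_cmul[OF assms(1)])
  moreover have "norm (f (v /\<^sub>R norm v)) \<le> C"
    using False by (intro b) simp
  ultimately show ?thesis
    by (metis abs_norm_cancel mult.commute mult_left_mono norm_ge_zero norm_scaleR)
qed

lemma unit_lists_Cons [simp]: "v # vs \<in> unit_lists (Suc n) \<longleftrightarrow> norm v \<le> 1 \<and> vs \<in> unit_lists n"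
  by (auto simp: unit_lists_def)

lemma unit_lists_0 [simp]: "unit_lists 0 = {[]}"
  by (auto simp: unit_lists_def)

text \<open>Linearity in the first slot turns the bound \<open>C\<close> on unit lists into
  \<open>C * norm v\<close> for the remaining slots, and induction does the rest. Hence
  \<open>multilin\<close> can leave out the norm bound of \<open>bounded_multilinear\<close>:
  boundedness on \<open>unit_lists\<close> restores it.\<close>

lemma multilin_bound:
  assumes "multilin n T" "\<And>vs. vs \<in> unit_lists n \<Longrightarrow> norm (T vs) \<le> C" "length vs = n"
  shows "norm (T vs) \<le> C * prod_list (map norm vs)"
  using assms
proof (induction n arbitrary: T C vs)
  case 0
  then show ?case by simp
next
  case (Suc n)
  then obtain v ws where vs: "vs = v # ws" and len: "length ws = n"
    by (metis length_Suc_conv)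
  have "norm (T (v # us)) \<le> C * norm v" if "us \<in> unit_lists n" for us
    using that Suc.prems(2)
    by (intro linear_unit_bound multilin_head[OF Suc.prems(1)]) (auto simp: unit_lists_def)
  from Suc.IH[OF multilin_Cons[OF Suc.prems(1)] this len]
  show ?case by (simp add: vs mult.assoc)
qed

section \<open>Uniform limits of families, and plugging maps into multilinear slots\<close>

text \<open>Boundedness at \<open>x\<close> is included because product estimates need it. The index
  set is abstract so that, besides unit lists, it can carry further directions as parameters. For
  multilinear families over unit lists this is continuity in the operator norm.\<close>

definition ucont :: "'s set \<Rightarrow> ('a::real_normed_vector \<Rightarrow> 's \<Rightarrow> 'b::real_normed_vector) \<Rightarrow> 'a \<Rightarrow> bool" where
  "ucont S f x \<longleftrightarrow> (\<exists>C. \<forall>s\<in>S. norm (f x s) \<le> C) \<and> uniform_limit S f (f x) (at x)"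

lemma ucont_reindex:
  assumes "ucont S f x" "\<And>s. s \<in> S' \<Longrightarrow> h s \<in> S"
  shows "ucont S' (\<lambda>y s. f y (h s)) x"
proof -
  have "uniform_limit S' (\<lambda>y s. f y (h s)) (\<lambda>s. f x (h s)) (at x)"
    using assms unfolding ucont_def uniform_limit_iff
    by (auto elim!: allE eventually_mono)
  then show ?thesis using assms unfolding ucont_def by blast
qed

lemma ucont_cong:
  assumes "open U" "x \<in> U" "\<And>y s. y \<in> U \<Longrightarrow> s \<in> S \<Longrightarrow> f y s = g y s" "ucont S f x"
  shows "ucont S g x"
proof -
  have "\<forall>\<^sub>F y in at x. y \<in> U"
    using assms(1,2) eventually_at_topological by blast
  moreover have "uniform_limit S f (f x) (at x)"
    using assms(4) by (simp add: ucont_def)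
  ultimately have "uniform_limit S g (g x) (at x)"
    unfolding uniform_limit_iff
  proof (intro allI impI)
    fix e :: real assume "e > 0" and "\<forall>\<^sub>F y in at x. y \<in> U"
      and "\<forall>e>0. \<forall>\<^sub>F y in at x. \<forall>s\<in>S. dist (f y s) (f x s) < e"
    then have "\<forall>\<^sub>F y in at x. y \<in> U" "\<forall>\<^sub>F y in at x. \<forall>s\<in>S. dist (f y s) (f x s) < e"
      by auto
    then show "\<forall>\<^sub>F y in at x. \<forall>s\<in>S. dist (g y s) (g x s) < e"
      by eventually_elim (use assms(2,3) in auto)
  qed
  moreover have "\<exists>C. \<forall>s\<in>S. norm (g x s) \<le> C"
    using assms unfolding ucont_def by metis
  ultimately show ?thesis unfolding ucont_def by blast
qed

lemma ucont_add:
  assumes "ucont S f x" "ucont S g x"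
  shows "ucont S (\<lambda>y s. f y s + g y s) x"
proof -
  obtain C D where "\<forall>s\<in>S. norm (f x s) \<le> C" "\<forall>s\<in>S. norm (g x s) \<le> D"
    using assms unfolding ucont_def by blast
  then have "\<forall>s\<in>S. norm (f x s + g x s) \<le> C + D"
    by (meson add_mono norm_triangle_le)
  then show ?thesis
    using assms unfolding ucont_def by (auto intro!: uniform_limit_add)
qed

lemma ucont_continuous:
  assumes "ucont S f x" "s \<in> S"
  shows "continuous (at x) (\<lambda>y. f y s)"
  using assms unfolding ucont_def continuous_at
  by (auto intro: tendsto_uniform_limitI)

lemma ucont_compose:
  assumes "ucont S f (T x)" "continuous (at x) T"
  shows "ucont S (\<lambda>y s. f (T y) s) x"
proof -
  have "\<forall>\<^sub>F y in at x. \<forall>s\<in>S. dist (f (T y) s) (f (T x) s) < e" if "e > 0" for e :: real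
  proof -
    have "\<forall>\<^sub>F z in at (T x). \<forall>s\<in>S. dist (f z s) (f (T x) s) < e"
      using assms(1) that unfolding ucont_def uniform_limit_iff by blast
    then have "\<forall>\<^sub>F z in nhds (T x). \<forall>s\<in>S. dist (f z s) (f (T x) s) < e"
      unfolding eventually_at_filter by (rule eventually_mono) (use that in auto)
    moreover have "filterlim T (nhds (T x)) (at x)"
      using assms(2) by (simp add: continuous_at)
    ultimately show ?thesis
      by (rule eventually_compose_filterlim)
  qed
  then show ?thesis
    using assms(1) unfolding ucont_def uniform_limit_iff by blast
qed

text \<open>The difference splits as
  \<open>(\<Gamma> y - \<Gamma> x) (c y) + \<Gamma> x (c y - c x)\<close>; linearity in the first
  slot lets the uniform estimates on unit vectors be applied to \<open>c y\<close> and
  \<open>c y - c x\<close>. The remaining slots \<open>ys\<close> and the parameter \<open>s\<close>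
  are carried along, so plugging can be iterated.\<close>

lemma ucont_plug:
  fixes \<Gamma> :: "'a::real_normed_vector \<Rightarrow> 'y::real_normed_vector list \<times> 's \<Rightarrow> 'w::real_normed_vector"
  assumes U: "open U" "x \<in> U"
    and ml: "\<And>y s. y \<in> U \<Longrightarrow> s \<in> S \<Longrightarrow> multilin (Suc p) (\<lambda>ys. \<Gamma> y (ys, s))"
    and \<Gamma>: "ucont (unit_lists (Suc p) \<times> S) \<Gamma> x" and c: "ucont S c x"
  shows "ucont (unit_lists p \<times> S) (\<lambda>y (ys, s). \<Gamma> y (c y s # ys, s)) x"
proof -
  obtain C0 D0 where C0: "\<forall>s \<in> unit_lists (Suc p) \<times> S. norm (\<Gamma> x s) \<le> C0"
    and D0: "\<forall>s\<in>S. norm (c x s) \<le> D0"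
    using \<Gamma> c unfolding ucont_def by blast
  define C D where "C = \<bar>C0\<bar>" and "D = \<bar>D0\<bar>"
  have CD: "C \<ge> 0" "D \<ge> 0" by (auto simp: C_def D_def)
  have len: "length ys = p" if "ys \<in> unit_lists p" for ys :: "'y list"
    using that by (simp add: unit_lists_def)
  have C: "norm (\<Gamma> x (v # ys, s)) \<le> C * norm v" if "ys \<in> unit_lists p" "s \<in> S" for v ys s
  proof (rule linear_unit_bound[where f="\<lambda>v. \<Gamma> x (v # ys, s)"])
    show "linear (\<lambda>v. \<Gamma> x (v # ys, s))"
      by (rule multilin_head[OF ml[OF U(2) that(2)] len[OF that(1)]])
    fix v :: 'y assume "norm v \<le> 1"
    then have "norm (\<Gamma> x (v # ys, s)) \<le> C0" using C0 that by simp
    then show "norm (\<Gamma> x (v # ys, s)) \<le> C" by (simp add: C_def)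
  qed
  have D: "norm (c x s) \<le> D" if "s \<in> S" for s
    using that D0 by (force simp: D_def)
  have "norm (\<Gamma> x (c x s # ys, s)) \<le> C * D" if "ys \<in> unit_lists p" "s \<in> S" for ys s
    using C[OF that, of "c x s"] D[OF that(2)] CD
    by (meson mult_left_mono order_trans)
  then have 1: "\<exists>C. \<forall>s\<in>unit_lists p \<times> S. norm ((\<lambda>(ys, s). \<Gamma> x (c x s # ys, s)) s) \<le> C"
    by (intro exI[of _ "C * D"]) auto
  have 2: "\<forall>\<^sub>F y in at x. \<forall>s\<in>unit_lists p \<times> S.
      dist (case s of (ys, s) \<Rightarrow> \<Gamma> y (c y s # ys, s)) (case s of (ys, s) \<Rightarrow> \<Gamma> x (c x s # ys, s)) < e"
    if e: "e > 0" for e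
  proof -
    \<comment> \<open>Each of the two terms of the splitting gets \<open>e / 2\<close>; the
      \<open>min 1\<close> keeps \<open>norm (c y s)\<close> at most \<open>D + 1\<close>, and the
      summands 1 in the denominators avoid division by zero.\<close>
    define e1 where "e1 = e / (2 * (D + 1))"
    define e2 where "e2 = min 1 (e / (2 * (C + 1)))"
    have pos: "e1 > 0" "e2 > 0" using e CD by (auto simp: e1_def e2_def)
    have inU: "\<forall>\<^sub>F y in at x. y \<in> U"
      using U eventually_at_topological by blast
    have E1: "\<forall>\<^sub>F y in at x. \<forall>s\<in>unit_lists (Suc p) \<times> S. dist (\<Gamma> y s) (\<Gamma> x s) < e1"
      using \<Gamma> pos unfolding ucont_def uniform_limit_iff by blast
    have E2: "\<forall>\<^sub>F y in at x. \<forall>s\<in>S. dist (c y s) (c x s) < e2"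
      using c pos unfolding ucont_def uniform_limit_iff by blast
    show ?thesis
      using inU E1 E2
    proof eventually_elim
      case (elim y)
      have "dist (\<Gamma> y (c y s # ys, s)) (\<Gamma> x (c x s # ys, s)) < e"
        if ys: "ys \<in> unit_lists p" and s: "s \<in> S" for ys s
      proof -
        have lin: "linear (\<lambda>v. \<Gamma> x (v # ys, s))" "linear (\<lambda>v. \<Gamma> y (v # ys, s))"
          using multilin_head[OF ml len[OF ys]] U elim s by auto
        have d: "norm (c y s - c x s) < e2"
          using elim s by (simp add: dist_norm)
        have n: "norm (c y s) \<le> D + 1"
        proof -
          have "norm (c y s) \<le> norm (c x s) + norm (c y s - c x s)"
            by (metis add.commute diff_add_cancel norm_triangle_ineq)
          also have "\<dots> \<le> D + 1" using D[OF s] d by (auto simp: e2_def)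
          finally show ?thesis .
        qed
        have "norm (\<Gamma> y (c y s # ys, s) - \<Gamma> x (c y s # ys, s)) \<le> e1 * norm (c y s)"
        proof (rule linear_unit_bound[where f="\<lambda>v. \<Gamma> y (v # ys, s) - \<Gamma> x (v # ys, s)"])
          fix v :: 'y assume "norm v \<le> 1"
          then have "dist (\<Gamma> y (v # ys, s)) (\<Gamma> x (v # ys, s)) < e1"
            using elim(2) ys s by auto
          then show "norm (\<Gamma> y (v # ys, s) - \<Gamma> x (v # ys, s)) \<le> e1"
            by (simp add: dist_norm)
        qed (intro linear_compose_sub lin)
        also have "\<dots> \<le> e1 * (D + 1)" using n pos by simp
        also have "\<dots> = e / 2" using CD by (simp add: e1_def field_simps)
        finally have A: "norm (\<Gamma> y (c y s # ys, s) - \<Gamma> x (c y s # ys, s)) \<le> e / 2" .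
        have "norm (\<Gamma> x (c y s # ys, s) - \<Gamma> x (c x s # ys, s)) = norm (\<Gamma> x ((c y s - c x s) # ys, s))"
          by (simp add: linear_diff[OF lin(1)])
        also have "\<dots> \<le> C * norm (c y s - c x s)" by (rule C[OF ys s])
        also have "\<dots> \<le> C * e2" using d CD by (simp add: mult_left_mono)
        also have "\<dots> \<le> C * (e / (2 * (C + 1)))" unfolding e2_def using CD by (intro mult_left_mono) auto
        also have "\<dots> < e / 2" using CD e by (simp add: field_simps)
        finally have B: "norm (\<Gamma> x (c y s # ys, s) - \<Gamma> x (c x s # ys, s)) < e / 2" .
        show ?thesis
          using norm_triangle_ineq[of "\<Gamma> y (c y s # ys, s) - \<Gamma> x (c y s # ys, s)"
              "\<Gamma> x (c y s # ys, s) - \<Gamma> x (c x s # ys, s)"] A B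
          by (simp add: dist_norm)
      qed
      then show ?case by auto
    qed
  qed
  show ?thesis
    using 1 2 unfolding ucont_def uniform_limit_iff by auto
qed

lemma ucont_plug_list:
  fixes \<Gamma> :: "'a::real_normed_vector \<Rightarrow> 'y::real_normed_vector list \<times> 's \<Rightarrow> 'w::real_normed_vector"
  assumes U: "open U" "x \<in> U"
    and "\<And>y s. y \<in> U \<Longrightarrow> s \<in> S \<Longrightarrow> multilin (length cs) (\<lambda>ys. \<Gamma> y (ys, s))"
    and "ucont (unit_lists (length cs) \<times> S) \<Gamma> x"
    and "\<And>c. c \<in> set cs \<Longrightarrow> ucont S c x"
  shows "ucont S (\<lambda>y s. \<Gamma> y (map (\<lambda>c. c y s) cs, s)) x"
  using assms(3-5)
proof (induction cs arbitrary: \<Gamma>)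
  case Nil
  have "ucont S (\<lambda>y s. \<Gamma> y ([], s)) x"
    using Nil(2) by (rule ucont_reindex) auto
  then show ?case by simp
next
  case (Cons c cs)
  let ?\<Gamma> = "\<lambda>y (ys, s). \<Gamma> y (c y s # ys, s)"
  have "ucont (unit_lists (length cs) \<times> S) ?\<Gamma> x"
    using Cons.prems by (intro ucont_plug[OF U]) auto
  moreover have "multilin (length cs) (\<lambda>ys. ?\<Gamma> y (ys, s))" if "y \<in> U" "s \<in> S" for y s
    using multilin_Cons Cons.prems(1)[OF that] by fastforce
  ultimately have "ucont S (\<lambda>y s. ?\<Gamma> y (map (\<lambda>c. c y s) cs, s)) x"
    by (intro Cons.IH) (auto simp: Cons.prems)
  then show ?case by simp
qed

text \<open>The product rule: \<open>\<Gamma> y (c y)\<close> is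
  \<open>\<Gamma> y (c x) + \<Gamma> x (c y) - \<Gamma> x (c x)\<close> plus a remainder
  \<open>r y\<close>, the value of \<open>\<Gamma> y - \<Gamma> x\<close> at
  \<open>c y - c x\<close>. The former tends to 0 in operator norm and the latter is of order
  \<open>norm (y - x)\<close>, so \<open>r\<close> has derivative 0.\<close>

lemma has_derivative_plug:
  fixes \<Gamma> :: "'a::real_normed_vector \<Rightarrow> 'y::real_normed_vector list \<Rightarrow> 'w::real_normed_vector"
  assumes U: "open U" "x \<in> U"
    and ml: "\<And>y. y \<in> U \<Longrightarrow> multilin (Suc p) (\<Gamma> y)"
    and \<Gamma>: "ucont (unit_lists (Suc p)) \<Gamma> x"
    and \<Gamma>': "\<And>ys. length ys = Suc p \<Longrightarrow> ((\<lambda>y. \<Gamma> y ys) has_derivative (\<lambda>v. \<Gamma>' v ys)) (at x)"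
    and c: "(c has_derivative c') (at x)" and len: "length ys = p"
  shows "((\<lambda>y. \<Gamma> y (c y # ys)) has_derivative (\<lambda>v. \<Gamma>' v (c x # ys) + \<Gamma> x (c' v # ys))) (at x)"
proof -
  define P where "P = prod_list (map norm ys)"
  have P: "P \<ge> 0" unfolding P_def by (rule prod_list_nonneg) auto
  obtain C where C: "\<forall>s \<in> unit_lists (Suc p). norm (\<Gamma> x s) \<le> C"
    using \<Gamma> unfolding ucont_def by blast
  have bnd: "norm (\<Gamma> x (v # ys)) \<le> C * (norm v * P)" for v
    using multilin_bound[OF ml[OF U(2)], of C "v # ys"] C len by (simp add: P_def)
  have bl: "bounded_linear (\<lambda>v. \<Gamma> x (v # ys))"
    using bnd multilin_head[OF ml[OF U(2)] len]
    by (intro bounded_linear_intro[of _ "C * P"])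
      (auto simp: linear_iff algebra_simps)
  have 1: "((\<lambda>y. \<Gamma> x (c y # ys)) has_derivative (\<lambda>v. \<Gamma> x (c' v # ys))) (at x)"
    by (rule bounded_linear.has_derivative[OF bl c])
  have 2: "((\<lambda>y. \<Gamma> y (c x # ys)) has_derivative (\<lambda>v. \<Gamma>' v (c x # ys))) (at x)"
    by (rule \<Gamma>') (simp add: len)
  define r where "r y = \<Gamma> y ((c y - c x) # ys) - \<Gamma> x ((c y - c x) # ys)" for y
  have 3: "(r has_derivative (\<lambda>v. 0)) (at x)"
    unfolding has_derivative_at_alt
  proof (intro conjI allI impI)
    fix e :: real assume e: "e > 0"
    obtain M where M: "M > 0" "\<And>v. norm (c' v) \<le> norm v * M"
      using bounded_linear.pos_bounded[OF has_derivative_bounded_linear[OF c]] by blast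
    obtain d1 where d1: "d1 > 0"
      "\<And>y. norm (y - x) < d1 \<Longrightarrow> norm (c y - c x - c' (y - x)) \<le> 1 * norm (y - x)"
      using c unfolding has_derivative_at_alt by (meson zero_less_one)
    \<comment> \<open>\<open>M + 1\<close> bounds the difference quotients of \<open>c\<close> near
      \<open>x\<close> (the 1 is the accuracy in \<open>d1\<close>), and \<open>P\<close> accounts
      for the other slots.\<close>
    define \<omega> where "\<omega> = e / ((M + 1) * (P + 1))"
    have \<omega>: "\<omega> > 0" using e M P by (simp add: \<omega>_def)
    have "\<forall>\<^sub>F y in at x. \<forall>s\<in>unit_lists (Suc p). dist (\<Gamma> y s) (\<Gamma> x s) < \<omega>"
      using \<Gamma> \<omega> unfolding ucont_def uniform_limit_iff by blast
    moreover have "\<forall>\<^sub>F y in at x. y \<in> U"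
      using U eventually_at_topological by blast
    ultimately have "\<forall>\<^sub>F y in at x. y \<in> U \<and> (\<forall>s\<in>unit_lists (Suc p). dist (\<Gamma> y s) (\<Gamma> x s) < \<omega>)"
      by eventually_elim auto
    then obtain d2 where d2: "d2 > 0"
      "\<And>y. y \<noteq> x \<Longrightarrow> dist y x < d2 \<Longrightarrow> y \<in> U \<and> (\<forall>s\<in>unit_lists (Suc p). dist (\<Gamma> y s) (\<Gamma> x s) < \<omega>)"
      unfolding eventually_at by blast
    show "\<exists>d>0. \<forall>y. norm (y - x) < d \<longrightarrow> norm (r y - r x - 0) \<le> e * norm (y - x)"
    proof (intro exI[of _ "min d1 d2"] conjI allI impI)
      fix y assume y: "norm (y - x) < min d1 d2"
      show "norm (r y - r x - 0) \<le> e * norm (y - x)"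
      proof (cases "y = x")
        case False
        then have yU: "y \<in> U" and dy: "\<forall>s\<in>unit_lists (Suc p). dist (\<Gamma> y s) (\<Gamma> x s) < \<omega>"
          using d2(2)[OF False] y by (auto simp: dist_norm)
        have rx: "r x = 0" unfolding r_def by simp
        have "norm (c y - c x) \<le> norm (c y - c x - c' (y - x)) + norm (c' (y - x))"
          by (metis diff_add_cancel norm_triangle_ineq)
        also have "\<dots> \<le> (M + 1) * norm (y - x)"
          using d1(2)[of y] M(2)[of "y - x"] y by (simp add: algebra_simps)
        finally have cc: "norm (c y - c x) \<le> (M + 1) * norm (y - x)" .
        have "norm (\<Gamma> y ((c y - c x) # ys) - \<Gamma> x ((c y - c x) # ys))
            \<le> \<omega> * prod_list (map norm ((c y - c x) # ys))"
          using dy len by (intro multilin_bound[OF multilin_diff[OF ml[OF yU] ml[OF U(2)]]])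
            (auto simp: dist_norm intro: less_imp_le)
        then have "norm (r y) \<le> \<omega> * (norm (c y - c x) * P)"
          by (simp add: r_def P_def)
        also have "\<dots> \<le> \<omega> * (((M + 1) * norm (y - x)) * (P + 1))"
          using cc \<omega> P M by (intro mult_left_mono mult_mono) auto
        also have "\<dots> = e * norm (y - x)"
          using M P by (simp add: \<omega>_def)
        finally show ?thesis by (simp add: rx)
      qed simp
    qed (use d1 d2 in auto)
  qed simp
  have s: "((\<lambda>y. \<Gamma> y (c x # ys) + \<Gamma> x (c y # ys) + r y - \<Gamma> x (c x # ys)) has_derivative
      (\<lambda>v. \<Gamma>' v (c x # ys) + \<Gamma> x (c' v # ys))) (at x)"
    using has_derivative_diff[OF has_derivative_add[OF has_derivative_add[OF 2 1] 3] has_derivative_const[of "\<Gamma> x (c x # ys)"]]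
    by simp
  show ?thesis
  proof (rule has_derivative_transform_within_open[OF s U])
    fix y assume y: "y \<in> U"
    show "\<Gamma> y (c x # ys) + \<Gamma> x (c y # ys) + r y - \<Gamma> x (c x # ys) = \<Gamma> y (c y # ys)"
      using linear_diff[OF multilin_head[OF ml[OF y] len]] linear_diff[OF multilin_head[OF ml[OF U(2)] len]]
      by (simp add: r_def)
  qed
qed

text \<open>Each plug adds one product-rule term, which is absorbed into the derivative
  \<open>\<Gamma>'\<close> of the next family; therefore both \<open>\<Gamma>\<close> and
  \<open>\<Gamma>'\<close> vary in the induction.\<close>

lemma has_derivative_plug_list:
  fixes \<Gamma> :: "'a::real_normed_vector \<Rightarrow> 'y::real_normed_vector list \<Rightarrow> 'w::real_normed_vector"
  assumes U: "open U" "x \<in> U"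
    and "\<And>y. y \<in> U \<Longrightarrow> multilin (length cs) (\<Gamma> y)"
    and "ucont (unit_lists (length cs)) \<Gamma> x"
    and "\<And>ys. length ys = length cs \<Longrightarrow> ((\<lambda>y. \<Gamma> y ys) has_derivative (\<lambda>v. \<Gamma>' v ys)) (at x)"
    and "list_all2 (\<lambda>c c'. (c has_derivative c') (at x)) cs cs'"
  shows "((\<lambda>y. \<Gamma> y (map (\<lambda>c. c y) cs)) has_derivative
      (\<lambda>v. \<Gamma>' v (map (\<lambda>c. c x) cs) + (\<Sum>i<length cs. \<Gamma> x ((map (\<lambda>c. c x) cs)[i := (cs' ! i) v])))) (at x)"
  using assms(3-6)
proof (induction cs arbitrary: \<Gamma> \<Gamma>' cs')
  case Nil
  then show ?case by simp
next
  case (Cons c cs)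
  then obtain c' ds where cs': "cs' = c' # ds" and c': "(c has_derivative c') (at x)"
    and ds: "list_all2 (\<lambda>c c'. (c has_derivative c') (at x)) cs ds"
    by (auto simp: list_all2_Cons1)
  let ?\<Gamma> = "\<lambda>y ys. \<Gamma> y (c y # ys)"
  let ?\<Gamma>' = "\<lambda>v ys. \<Gamma>' v (c x # ys) + \<Gamma> x (c' v # ys)"
  have ml: "multilin (length cs) (?\<Gamma> y)" if "y \<in> U" for y
    using multilin_Cons Cons.prems(1)[OF that] by fastforce
  \<comment> \<open>There is no further parameter, so the one-point set \<open>{()}\<close> takes
    its place in \<open>ucont_plug\<close>.\<close>
  have "ucont (unit_lists (Suc (length cs)) \<times> {()}) (\<lambda>y (ys, s). \<Gamma> y ys) x"
    using ucont_reindex[OF Cons.prems(2), of "unit_lists (Suc (length cs)) \<times> {()}" fst]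
    by (auto simp: case_prod_unfold)
  moreover have "ucont {()} (\<lambda>y _. c y) x"
    using has_derivative_continuous[OF c'] unfolding ucont_def continuous_at by auto
  ultimately have "ucont (unit_lists (length cs) \<times> {()}) (\<lambda>y (ys, s). ?\<Gamma> y ys) x"
    using Cons.prems(1)
      ucont_plug[OF U, of "{()}" "length cs" "\<lambda>y (ys, s). \<Gamma> y ys" "\<lambda>y _. c y"] by simp
  then have ucont: "ucont (unit_lists (length cs)) ?\<Gamma> x"
    using ucont_reindex[of _ _ x "unit_lists (length cs)" "\<lambda>ys. (ys, ())"] by fastforce
  have der: "((\<lambda>y. ?\<Gamma> y ys) has_derivative (\<lambda>v. ?\<Gamma>' v ys)) (at x)" if "length ys = length cs" for ys
    using Cons.prems that by (intro has_derivative_plug[OF U _ _ _ c']) auto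
  show ?case
    using Cons.IH[OF ml ucont der ds] unfolding cs'
    by (simp add: sum.lessThan_Suc_shift add.assoc del: sum.lessThan_Suc)
qed

section \<open>Smoothness as a recursion on the order of differentiation\<close>

text \<open>In the new direction linearity comes from the derivative itself. In an old one, both
  sides of the linearity equation are derivatives of functions that agree on \<open>U\<close>, and
  derivatives are unique.\<close>

lemma multilin_derivative:
  assumes U: "open U" and ml: "\<And>x. x \<in> U \<Longrightarrow> multilin n (E x)"
    and der: "\<And>x vs. x \<in> U \<Longrightarrow> length vs = n \<Longrightarrow>
      ((\<lambda>y. E y vs) has_derivative (\<lambda>v. E' x (v # vs))) (at x)"
    and x: "x \<in> U"
  shows "multilin (Suc n) (E' x)"
  unfolding multilin_def
proof (intro allI impI)
  fix us ws :: "'a list"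
  assume len: "length us + Suc (length ws) = Suc n"
  show "linear (\<lambda>v. E' x (us @ v # ws))"
  proof (cases us)
    case Nil
    then show ?thesis
      using has_derivative_linear[OF der[OF x, of ws]] len by simp
  next
    case (Cons u us')
    have l: "length us' + Suc (length ws) = n" using len Cons by simp
    then have lin: "linear (\<lambda>v. E y (us' @ v # ws))" if "y \<in> U" for y
      using ml[OF that] unfolding multilin_def by blast
    have d: "((\<lambda>y. E y (us' @ v # ws)) has_derivative (\<lambda>u. E' x (u # us' @ v # ws))) (at x)" for v
      using l by (intro der x) simp
    show ?thesis
    proof (rule linearI)
      fix v w
      have "((\<lambda>y. E y (us' @ v # ws) + E y (us' @ w # ws)) has_derivative
          (\<lambda>u. E' x (u # us' @ v # ws) + E' x (u # us' @ w # ws))) (at x)"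
        by (intro has_derivative_add d)
      then have "((\<lambda>y. E y (us' @ (v + w) # ws)) has_derivative
          (\<lambda>u. E' x (u # us' @ v # ws) + E' x (u # us' @ w # ws))) (at x)"
        by (rule has_derivative_transform_within_open[OF _ U x]) (simp add: linear_add[OF lin])
      from has_derivative_unique[OF d this]
      show "E' x (us @ (v + w) # ws) = E' x (us @ v # ws) + E' x (us @ w # ws)"
        unfolding Cons by (simp add: fun_eq_iff)
    next
      fix r v
      have "((\<lambda>y. r *\<^sub>R E y (us' @ v # ws)) has_derivative
          (\<lambda>u. r *\<^sub>R E' x (u # us' @ v # ws))) (at x)"
        by (intro has_derivative_scaleR_right d)
      then have "((\<lambda>y. E y (us' @ (r *\<^sub>R v) # ws)) has_derivative
          (\<lambda>u. r *\<^sub>R E' x (u # us' @ v # ws))) (at x)"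
        by (rule has_derivative_transform_within_open[OF _ U x]) (simp add: linear_scale[OF lin])
      from has_derivative_unique[OF d this]
      show "E' x (us @ (r *\<^sub>R v) # ws) = r *\<^sub>R E' x (us @ v # ws)"
        unfolding Cons by (simp add: fun_eq_iff)
    qed
  qed
qed

text \<open>
  The recursion on the order changes the number \<open>n\<close> of directions, but not the type of the family.
  Multilinearity is not part of the definition, since it is inherited by derivatives.
\<close>

primrec Ck_fam :: "nat \<Rightarrow> nat \<Rightarrow> 'a::real_normed_vector set \<Rightarrow> ('a \<Rightarrow> 'a list \<Rightarrow> 'b::real_normed_vector) \<Rightarrow> bool" where
  "Ck_fam 0 n U E \<longleftrightarrow> (\<forall>x\<in>U. ucont (unit_lists n) E x)"
| "Ck_fam (Suc k) n U E \<longleftrightarrow> (\<forall>x\<in>U. ucont (unit_lists n) E x) \<and>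
     (\<exists>E'. Ck_fam k (Suc n) U E' \<and> (\<forall>x\<in>U. \<forall>vs. length vs = n \<longrightarrow>
        ((\<lambda>y. E y vs) has_derivative (\<lambda>v. E' x (v # vs))) (at x)))"

lemma Ck_fam_ucont: "Ck_fam k n U E \<Longrightarrow> x \<in> U \<Longrightarrow> ucont (unit_lists n) E x"
  by (cases k) auto

lemma Ck_fam_SucD: "Ck_fam (Suc k) n U E \<Longrightarrow> Ck_fam k n U E"
proof (induction k arbitrary: n E)
  case (Suc k)
  then obtain E' where "Ck_fam (Suc k) (Suc n) U E'" "\<forall>x\<in>U. \<forall>vs. length vs = n \<longrightarrow>
        ((\<lambda>y. E y vs) has_derivative (\<lambda>v. E' x (v # vs))) (at x)"
    by (auto simp del: Ck_fam.simps(1) simp: Ck_fam.simps(2)[of "Suc k"])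
  then show ?case using Suc.IH[of "Suc n" E'] Suc.prems by auto
qed auto

lemma Ck_fam_subset: "Ck_fam k n U E \<Longrightarrow> V \<subseteq> U \<Longrightarrow> Ck_fam k n V E"
proof (induction k arbitrary: n E)
  case (Suc k)
  then obtain E' where "Ck_fam k (Suc n) U E'" "\<forall>x\<in>U. \<forall>vs. length vs = n \<longrightarrow>
        ((\<lambda>y. E y vs) has_derivative (\<lambda>v. E' x (v # vs))) (at x)"
    by auto
  then have "Ck_fam k (Suc n) V E'" "\<forall>x\<in>V. \<forall>vs. length vs = n \<longrightarrow>
        ((\<lambda>y. E y vs) has_derivative (\<lambda>v. E' x (v # vs))) (at x)"
    using Suc by auto
  then show ?case using Suc.prems by auto
qed auto

lemma Ck_fam_cong:
  assumes "open U" "\<And>x vs. x \<in> U \<Longrightarrow> length vs = n \<Longrightarrow> E x vs = F x vs" "Ck_fam k n U E"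
  shows "Ck_fam k n U F"
proof -
  have u: "ucont (unit_lists n) F x" if "x \<in> U" for x
    using Ck_fam_ucont[OF assms(3) that] assms(2)
    by (rule ucont_cong[OF assms(1) that, rotated]) (auto simp: unit_lists_def)
  show ?thesis
  proof (cases k)
    case (Suc j)
    then obtain E' where E': "Ck_fam j (Suc n) U E'" "\<And>x vs. x \<in> U \<Longrightarrow> length vs = n \<Longrightarrow>
        ((\<lambda>y. E y vs) has_derivative (\<lambda>v. E' x (v # vs))) (at x)"
      using assms(3) by auto
    have "((\<lambda>y. F y vs) has_derivative (\<lambda>v. E' x (v # vs))) (at x)" if "x \<in> U" "length vs = n" for x vs
      by (rule has_derivative_transform_within_open[OF E'(2)[OF that] assms(1) that(1)])
        (simp add: assms(2) that)
    then show ?thesis using Suc E'(1) u by auto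
  qed (use u in simp)
qed

lemma Ck_fam_zero: "Ck_fam k n U (\<lambda>x vs. 0)"
proof (induction k arbitrary: n)
  case (Suc k)
  then show ?case by (auto simp: ucont_def intro!: uniform_limit_const exI[of _ "\<lambda>x vs. 0"])
qed (auto simp: ucont_def intro!: uniform_limit_const)

lemma Ck_fam_add: "Ck_fam k n U E \<Longrightarrow> Ck_fam k n U F \<Longrightarrow> Ck_fam k n U (\<lambda>x vs. E x vs + F x vs)"
proof (induction k arbitrary: n E F)
  case (Suc k)
  then obtain E' F' where "Ck_fam k (Suc n) U E'" "Ck_fam k (Suc n) U F'"
    and "\<forall>x\<in>U. \<forall>vs. length vs = n \<longrightarrow> ((\<lambda>y. E y vs) has_derivative (\<lambda>v. E' x (v # vs))) (at x)"
    and "\<forall>x\<in>U. \<forall>vs. length vs = n \<longrightarrow> ((\<lambda>y. F y vs) has_derivative (\<lambda>v. F' x (v # vs))) (at x)"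
    by auto
  then show ?case
    using Suc by (auto intro!: ucont_add has_derivative_add exI[of _ "\<lambda>x vs. E' x vs + F' x vs"])
qed (auto intro: ucont_add)

lemma Ck_fam_sum:
  "(\<And>i. i \<in> I \<Longrightarrow> Ck_fam k n U (E i)) \<Longrightarrow> Ck_fam k n U (\<lambda>x vs. \<Sum>i\<in>I. E i x vs)"
  by (induction I rule: infinite_finite_induct) (auto intro: Ck_fam_zero Ck_fam_add)

text \<open>
  Every term of the Faa di Bruno formula has the form treated here: a derivative of the outer
  function, evaluated at derivatives of the inner one in selected directions. The derivative of
  such a term is a sum of terms of the same form.
\<close>

lemma Ck_fam_term:
  fixes H :: "'y::real_normed_vector \<Rightarrow> 'y list \<Rightarrow> 'w::real_normed_vector"
    and T :: "'a::real_normed_vector \<Rightarrow> 'y"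
    and bs :: "(('a \<Rightarrow> 'a list \<Rightarrow> 'y) \<times> nat \<times> ('a list \<Rightarrow> 'a list)) list"
  assumes U: "open U" and V: "open V" and TU: "T ` U \<subseteq> V"
    and "Ck_fam k p V H" "\<And>z. z \<in> V \<Longrightarrow> multilin p (H z)"
    and "Ck_fam k 0 U (\<lambda>x _. T x)" "length bs = p"
    and "\<And>E m sel. (E, m, sel) \<in> set bs \<Longrightarrow> Ck_fam k m U E \<and>
      (\<forall>vs. length vs = n \<longrightarrow> length (sel vs) = m) \<and>
      (\<forall>vs\<in>unit_lists n. sel vs \<in> unit_lists m)"
  shows "Ck_fam k n U (\<lambda>x vs. H (T x) (map (\<lambda>(E, m, sel). E x (sel vs)) bs))"
  using assms(4-8)
proof (induction k arbitrary: p n H bs)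
  case (0 p n H bs)
  show ?case
    unfolding Ck_fam.simps
  proof
    fix x assume x: "x \<in> U"
    have Tc: "continuous (at x) T"
      using ucont_continuous[OF Ck_fam_ucont[OF "0.prems"(3) x], of "[]"] by simp
    let ?\<Gamma> = "\<lambda>y (ys, s::'a list). H (T y) ys"
    let ?cs = "map (\<lambda>(E, m, sel) y vs. E y (sel vs)) bs"
    have "ucont (unit_lists p) H (T x)"
      using Ck_fam_ucont[OF "0.prems"(1)] TU x by auto
    then have "ucont (unit_lists p) (\<lambda>y ys. H (T y) ys) x"
      by (rule ucont_compose[OF _ Tc])
    then have G: "ucont (unit_lists p \<times> unit_lists n) ?\<Gamma> x"
      using ucont_reindex[of "unit_lists p" _ x "unit_lists p \<times> unit_lists n" fst]
      by (fastforce simp: case_prod_unfold)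
    have c: "ucont (unit_lists n) c x" if c_mem: "c \<in> set ?cs" for c
    proof -
      obtain b where b0: "b \<in> set bs" "c = (case b of (E, m, sel) \<Rightarrow> \<lambda>y vs. E y (sel vs))"
        using c_mem unfolding set_map by blast
      obtain E m sel where "b = (E, m, sel)" by (cases b)
      with b0 have b: "(E, m, sel) \<in> set bs" "c = (\<lambda>y vs. E y (sel vs))" by auto
      then have "ucont (unit_lists m) E x" "\<forall>vs\<in>unit_lists n. sel vs \<in> unit_lists m"
        using Ck_fam_ucont[OF _ x] "0.prems"(5) by blast+
      then show ?thesis unfolding b(2) by (auto intro: ucont_reindex[of "unit_lists m" E])
    qed
    have "ucont (unit_lists n) (\<lambda>y s. ?\<Gamma> y (map (\<lambda>c. c y s) ?cs, s)) x"
      using "0.prems"(2,4) TU G c by (intro ucont_plug_list[OF U x]) auto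
    then show "ucont (unit_lists n) (\<lambda>x vs. H (T x) (map (\<lambda>(E, m, sel). E x (sel vs)) bs)) x"
      by (simp add: case_prod_unfold comp_def)
  qed
next
  case (Suc k p n H bs)
  have base: "Ck_fam k n U (\<lambda>x vs. H (T x) (map (\<lambda>(E, m, sel). E x (sel vs)) bs))"
  proof (rule Suc.IH[OF Ck_fam_SucD[OF Suc.prems(1)] Suc.prems(2) Ck_fam_SucD[OF Suc.prems(3)] Suc.prems(4)])
    fix E m sel assume "(E, m, sel) \<in> set bs"
    from Suc.prems(5)[OF this] Ck_fam_SucD[of k m U E]
    show "Ck_fam k m U E \<and> (\<forall>vs. length vs = n \<longrightarrow> length (sel vs) = m) \<and>
      (\<forall>vs\<in>unit_lists n. sel vs \<in> unit_lists m)" by blast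
  qed
  obtain H' where H': "Ck_fam k (Suc p) V H'" "\<And>z ys. z \<in> V \<Longrightarrow> length ys = p \<Longrightarrow>
      ((\<lambda>y. H y ys) has_derivative (\<lambda>v. H' z (v # ys))) (at z)"
    using Suc.prems(1) by auto
  obtain T' where T': "Ck_fam k 1 U T'" "\<And>x. x \<in> U \<Longrightarrow> (T has_derivative (\<lambda>v. T' x [v])) (at x)"
    using Suc.prems(3) by auto
  have "\<forall>i<p. \<exists>E'. Ck_fam k (Suc (fst (snd (bs ! i)))) U E' \<and>
      (\<forall>x\<in>U. \<forall>vs. length vs = fst (snd (bs ! i)) \<longrightarrow>
        ((\<lambda>y. fst (bs ! i) y vs) has_derivative (\<lambda>v. E' x (v # vs))) (at x))"
  proof (intro allI impI)
    fix i assume "i < p"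
    then have "bs ! i \<in> set bs" using Suc.prems(4) by auto
    then have "Ck_fam (Suc k) (fst (snd (bs ! i))) U (fst (bs ! i))"
      using Suc.prems(5)[of "fst (bs ! i)" "fst (snd (bs ! i))" "snd (snd (bs ! i))"] by simp
    then show "\<exists>E'. Ck_fam k (Suc (fst (snd (bs ! i)))) U E' \<and>
      (\<forall>x\<in>U. \<forall>vs. length vs = fst (snd (bs ! i)) \<longrightarrow>
        ((\<lambda>y. fst (bs ! i) y vs) has_derivative (\<lambda>v. E' x (v # vs))) (at x))" by auto
  qed
  then obtain E' where E': "\<And>i. i < p \<Longrightarrow> Ck_fam k (Suc (fst (snd (bs ! i)))) U (E' i)"
    "\<And>i x vs. i < p \<Longrightarrow> x \<in> U \<Longrightarrow> length vs = fst (snd (bs ! i)) \<Longrightarrow>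
        ((\<lambda>y. fst (bs ! i) y vs) has_derivative (\<lambda>v. E' i x (v # vs))) (at x)"
    by metis
  \<comment> \<open>An entry \<open>(E, m, sel)\<close> of \<open>bs\<close> stands for the family
    \<open>E\<close> with \<open>m\<close> slots, fed with the directions that \<open>sel\<close>
    picks. With the new direction at the head of the list, \<open>?lift\<close> lets an old entry
    ignore it, \<open>?head\<close> is the term in which the outer function is differentiated (along
    \<open>T' x [hd w]\<close>), and \<open>?bs i\<close> the one in which the \<open>i\<close>-th
    inner entry is.\<close>
  let ?lift = "\<lambda>(E::'a \<Rightarrow> 'a list \<Rightarrow> 'y, m::nat, sel::'a list \<Rightarrow> 'a list). (E, m, \<lambda>w. sel (tl w))"
  let ?head = "(T', 1, \<lambda>w. [hd w]) # map ?lift bs"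
  let ?bs = "\<lambda>i. (map ?lift bs)[i := (E' i, Suc (fst (snd (bs ! i))), \<lambda>w. hd w # snd (snd (bs ! i)) (tl w))]"
  let ?ev = "\<lambda>bs x w. map (\<lambda>(E::'a \<Rightarrow> 'a list \<Rightarrow> 'y, m::nat, sel). E x (sel w)) bs"
  define D where "D x w = H' (T x) (?ev ?head x w) + (\<Sum>i<p. H (T x) (?ev (?bs i) x w))" for x w
  have tl_unit: "tl w \<in> unit_lists n" "norm (hd w) \<le> 1" if "w \<in> unit_lists (Suc n)" for w :: "'a list"
    using that by (cases w; auto simp: unit_lists_def)+
  have lift: "Ck_fam k m U E \<and> (\<forall>vs. length vs = Suc n \<longrightarrow> length (sel vs) = m) \<and>
      (\<forall>vs\<in>unit_lists (Suc n). sel vs \<in> unit_lists m)" if b_mem: "(E, m, sel) \<in> set (map ?lift bs)" for E m sel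
  proof -
    obtain s0 where s0: "(E, m, s0) \<in> set bs" "sel = (\<lambda>w. s0 (tl w))"
      using b_mem by auto
    show ?thesis
      using Suc.prems(5)[OF s0(1)] tl_unit(1) Ck_fam_SucD[of k m U E] unfolding s0(2) by (simp del: Ck_fam.simps)
  qed
  have Tk: "Ck_fam k 0 U (\<lambda>x _. T x)" using Suc.prems(3) by (rule Ck_fam_SucD)
  have "Ck_fam k (Suc n) U (\<lambda>x w. H' (T x) (?ev ?head x w))"
  proof (rule Suc.IH[OF H'(1) _ Tk])
    show "multilin (Suc p) (H' z)" if "z \<in> V" for z
      using multilin_derivative[OF V Suc.prems(2) H'(2) that] by blast
    show "length ?head = Suc p" using Suc.prems(4) by simp
    fix E m sel assume "(E, m, sel) \<in> set ?head"
    then consider "E = T'" "m = 1" "sel = (\<lambda>w. [hd w])" | "(E, m, sel) \<in> set (map ?lift bs)"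
      by (auto simp del: set_map)
    then show "Ck_fam k m U E \<and> (\<forall>vs. length vs = Suc n \<longrightarrow> length (sel vs) = m) \<and>
      (\<forall>vs\<in>unit_lists (Suc n). sel vs \<in> unit_lists m)"
    proof cases
      case 1
      then show ?thesis using T'(1) tl_unit by (auto simp: unit_lists_def)
    qed (rule lift)
  qed
  moreover have "Ck_fam k (Suc n) U (\<lambda>x w. H (T x) (?ev (?bs i) x w))" if i: "i < p" for i
  proof (rule Suc.IH[OF Ck_fam_SucD[OF Suc.prems(1)] Suc.prems(2) Tk])
    show "length (?bs i) = p" using Suc.prems(4) by simp
    fix E m sel assume "(E, m, sel) \<in> set (?bs i)"
    then consider "E = E' i" "m = Suc (fst (snd (bs ! i)))" "sel = (\<lambda>w. hd w # snd (snd (bs ! i)) (tl w))"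
      | "(E, m, sel) \<in> set (map ?lift bs)"
      using set_update_subset_insert by fastforce
    then show "Ck_fam k m U E \<and> (\<forall>vs. length vs = Suc n \<longrightarrow> length (sel vs) = m) \<and>
      (\<forall>vs\<in>unit_lists (Suc n). sel vs \<in> unit_lists m)"
    proof cases
      case 1
      have "bs ! i \<in> set bs" using i Suc.prems(4) by auto
      then have "(fst (bs ! i), fst (snd (bs ! i)), snd (snd (bs ! i))) \<in> set bs" by simp
      from Suc.prems(5)[OF this] show ?thesis
        using 1 E'(1)[OF i] tl_unit by auto
    qed (rule lift)
  qed
  ultimately have CSD: "Ck_fam k (Suc n) U D"
    unfolding D_def by (intro Ck_fam_add Ck_fam_sum) auto
  have der: "((\<lambda>y. H (T y) (?ev bs y vs)) has_derivative (\<lambda>v. D x (v # vs))) (at x)"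
    if x: "x \<in> U" and len: "length vs = n" for x vs
  proof -
    let ?cs = "map (\<lambda>(E, m, sel) y. E y (sel vs)) bs"
    let ?cs' = "map (\<lambda>i v. E' i x (v # snd (snd (bs ! i)) vs)) [0..<p]"
    have Tx: "(T has_derivative (\<lambda>v. T' x [v])) (at x)" by (rule T'(2)[OF x])
    have TxV: "T x \<in> V" using TU x by auto
    have "ucont (unit_lists (length ?cs)) H (T x)"
      using Ck_fam_ucont[OF Suc.prems(1) TxV] Suc.prems(4) by simp
    then have 1: "ucont (unit_lists (length ?cs)) (\<lambda>y ys. H (T y) ys) x"
      by (rule ucont_compose[OF _ has_derivative_continuous[OF Tx]])
    have 2: "((\<lambda>y. H (T y) ys) has_derivative (\<lambda>v. H' (T x) (T' x [v] # ys))) (at x)"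
      if "length ys = length ?cs" for ys
      using has_derivative_compose[OF Tx H'(2)[OF TxV, of ys]] that Suc.prems(4) by simp
    have 3: "list_all2 (\<lambda>c c'. (c has_derivative c') (at x)) ?cs ?cs'"
      unfolding list_all2_conv_all_nth
    proof (intro conjI allI impI)
      fix i assume "i < length ?cs"
      then have i: "i < p" using Suc.prems(4) by simp
      then have "bs ! i \<in> set bs" using Suc.prems(4) by auto
      then have "(fst (bs ! i), fst (snd (bs ! i)), snd (snd (bs ! i))) \<in> set bs" by simp
      from Suc.prems(5)[OF this] len have "length (snd (snd (bs ! i)) vs) = fst (snd (bs ! i))" by blast
      from E'(2)[OF i x this] show "(?cs ! i has_derivative ?cs' ! i) (at x)"
        using i Suc.prems(4) by (simp add: case_prod_unfold)
    qed (simp add: Suc.prems(4))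
    have "((\<lambda>y. H (T y) (map (\<lambda>c. c y) ?cs)) has_derivative
      (\<lambda>v. H' (T x) (T' x [v] # map (\<lambda>c. c x) ?cs) +
        (\<Sum>i<length ?cs. H (T x) ((map (\<lambda>c. c x) ?cs)[i := (?cs' ! i) v])))) (at x)"
      using Suc.prems(2,4) TU by (intro has_derivative_plug_list[OF U x _ 1 2 3]) auto
    moreover have "H' (T x) (T' x [v] # map (\<lambda>c. c x) ?cs) +
        (\<Sum>i<length ?cs. H (T x) ((map (\<lambda>c. c x) ?cs)[i := (?cs' ! i) v])) = D x (v # vs)" for v
    proof -
      have "(\<Sum>i<length ?cs. H (T x) ((map (\<lambda>c. c x) ?cs)[i := (?cs' ! i) v])) =
          (\<Sum>i<p. H (T x) (?ev (?bs i) x (v # vs)))"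
        using Suc.prems(4) by (intro sum.cong) (auto simp: map_update case_prod_unfold comp_def)
      then show ?thesis
        unfolding D_def by (simp add: case_prod_unfold comp_def)
    qed
    ultimately show ?thesis by (simp add: case_prod_unfold comp_def)
  qed
  show ?case
    unfolding Ck_fam.simps using CSD der Ck_fam_ucont[OF base] by blast
qed

text \<open>The term without inner entries and without directions; differentiating it produces all
  other terms of the formula.\<close>

lemma Ck_fam_compose:
  assumes "open U" "open V" "T ` U \<subseteq> V" "Ck_fam k 0 V (\<lambda>x _. h x)" "Ck_fam k 0 U (\<lambda>x _. T x)"
  shows "Ck_fam k 0 U (\<lambda>x _. h (T x))"
  using Ck_fam_term[OF assms(1-4) _ assms(5), of "[]" 0] by (simp add: multilin_def)

section \<open>Equivalence of the recursive notion with \<open>Ck_on\<close>\<close>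

lemma bounded_multilinear_multilin:
  "bounded_multilinear n T \<longleftrightarrow>
     multilin n T \<and> (\<exists>C. \<forall>vs. length vs = n \<longrightarrow> norm (T vs) \<le> C * prod_list (map norm vs))"
  by (simp add: bounded_multilinear_def multilin_def)

text \<open>Mean value inequality on a ball where \<open>E'\<close> is within \<open>e\<close> of
  \<open>E' x\<close>. Uniformity in \<open>vs\<close> gives the remainder estimate of
  \<open>Ck_on\<close>; that both \<open>y\<close> and \<open>z\<close> are free is what later
  compares the coordinate differences of nearby points in two charts.\<close>

lemma Ck_fam_strict_derivative:
  assumes U: "open U" "x \<in> U" and E': "Ck_fam 0 (Suc n) U E'"
    and der: "\<And>x vs. x \<in> U \<Longrightarrow> length vs = n \<Longrightarrow>
      ((\<lambda>y. E y vs) has_derivative (\<lambda>v. E' x (v # vs))) (at x)"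
    and e: "e > 0"
  shows "\<exists>d>0. ball x d \<subseteq> U \<and> (\<forall>y\<in>ball x d. \<forall>z\<in>ball x d. \<forall>vs\<in>unit_lists n.
    norm (E y vs - E z vs - E' x ((y - z) # vs)) \<le> e * norm (y - z))"
proof -
  have "\<forall>\<^sub>F y in at x. \<forall>w\<in>unit_lists (Suc n). dist (E' y w) (E' x w) < e"
    using E' U e unfolding Ck_fam.simps ucont_def uniform_limit_iff by blast
  moreover have "\<forall>\<^sub>F y in at x. y \<in> U" using U eventually_at_topological by blast
  ultimately have "\<forall>\<^sub>F y in at x. y \<in> U \<and> (\<forall>w\<in>unit_lists (Suc n). dist (E' y w) (E' x w) < e)"
    by eventually_elim auto
  then obtain d where d: "d > 0" "\<And>y. y \<noteq> x \<Longrightarrow> dist y x < d \<Longrightarrow>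
      y \<in> U \<and> (\<forall>w\<in>unit_lists (Suc n). dist (E' y w) (E' x w) < e)"
    unfolding eventually_at by blast
  have d': "y \<in> U" "\<And>w. w \<in> unit_lists (Suc n) \<Longrightarrow> dist (E' y w) (E' x w) < e" if "y \<in> ball x d" for y
    using d(2)[of y] that U e by (cases "y = x"; simp add: dist_commute)+
  have "norm (E y vs - E z vs - E' x ((y - z) # vs)) \<le> e * norm (y - z)"
    if y: "y \<in> ball x d" and z: "z \<in> ball x d" and vs: "vs \<in> unit_lists n" for y z vs
  proof -
    have len: "length vs = n" using vs by (simp add: unit_lists_def)
    have "norm (E y vs - E z vs - (\<lambda>v. E' x (v # vs)) (y - z)) \<le> norm (y - z) * e"
    proof (rule differentiable_bound_linearization[where S="ball x d"])
      fix t :: real assume t: "t \<in> {0..1}"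
      have "z + t *\<^sub>R (y - z) = (1 - t) *\<^sub>R z + t *\<^sub>R y" by (simp add: algebra_simps)
      then show "z + t *\<^sub>R (y - z) \<in> ball x d"
        using convexD[OF convex_ball z y] t by simp
    next
      fix u assume "u \<in> ball x d"
      then show "((\<lambda>y. E y vs) has_derivative (\<lambda>v. E' u (v # vs))) (at u within ball x d)"
        using der[OF d'(1) len] by (simp add: has_derivative_at_withinI)
    next
      fix u assume u: "u \<in> ball x d"
      have l: "linear (\<lambda>v. E' u (v # vs) - E' x (v # vs))"
        using has_derivative_linear[OF der[OF d'(1)[OF u] len]] has_derivative_linear[OF der[OF U(2) len]]
        by (rule linear_compose_sub)
      have "norm (E' u (v # vs) - E' x (v # vs)) \<le> e * norm v" for v
      proof (rule linear_unit_bound[OF l])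
        fix v :: 'a assume "norm v \<le> 1"
        then show "norm (E' u (v # vs) - E' x (v # vs)) \<le> e"
          using d'(2)[OF u, of "v # vs"] vs by (simp add: dist_norm)
      qed
      then show "onorm ((\<lambda>v. E' u (v # vs)) - (\<lambda>v. E' x (v # vs))) \<le> e"
        using e by (intro onorm_bound) auto
    qed (use d in auto)
    then show ?thesis by (simp add: mult.commute)
  qed
  moreover have "ball x d \<subseteq> U" using d' by blast
  ultimately show ?thesis using d by blast
qed

lemma prod_list_norm_le_1: "vs \<in> unit_lists n \<Longrightarrow> prod_list (map norm vs) \<le> 1"
proof (induction vs arbitrary: n)
  case (Cons v vs)
  then have "norm v \<le> 1" "prod_list (map norm vs) \<le> 1"
    by (auto simp: unit_lists_def)
  moreover have "0 \<le> prod_list (map norm vs)"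
    by (rule prod_list_nonneg) auto
  ultimately show ?case by (simp add: mult_le_one)
qed simp

text \<open>\<open>Ck_on\<close> controls the remainder on unit lists only. The remainder is
  multilinear in \<open>vs\<close>, so \<open>multilin_bound\<close> extends the estimate to
  arbitrary directions, which gives the derivatives required by \<open>Ck_fam\<close> one list at a
  time.\<close>

lemma Ck_on_imp_Ck_fam:
  assumes U: "open U" and f: "Ck_on k U f" and "enat j \<le> k"
  shows "Ck_fam j 0 U (\<lambda>x _. f x)"
proof -
  obtain D where D: "\<forall>x\<in>U. D 0 x [] = f x"
    "\<forall>n x. enat n \<le> k \<and> x \<in> U \<longrightarrow> bounded_multilinear n (D n x) \<and>
        uniform_limit (unit_lists n) (D n) (D n x) (at x within U)"
    "\<forall>n x. enat n < k \<and> x \<in> U \<longrightarrow> uniform_limit (unit_lists n)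
          (\<lambda>y vs. (D n y vs - D n x vs - D (Suc n) x ((y - x) # vs)) /\<^sub>R norm (y - x))
          (\<lambda>vs. 0) (at x within U)"
    using f unfolding Ck_on_def by (elim exE conjE) (rule that)
  have D1: "bounded_multilinear n (D n x) \<and>
      uniform_limit (unit_lists n) (D n) (D n x) (at x within U)" if "enat n \<le> k" "x \<in> U" for n x
    using D(2) that by blast
  have D2: "uniform_limit (unit_lists n)
          (\<lambda>y vs. (D n y vs - D n x vs - D (Suc n) x ((y - x) # vs)) /\<^sub>R norm (y - x))
          (\<lambda>vs. 0) (at x within U)" if "enat n < k" "x \<in> U" for n x
    using D(3) that by blast
  have at: "at x within U = at x" if "x \<in> U" for x
    using that U by (rule at_within_open)
  have ml: "multilin n (D n x)" if "enat n \<le> k" "x \<in> U" for n x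
    using D1[OF that] unfolding bounded_multilinear_multilin by blast
  have D_ucont: "ucont (unit_lists n) (D n) x" if n: "enat n \<le> k" and x: "x \<in> U" for n x
  proof -
    obtain C where C: "\<And>vs. length vs = n \<Longrightarrow> norm (D n x vs) \<le> C * prod_list (map norm vs)"
      using D1[OF n x] unfolding bounded_multilinear_multilin by blast
    have "norm (D n x vs) \<le> \<bar>C\<bar>" if "vs \<in> unit_lists n" for vs
    proof -
      have "norm (D n x vs) \<le> C * prod_list (map norm vs)"
        using that by (intro C) (simp add: unit_lists_def)
      also have "\<dots> \<le> \<bar>C\<bar> * 1"
      proof (rule mult_mono)
        show "0 \<le> prod_list (map norm vs)" by (rule prod_list_nonneg) auto
      qed (use prod_list_norm_le_1[OF that] in auto)
      finally show ?thesis by simp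
    qed
    then show ?thesis
      using D1[OF n x] at[OF x] unfolding ucont_def by auto
  qed
  have der: "((\<lambda>y. D n y vs) has_derivative (\<lambda>v. D (Suc n) x (v # vs))) (at x)"
    if n: "enat n < k" and x: "x \<in> U" and len: "length vs = n" for n x vs
  proof -
    have Sn: "enat (Suc n) \<le> k" using n by (simp add: Suc_ile_eq)
    define P where "P = prod_list (map norm vs)"
    have P: "P \<ge> 0" unfolding P_def by (rule prod_list_nonneg) auto
    obtain C where C: "\<And>vs. length vs = Suc n \<Longrightarrow> norm (D (Suc n) x vs) \<le> C * prod_list (map norm vs)"
      using D1[OF Sn x] unfolding bounded_multilinear_multilin by blast
    have "norm (D (Suc n) x (v # vs)) \<le> norm v * (C * P)" for v
      using C[of "v # vs"] len by (simp add: P_def algebra_simps)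
    then have bl: "bounded_linear (\<lambda>v. D (Suc n) x (v # vs))"
      using multilin_head[OF ml[OF Sn x] len] by (intro bounded_linear_intro[of _ "C * P"]) (auto simp: linear_iff)
    show ?thesis
      unfolding has_derivative_at_alt
    proof (intro conjI bl allI impI)
      fix e :: real assume e: "e > 0"
      \<comment> \<open>The estimate on unit lists gets multiplied by \<open>P\<close>, the product
        of the norms of the directions.\<close>
      define e' where "e' = e / (P + 1)"
      have e': "e' > 0" using e P by (simp add: e'_def)
      have "\<forall>\<^sub>F y in at x. \<forall>vs\<in>unit_lists n.
          dist ((D n y vs - D n x vs - D (Suc n) x ((y - x) # vs)) /\<^sub>R norm (y - x)) 0 < e'"
        using D2[OF n x] e' at[OF x] unfolding uniform_limit_iff by auto
      moreover have "\<forall>\<^sub>F y in at x. y \<in> U" using U x eventually_at_topological by blast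
      ultimately have "\<forall>\<^sub>F y in at x. y \<in> U \<and> (\<forall>vs\<in>unit_lists n.
          dist ((D n y vs - D n x vs - D (Suc n) x ((y - x) # vs)) /\<^sub>R norm (y - x)) 0 < e')"
        by eventually_elim auto
      then obtain d where d: "d > 0" "\<And>y. y \<noteq> x \<Longrightarrow> dist y x < d \<Longrightarrow> y \<in> U \<and> (\<forall>vs\<in>unit_lists n.
          dist ((D n y vs - D n x vs - D (Suc n) x ((y - x) # vs)) /\<^sub>R norm (y - x)) 0 < e')"
        unfolding eventually_at by blast
      show "\<exists>d>0. \<forall>y. norm (y - x) < d \<longrightarrow>
          norm (D n y vs - D n x vs - D (Suc n) x ((y - x) # vs)) \<le> e * norm (y - x)"
      proof (intro exI[of _ d] conjI d allI impI)
        fix y assume y: "norm (y - x) < d"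
        show "norm (D n y vs - D n x vs - D (Suc n) x ((y - x) # vs)) \<le> e * norm (y - x)"
        proof (cases "y = x")
          case True
          then show ?thesis using linear_0[OF multilin_head[OF ml[OF Sn x] len]] by simp
        next
          case False
          then have yU: "y \<in> U" and dy: "\<forall>vs\<in>unit_lists n.
              dist ((D n y vs - D n x vs - D (Suc n) x ((y - x) # vs)) /\<^sub>R norm (y - x)) 0 < e'"
            using d(2)[OF False] y unfolding dist_norm by blast+
          have dy': "norm (D n y vs - D n x vs - D (Suc n) x ((y - x) # vs)) \<le> e' * norm (y - x)"
            if "vs \<in> unit_lists n" for vs
          proof -
            have "norm (D n y vs - D n x vs - D (Suc n) x ((y - x) # vs)) / norm (y - x) < e'"
              using dy that by (simp add: dist_norm divide_inverse mult.commute)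
            then show ?thesis using False by (simp add: pos_divide_less_eq)
          qed
          have "multilin n (\<lambda>vs. D n y vs - D n x vs - D (Suc n) x ((y - x) # vs))"
            using n by (intro multilin_diff ml multilin_Cons Sn x yU) auto
          from multilin_bound[OF this dy' len]
          have "norm (D n y vs - D n x vs - D (Suc n) x ((y - x) # vs)) \<le> e' * norm (y - x) * P"
            unfolding P_def by blast
          also have "\<dots> \<le> e' * norm (y - x) * (P + 1)"
            using e' by (intro mult_left_mono) auto
          also have "\<dots> = e * norm (y - x)" using P by (simp add: e'_def)
          finally show ?thesis .
        qed
      qed
    qed
  qed
  have "Ck_fam j n U (D n)" if "enat (n + j) \<le> k" for n
    using that
  proof (induction j arbitrary: n)
    case 0
    then show ?case by (auto intro: D_ucont)
  next
    case (Suc j)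
    have nk: "enat n \<le> enat (n + Suc j)" "enat n < enat (n + Suc j)" by auto
    have "Ck_fam j (Suc n) U (D (Suc n))" using Suc by simp
    then show ?case
      using D_ucont der order_trans[OF nk(1) Suc.prems] less_le_trans[OF nk(2) Suc.prems] by auto
  qed
  from this[of 0] assms(3) have "Ck_fam j 0 U (D 0)" by simp
  then show ?thesis by (rule Ck_fam_cong[OF U, rotated]) (simp add: D(1))
qed

text \<open>A canonical value for the derivative that \<open>Ck_fam\<close> asserts to exist. It
  depends on \<open>E\<close> near \<open>x\<close> alone, so derivatives found on different open
  sets fit together.\<close>

definition diff_fam :: "('a::real_normed_vector \<Rightarrow> 'a list \<Rightarrow> 'b::real_normed_vector) \<Rightarrow> 'a \<Rightarrow> 'a list \<Rightarrow> 'b" where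
  "diff_fam E x w = frechet_derivative (\<lambda>y. E y (tl w)) (at x) (hd w)"

lemma Ck_fam_diff_fam:
  assumes U: "open U" and E: "Ck_fam (Suc k) n U E"
  shows "Ck_fam k (Suc n) U (diff_fam E)"
    and "\<And>x vs. x \<in> U \<Longrightarrow> length vs = n \<Longrightarrow>
      ((\<lambda>y. E y vs) has_derivative (\<lambda>v. diff_fam E x (v # vs))) (at x)"
proof -
  obtain E' where E': "Ck_fam k (Suc n) U E'" "\<And>x vs. x \<in> U \<Longrightarrow> length vs = n \<Longrightarrow>
        ((\<lambda>y. E y vs) has_derivative (\<lambda>v. E' x (v # vs))) (at x)"
    using E by auto
  have diff_fam: "diff_fam E x (v # vs) = E' x (v # vs)" if "x \<in> U" "length vs = n" for x v vs
    unfolding diff_fam_def using fun_cong[OF frechet_derivative_at[OF E'(2)[OF that]], of v] by simp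
  show "Ck_fam k (Suc n) U (diff_fam E)"
    by (rule Ck_fam_cong[OF U _ E'(1)]) (auto simp: length_Suc_conv diff_fam)
  show "((\<lambda>y. E y vs) has_derivative (\<lambda>v. diff_fam E x (v # vs))) (at x)"
    if "x \<in> U" "length vs = n" for x vs
    using E'(2)[OF that] by (simp add: diff_fam[OF that])
qed

lemma Ck_fam_local:
  assumes "\<And>x. x \<in> U \<Longrightarrow> \<exists>V. open V \<and> x \<in> V \<and> Ck_fam k n V E"
  shows "Ck_fam k n U E"
  using assms
proof (induction k arbitrary: n E)
  case 0
  then show ?case by fastforce
next
  case (Suc k)
  have "Ck_fam k (Suc n) U (diff_fam E)"
    using Suc.prems by (intro Suc.IH) (meson Ck_fam_diff_fam(1))
  moreover have "((\<lambda>y. E y vs) has_derivative (\<lambda>v. diff_fam E x (v # vs))) (at x)"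
    if "x \<in> U" "length vs = n" for x vs
    using Suc.prems[OF that(1)] Ck_fam_diff_fam(2) that(2) by blast
  moreover have "ucont (unit_lists n) E x" if "x \<in> U" for x
    using Suc.prems[OF that] Ck_fam_ucont by blast
  ultimately show ?case by auto
qed

text \<open>For \<open>k = \<infinity>\<close> each finite order comes with derivatives of its own,
  whereas \<open>Ck_on\<close> wants one sequence for all orders; the iterates of
  \<open>diff_fam\<close> provide it.\<close>

lemma Ck_fam_imp_Ck_on:
  assumes U: "open U" and f: "\<And>j. enat j \<le> k \<Longrightarrow> Ck_fam j 0 U (\<lambda>x _. f x)"
  shows "Ck_on k U f"
proof -
  define D where "D n = (diff_fam ^^ n) (\<lambda>x _. f x)" for n
  have D_Suc: "D (Suc n) = diff_fam (D n)" for n by (simp add: D_def)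
  have CSD: "Ck_fam i n U (D n)" if "enat (n + i) \<le> k" for i n
    using that
  proof (induction n arbitrary: i)
    case 0
    then show ?case using f by (simp add: D_def)
  next
    case (Suc n)
    then have "Ck_fam (Suc i) n U (D n)" by (simp del: Ck_fam.simps)
    then show ?case unfolding D_Suc by (rule Ck_fam_diff_fam(1)[OF U])
  qed
  have der: "((\<lambda>y. D n y vs) has_derivative (\<lambda>v. D (Suc n) x (v # vs))) (at x)"
    if "enat n < k" "x \<in> U" "length vs = n" for n x vs
    unfolding D_Suc using that CSD[of n 1] by (intro Ck_fam_diff_fam(2)[OF U, of 0]) (auto simp: Suc_ile_eq)
  have ml: "multilin n (D n x)" if "enat n \<le> k" "x \<in> U" for n x
    using that
  proof (induction n arbitrary: x)
    case (Suc n)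
    then have "enat n < k" by (simp add: Suc_ile_eq)
    then show ?case
      using Suc by (intro multilin_derivative[OF U, of n "D n"] der) auto
  qed (simp add: multilin_def)
  have ucont: "ucont (unit_lists n) (D n) x" if "enat n \<le> k" "x \<in> U" for n x
    using Ck_fam_ucont[OF CSD[of n 0]] that by simp
  have at: "at x within U = at x" if "x \<in> U" for x
    using that U by (rule at_within_open)
  show ?thesis
    unfolding Ck_on_def
  proof (intro exI[of _ D] conjI ballI allI impI)
    show "D 0 x [] = f x" for x by (simp add: D_def)
  next
    fix n x assume A: "enat n \<le> k \<and> x \<in> U"
    then obtain C where "\<And>vs. vs \<in> unit_lists n \<Longrightarrow> norm (D n x vs) \<le> C"
      using ucont unfolding ucont_def by meson
    then show "bounded_multilinear n (D n x)"
      using multilin_bound ml A unfolding bounded_multilinear_multilin by blast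
    show "uniform_limit (unit_lists n) (D n) (D n x) (at x within U)"
      using ucont A at unfolding ucont_def by simp
  next
    fix n x assume A: "enat n < k \<and> x \<in> U"
    then have x: "x \<in> U" and c: "Ck_fam 0 (Suc n) U (D (Suc n))"
      using CSD[of "Suc n" 0] by (auto simp: Suc_ile_eq)
    show "uniform_limit (unit_lists n)
          (\<lambda>y vs. (D n y vs - D n x vs - D (Suc n) x ((y - x) # vs)) /\<^sub>R norm (y - x))
          (\<lambda>vs. 0) (at x within U)"
      unfolding at[OF x] uniform_limit_iff
    proof (intro allI impI)
      fix e :: real assume e: "e > 0"
      have "((\<lambda>y. D n y vs) has_derivative (\<lambda>v. D (Suc n) x (v # vs))) (at x)"
        if "x \<in> U" "length vs = n" for x vs
        using der A that by blast
      from Ck_fam_strict_derivative[OF U x c this, of "e / 2"] e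
      obtain d where d: "d > 0" "\<forall>y\<in>ball x d. \<forall>z\<in>ball x d. \<forall>vs\<in>unit_lists n.
         norm (D n y vs - D n z vs - D (Suc n) x ((y - z) # vs)) \<le> e / 2 * norm (y - z)"
        by auto
      have "dist ((D n y vs - D n x vs - D (Suc n) x ((y - x) # vs)) /\<^sub>R norm (y - x)) 0 < e"
        if "y \<noteq> x" "dist y x < d" "vs \<in> unit_lists n" for y vs
      proof -
        have "norm (D n y vs - D n x vs - D (Suc n) x ((y - x) # vs)) \<le> e / 2 * norm (y - x)"
          using that d by (simp add: dist_commute)
        moreover have "norm (y - x) > 0" using that by simp
        ultimately have "norm (D n y vs - D n x vs - D (Suc n) x ((y - x) # vs)) / norm (y - x) \<le> e / 2"
          by (simp only: pos_divide_le_eq)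
        moreover have "dist ((D n y vs - D n x vs - D (Suc n) x ((y - x) # vs)) /\<^sub>R norm (y - x)) 0 =
            norm (D n y vs - D n x vs - D (Suc n) x ((y - x) # vs)) / norm (y - x)"
          by (simp add: dist_norm divide_inverse_commute)
        ultimately show ?thesis using e by linarith
      qed
      then show "\<forall>\<^sub>F y in at x. \<forall>vs\<in>unit_lists n.
          dist ((D n y vs - D n x vs - D (Suc n) x ((y - x) # vs)) /\<^sub>R norm (y - x)) 0 < e"
        unfolding eventually_at using d(1) by blast
    qed
  qed
qed

lemma Ck_on_iff_Ck_fam: "open U \<Longrightarrow> Ck_on k U f \<longleftrightarrow> (\<forall>j. enat j \<le> k \<longrightarrow> Ck_fam j 0 U (\<lambda>x _. f x))"
  using Ck_on_imp_Ck_fam Ck_fam_imp_Ck_on by blast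

section \<open>Closure properties of smooth maps\<close>

lemma Ck_on_mono: "Ck_on k U f \<Longrightarrow> j \<le> k \<Longrightarrow> Ck_on j U f"
proof -
  assume f: "Ck_on k U f" and "j \<le> k"
  then have *: "enat n \<le> j \<Longrightarrow> enat n \<le> k" "enat n < j \<Longrightarrow> enat n < k" for n by auto
  obtain D where D: "\<forall>x\<in>U. D 0 x [] = f x"
    "\<forall>n x. enat n \<le> k \<and> x \<in> U \<longrightarrow> bounded_multilinear n (D n x) \<and>
        uniform_limit (unit_lists n) (D n) (D n x) (at x within U)"
    "\<forall>n x. enat n < k \<and> x \<in> U \<longrightarrow> uniform_limit (unit_lists n)
          (\<lambda>y vs. (D n y vs - D n x vs - D (Suc n) x ((y - x) # vs)) /\<^sub>R norm (y - x))
          (\<lambda>vs. 0) (at x within U)"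
    using f unfolding Ck_on_def by (elim exE conjE) (rule that)
  show "Ck_on j U f"
    unfolding Ck_on_def using D * by (intro exI[of _ D]) simp
qed

lemma Ck_on_subset: "open U \<Longrightarrow> open V \<Longrightarrow> V \<subseteq> U \<Longrightarrow> Ck_on k U f \<Longrightarrow> Ck_on k V f"
  by (auto simp: Ck_on_iff_Ck_fam intro: Ck_fam_subset)

lemma Ck_on_cong:
  assumes "open U" "\<And>x. x \<in> U \<Longrightarrow> f x = g x" "Ck_on k U f"
  shows "Ck_on k U g"
  using assms Ck_fam_cong[of U 0 "\<lambda>x _. f x" "\<lambda>x _. g x"] by (auto simp: Ck_on_iff_Ck_fam)

lemma Ck_on_local:
  assumes "open U" "\<And>x. x \<in> U \<Longrightarrow> \<exists>V. open V \<and> x \<in> V \<and> Ck_on k V f"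
  shows "Ck_on k U f"
proof (rule Ck_fam_imp_Ck_on[OF assms(1)])
  fix j assume j: "enat j \<le> k"
  show "Ck_fam j 0 U (\<lambda>x _. f x)"
  proof (rule Ck_fam_local)
    fix x assume "x \<in> U"
    from assms(2)[OF this] Ck_on_imp_Ck_fam[OF _ _ j]
    show "\<exists>V. open V \<and> x \<in> V \<and> Ck_fam j 0 V (\<lambda>x _. f x)" by blast
  qed
qed

lemma Ck_on_compose:
  assumes "open U" "open V" "T ` U \<subseteq> V" "Ck_on k V h" "Ck_on k U T"
  shows "Ck_on k U (\<lambda>x. h (T x))"
proof (rule Ck_fam_imp_Ck_on[OF assms(1)])
  fix j assume j: "enat j \<le> k"
  show "Ck_fam j 0 U (\<lambda>x _. h (T x))"
    by (rule Ck_fam_compose[OF assms(1-3) Ck_on_imp_Ck_fam[OF assms(2,4) j] Ck_on_imp_Ck_fam[OF assms(1,5) j]])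
qed

lemma Ck_on_add:
  "open U \<Longrightarrow> Ck_on k U f \<Longrightarrow> Ck_on k U g \<Longrightarrow> Ck_on k U (\<lambda>x. f x + g x)"
  by (simp add: Ck_on_iff_Ck_fam Ck_fam_add)

text \<open>On the line, the derivative of order \<open>n\<close> at \<open>x\<close> is
  \<open>F n x\<close> times the product of the directions, so scalar derivatives suffice.\<close>

lemma Ck_on_derivative_seq:
  fixes F :: "nat \<Rightarrow> real \<Rightarrow> real"
  assumes U: "open U" and F: "\<And>n x. x \<in> U \<Longrightarrow> (F n has_real_derivative F (Suc n) x) (at x)"
  shows "Ck_on k U (F 0)"
proof -
  have "Ck_fam j n U (\<lambda>x vs. F n x * prod_list vs)" for j n
  proof (induction j arbitrary: n)
    have ucont: "ucont (unit_lists n) (\<lambda>x vs. F n x * prod_list vs) x" if x: "x \<in> U" for n x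
    proof -
      have p: "\<bar>prod_list vs\<bar> \<le> 1" if "vs \<in> unit_lists n" for vs :: "real list"
      proof -
        have "\<bar>prod_list vs\<bar> = prod_list (map norm vs)"
          by (induction vs) (auto simp: abs_mult)
        then show ?thesis using prod_list_norm_le_1[OF that] by simp
      qed
      have c: "(F n \<longlongrightarrow> F n x) (at x)"
        using DERIV_isCont[OF F[OF x]] by (simp add: isCont_def)
      have "uniform_limit (unit_lists n) (\<lambda>x vs. F n x * prod_list vs) (\<lambda>vs. F n x * prod_list vs) (at x)"
        unfolding uniform_limit_iff
      proof (intro allI impI)
        fix e :: real assume "e > 0"
        then have "\<forall>\<^sub>F y in at x. dist (F n y) (F n x) < e" using c by (simp add: tendsto_iff)
        then show "\<forall>\<^sub>F y in at x. \<forall>vs\<in>unit_lists n. dist (F n y * prod_list vs) (F n x * prod_list vs) < e"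
        proof eventually_elim
          case (elim y)
          have "\<bar>F n y - F n x\<bar> * \<bar>prod_list vs\<bar> < e" if "vs \<in> unit_lists n" for vs
            using elim mult_left_mono[OF p[OF that], of "\<bar>F n y - F n x\<bar>"] by (simp add: dist_norm)
          then show ?case by (simp add: dist_norm left_diff_distrib[symmetric] abs_mult)
        qed
      qed
      moreover have "norm (F n x * prod_list vs) \<le> \<bar>F n x\<bar>" if "vs \<in> unit_lists n" for vs
        using mult_left_mono[OF p[OF that], of "\<bar>F n x\<bar>"] by (simp add: abs_mult)
      ultimately show ?thesis unfolding ucont_def by blast
    qed
    case 0
    then show ?case using ucont by simp
    case (Suc j)
    have "((\<lambda>y. F n y * prod_list vs) has_derivative (\<lambda>v. F (Suc n) x * prod_list (v # vs))) (at x)"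
      if "x \<in> U" for x vs
    proof -
      have "((\<lambda>y. F n y * prod_list vs) has_derivative (\<lambda>v. F (Suc n) x * v * prod_list vs)) (at x)"
        using F[OF that] unfolding has_field_derivative_def by (rule has_derivative_mult_left)
      then show ?thesis by (simp add: mult.assoc)
    qed
    then show ?case
      using Suc[of "Suc n"] ucont
      by (auto intro!: exI[of _ "\<lambda>x vs. F (Suc n) x * prod_list vs"] simp del: prod_list.Cons)
  qed
  from this[of _ 0] have "Ck_fam j 0 U (\<lambda>x _. F 0 x)" for j
    by (rule Ck_fam_cong[OF U, rotated]) simp
  then show ?thesis using U by (simp add: Ck_on_iff_Ck_fam)
qed

lemma Ck_on_const: "open U \<Longrightarrow> Ck_on k U (\<lambda>x. c :: real)"
  for U :: "'a::real_normed_vector set"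
proof -
  assume U: "open U"
  have "Ck_fam j 0 U (\<lambda>x _. c)" for j
  proof (cases j)
    case (Suc i)
    have "ucont (unit_lists 0) (\<lambda>(x::'a) _. c) x" for x
      unfolding ucont_def by (auto intro: uniform_limit_const)
    moreover have "\<exists>E'. Ck_fam i (Suc 0) U E' \<and> (\<forall>x\<in>U. \<forall>vs. length vs = 0 \<longrightarrow>
        ((\<lambda>y. c) has_derivative (\<lambda>v. E' x (v # vs))) (at x))"
      by (rule exI[of _ "\<lambda>x vs. 0"]) (simp add: Ck_fam_zero)
    ultimately show ?thesis unfolding Suc Ck_fam.simps by blast
  qed (auto simp: ucont_def)
  then show ?thesis using U by (simp add: Ck_on_iff_Ck_fam)
qed

lemma Ck_on_affine: "Ck_on k UNIV (\<lambda>x. a * x + b :: real)"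
proof -
  define F where "F n = (\<lambda>x::real. if n = 0 then a * x + b else if n = 1 then a else 0)" for n :: nat
  have "(F n has_real_derivative F (Suc n) x) (at x)" for n x
    unfolding F_def by (cases "n = 0"; cases "n = 1"; cases "n = 2"; auto intro!: derivative_eq_intros)
  from Ck_on_derivative_seq[of UNIV F, OF open_UNIV this] show ?thesis by (simp add: F_def)
qed

lemma Ck_on_power2: "Ck_on k UNIV (\<lambda>x::real. x\<^sup>2)"
proof -
  define F where "F n = (\<lambda>x::real. if n = 0 then x\<^sup>2 else if n = 1 then 2 * x else if n = 2 then 2 else 0)" for n :: nat
  have "(F n has_real_derivative F (Suc n) x) (at x)" for n x
    unfolding F_def by (cases "n = 0"; cases "n = 1"; cases "n = 2"; auto intro!: derivative_eq_intros)
  from Ck_on_derivative_seq[of UNIV F, OF open_UNIV this] show ?thesis by (simp add: F_def)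
qed

lemma Ck_on_affine_comp: "open U \<Longrightarrow> Ck_on k U f \<Longrightarrow> Ck_on k U (\<lambda>x. a * f x + b :: real)"
  using Ck_on_compose[of U UNIV f k "\<lambda>x. a * x + b"] Ck_on_affine by simp

text \<open>Polarization: the product is half of the square of the sum minus half of each square,
  which reduces multiplication to composition with the square function.\<close>

lemma Ck_on_mult:
  fixes f g :: "'a::real_normed_vector \<Rightarrow> real"
  assumes U: "open U" and f: "Ck_on k U f" and g: "Ck_on k U g"
  shows "Ck_on k U (\<lambda>x. f x * g x)"
proof -
  have sq: "Ck_on k U (\<lambda>x. (h x)\<^sup>2)" if "Ck_on k U h" for h :: "'a \<Rightarrow> real"
    using Ck_on_compose[OF U open_UNIV _ Ck_on_power2 that] by simp
  have "Ck_on k U (\<lambda>x. 1 / 2 * (f x + g x)\<^sup>2 + 0 + ((- 1 / 2 * (f x)\<^sup>2 + 0) + (- 1 / 2 * (g x)\<^sup>2 + 0)))"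
    by (intro Ck_on_add Ck_on_affine_comp sq U f g)
  then show ?thesis
    by (rule Ck_on_cong[OF U, rotated]) (simp add: power2_eq_square field_simps)
qed

section \<open>A smooth step function on the line\<close>

lemma poly_exp_minus_tendsto_0: "((\<lambda>t::real. poly p t * exp (- t)) \<longlongrightarrow> 0) at_top"
proof -
  have "((\<lambda>t::real. \<Sum>i\<le>degree p. coeff p i * (t ^ i / exp t)) \<longlongrightarrow> (\<Sum>i\<le>degree p. coeff p i * 0)) at_top"
    by (intro tendsto_sum tendsto_mult tendsto_const tendsto_power_div_exp_0)
  moreover have "(\<Sum>i\<le>degree p. coeff p i * (t ^ i / exp t)) = poly p t * exp (- t)" for t :: real
    by (simp add: poly_altdef sum_distrib_right exp_minus divide_inverse mult.assoc)
  ultimately show ?thesis by simp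
qed

text \<open>With \<open>t = 1 / x\<close>, differentiation with respect to \<open>x\<close> is
  \<open>- t^2 d/dt\<close>, which takes \<open>p(t) exp(- t)\<close> to
  \<open>t^2 (p(t) - p'(t)) exp(- t)\<close>; \<open>[:0, 0, 1:]\<close> is the polynomial
  \<open>t^2\<close>.\<close>

primrec flat_poly :: "nat \<Rightarrow> real poly" where
  "flat_poly 0 = 1"
| "flat_poly (Suc n) = [:0, 0, 1:] * (flat_poly n - pderiv (flat_poly n))"

definition flat_deriv :: "nat \<Rightarrow> real \<Rightarrow> real" where
  "flat_deriv n x = (if x \<le> 0 then 0 else poly (flat_poly n) (1 / x) * exp (- (1 / x)))"

text \<open>At 0 the right difference quotient is \<open>t p(t) exp(- t)\<close> with
  \<open>t = 1 / x\<close> tending to infinity, where the exponential wins; from the left it is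
  0.\<close>

lemma flat_deriv_has_derivative: "(flat_deriv n has_real_derivative flat_deriv (Suc n) x) (at x)"
proof -
  consider "x < 0" | "x > 0" | "x = 0" by linarith
  then show ?thesis
  proof cases
    case 1
    have "((\<lambda>x. 0) has_real_derivative 0) (at x)" by simp
    then have "(flat_deriv n has_real_derivative 0) (at x)"
      by (rule has_field_derivative_transform_within_open[of _ _ _ "{..<0}"])
        (use 1 in \<open>auto simp: flat_deriv_def\<close>)
    then show ?thesis using 1 by (simp add: flat_deriv_def)
  next
    case 2
    have "((\<lambda>x. poly (flat_poly n) (1 / x) * exp (- (1 / x))) has_real_derivative
        poly (flat_poly (Suc n)) (1 / x) * exp (- (1 / x))) (at x)"
      using 2 by (auto intro!: derivative_eq_intros DERIV_chain'[OF _ poly_DERIV]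
          simp: field_simps power2_eq_square)
    then have "(flat_deriv n has_real_derivative poly (flat_poly (Suc n)) (1 / x) * exp (- (1 / x))) (at x)"
      by (rule has_field_derivative_transform_within_open[of _ _ _ "{0<..}"])
        (use 2 in \<open>auto simp: flat_deriv_def\<close>)
    then show ?thesis using 2 by (simp add: flat_deriv_def)
  next
    case 3
    have "((\<lambda>y. (flat_deriv n y - flat_deriv n 0) / (y - 0)) \<longlongrightarrow> 0) (at_left 0)"
      by (rule Lim_transform_eventually[OF tendsto_const])
        (auto simp: eventually_at_filter flat_deriv_def)
    moreover have "((\<lambda>y. (flat_deriv n y - flat_deriv n 0) / (y - 0)) \<longlongrightarrow> 0) (at_right 0)"
    proof (rule Lim_transform_eventually)
      show "((\<lambda>y. poly ([:0, 1:] * flat_poly n) (inverse y) * exp (- inverse y)) \<longlongrightarrow> 0) (at_right 0)"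
        by (rule filterlim_compose[OF poly_exp_minus_tendsto_0 filterlim_inverse_at_top_right])
      show "\<forall>\<^sub>F y in at_right 0. poly ([:0, 1:] * flat_poly n) (inverse y) * exp (- inverse y) =
          (flat_deriv n y - flat_deriv n 0) / (y - 0)"
        by (auto simp: eventually_at_filter flat_deriv_def field_simps)
    qed
    ultimately have "((\<lambda>y. (flat_deriv n y - flat_deriv n 0) / (y - 0)) \<longlongrightarrow> 0) (at 0)"
      by (simp add: filterlim_at_split)
    then show ?thesis unfolding 3 by (simp add: has_field_derivative_iff flat_deriv_def)
  qed
qed

lemma Ck_on_inverse: "Ck_on k {0<..} (\<lambda>x::real. inverse x)"
proof -
  define F where "F n x = (- 1) ^ n * fact n * inverse x ^ Suc n" for n :: nat and x :: real
  have "(F n has_real_derivative F (Suc n) x) (at x)" if "x \<in> {0<..}" for n x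
    unfolding F_def using that
    by (auto intro!: derivative_eq_intros simp: field_simps simp del: power_Suc)
      (simp add: field_simps)
  then have "Ck_on k {0<..} (F 0)" by (intro Ck_on_derivative_seq) auto
  moreover have "F 0 = inverse" by (simp add: F_def fun_eq_iff)
  ultimately show ?thesis by simp
qed

text \<open>The quotient of \<open>f x\<close> by \<open>f x + f (1 - x)\<close> for the flat
  function \<open>f\<close>; the denominator never vanishes because one of \<open>x\<close> and
  \<open>1 - x\<close> is positive. The Lipschitz constant comes from the bounded derivative on
  \<open>{0..1}\<close>.\<close>

lemma smooth_step_exists:
  obtains \<sigma> :: "real \<Rightarrow> real" and L where
    "\<And>k. Ck_on k UNIV \<sigma>" "\<And>x. x \<le> 0 \<Longrightarrow> \<sigma> x = 0" "\<And>x. x \<ge> 1 \<Longrightarrow> \<sigma> x = 1"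
    "\<And>x. 0 \<le> \<sigma> x" "\<And>x. \<sigma> x \<le> 1" "L \<ge> 1" "\<And>x y. \<bar>\<sigma> x - \<sigma> y\<bar> \<le> L * \<bar>x - y\<bar>"
proof -
  define f where "f = flat_deriv 0"
  have f_nonneg: "f x \<ge> 0" and f_pos: "x > 0 \<Longrightarrow> f x > 0" and f_0: "x \<le> 0 \<Longrightarrow> f x = 0" for x
    by (auto simp: f_def flat_deriv_def)
  have f: "Ck_on k UNIV f" for k
    unfolding f_def by (intro Ck_on_derivative_seq flat_deriv_has_derivative) simp
  have f': "Ck_on k UNIV (\<lambda>x. f (1 - x))" for k
    using Ck_on_compose[OF open_UNIV open_UNIV _ f Ck_on_affine[of k "-1" 1]] by simp
  have pos: "f x + f (1 - x) > 0" for x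
    using f_pos[of x] f_pos[of "1 - x"] f_nonneg[of x] f_nonneg[of "1 - x"] by (cases "x > 0") auto
  define \<sigma> where "\<sigma> x = f x * inverse (f x + f (1 - x))" for x
  have Ck: "Ck_on k UNIV \<sigma>" for k
    unfolding \<sigma>_def using pos
    by (intro Ck_on_mult f Ck_on_compose[OF _ _ _ Ck_on_inverse] Ck_on_add f') auto
  have 0: "\<sigma> x = 0" if "x \<le> 0" for x using f_0[OF that] by (simp add: \<sigma>_def)
  have 1: "\<sigma> x = 1" if "x \<ge> 1" for x
    using f_0[of "1 - x"] f_pos[of x] that by (simp add: \<sigma>_def)
  have ge: "\<sigma> x \<ge> 0" for x using pos[of x] f_nonneg by (simp add: \<sigma>_def)
  have le: "\<sigma> x \<le> 1" for x
    using pos[of x] f_nonneg[of "1 - x"] by (simp add: \<sigma>_def divide_inverse[symmetric])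
  have "Ck_fam 1 0 UNIV (\<lambda>x _. \<sigma> x)" using Ck_on_imp_Ck_fam[OF open_UNIV Ck[of "enat 1"], of 1] by blast
  then obtain E' where E': "Ck_fam 0 1 UNIV E'" "\<And>x. (\<sigma> has_derivative (\<lambda>v. E' x [v])) (at x)"
    by auto
  have "continuous (at x) (\<lambda>x. E' x [1])" for x
    using ucont_continuous[OF Ck_fam_ucont[OF E'(1)], of x "[1]"] by (simp add: unit_lists_def)
  then have "compact ((\<lambda>x. E' x [1]) ` {0..1})"
    by (intro compact_continuous_image continuous_at_imp_continuous_on) auto
  then have "bounded ((\<lambda>x. E' x [1]) ` {0..1})" by (rule compact_imp_bounded)
  then obtain M where M: "\<And>x. x \<in> {0..1} \<Longrightarrow> norm (E' x [1]) \<le> M"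
    unfolding bounded_iff by blast
  have lin: "E' x [v] = v * E' x [1]" for x v
    using linear_cmul[OF has_derivative_linear[OF E'(2)[of x]], of v 1] by simp
  have lip01: "norm (\<sigma> x - \<sigma> y) \<le> M * norm (x - y)" if "x \<in> {0..1}" "y \<in> {0..1}" for x y
  proof (rule differentiable_bound[of "{0..1}"])
    fix z :: real assume z: "z \<in> {0..1}"
    have "norm (E' z [v]) \<le> M * norm v" for v
      using mult_right_mono[OF M[OF z], of "norm v"] unfolding lin[of z v] norm_mult by (simp add: mult.commute)
    then show "onorm (\<lambda>v. E' z [v]) \<le> M"
      using order_trans[OF norm_ge_zero M[OF z]] by (intro onorm_bound) auto
  qed (use that E'(2) in \<open>auto intro: has_derivative_at_withinI\<close>)
  \<comment> \<open>Clamping to \<open>{0..1}\<close> does not change the value of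
    \<open>\<sigma>\<close> and does not increase distances, so the bound on the interval becomes
    global.\<close>
  define cl :: "real \<Rightarrow> real" where "cl x = max 0 (min 1 x)" for x
  have cl: "cl x \<in> {0..1}" "\<sigma> (cl x) = \<sigma> x" "\<bar>cl x - cl y\<bar> \<le> \<bar>x - y\<bar>" for x y
    using 0 1 by (auto simp: cl_def max_def min_def)
  have "M \<ge> 0" using order_trans[OF norm_ge_zero M[of 0]] by simp
  have "\<bar>\<sigma> x - \<sigma> y\<bar> \<le> max 1 M * \<bar>x - y\<bar>" for x y
  proof -
    have "\<bar>\<sigma> x - \<sigma> y\<bar> \<le> M * \<bar>cl x - cl y\<bar>"
      using lip01[OF cl(1) cl(1), of x y] by (simp add: cl(2))
    also have "\<dots> \<le> max 1 M * \<bar>x - y\<bar>"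
      using cl(3)[of x y] \<open>M \<ge> 0\<close> by (intro mult_mono) auto
    finally show ?thesis .
  qed
  then show ?thesis using that[OF Ck 0 1 ge le, of "max 1 M"] by auto
qed

section \<open>First derivatives of \<open>Ck_on\<close> maps\<close>

lemma Ck_on_strict_derivative:
  assumes U: "open U" "x \<in> U" and f: "Ck_on k U f" "1 \<le> k"
  shows "(f has_derivative frechet_derivative f (at x)) (at x)"
    and "e > 0 \<Longrightarrow> \<exists>d>0. ball x d \<subseteq> U \<and> (\<forall>y\<in>ball x d. \<forall>z\<in>ball x d.
      norm (f y - f z - frechet_derivative f (at x) (y - z)) \<le> e * norm (y - z))"
    and "continuous (at x) (\<lambda>y. frechet_derivative f (at y) v)"
proof -
  have "Ck_fam 1 0 U (\<lambda>x _. f x)"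
    using Ck_on_imp_Ck_fam[OF U(1) f(1), of 1] f(2) by (simp add: one_enat_def del: Ck_fam.simps)
  then obtain E' where E': "Ck_fam 0 1 U E'" "\<And>x. x \<in> U \<Longrightarrow> (f has_derivative (\<lambda>v. E' x [v])) (at x)"
    by auto
  have fr: "frechet_derivative f (at x) = (\<lambda>v. E' x [v])" if "x \<in> U" for x
    using frechet_derivative_at[OF E'(2)[OF that]] by simp
  show "(f has_derivative frechet_derivative f (at x)) (at x)"
    using E'(2) U(2) by (simp add: fr)
  show "\<exists>d>0. ball x d \<subseteq> U \<and> (\<forall>y\<in>ball x d. \<forall>z\<in>ball x d.
      norm (f y - f z - frechet_derivative f (at x) (y - z)) \<le> e * norm (y - z))" if "e > 0"
    using Ck_fam_strict_derivative[OF U, of 0 E' "\<lambda>x _. f x" e] E' that by (simp add: fr[OF U(2)])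
  \<comment> \<open>Continuity is known on unit lists, so \<open>v\<close> is shrunk to norm below
    1; the summand 1 also covers \<open>v = 0\<close>.\<close>
  define w where "w = v /\<^sub>R (norm v + 1)"
  have nv: "norm v + 1 > 0" using norm_ge_zero[of v] by linarith
  have "norm w = norm v / (norm v + 1)"
    using nv by (simp add: w_def divide_inverse mult.commute)
  then have w: "[w] \<in> unit_lists 1" using nv by (simp add: unit_lists_def)
  have sc: "(norm v + 1) *\<^sub>R E' y [w] = frechet_derivative f (at y) v" if "y \<in> U" for y
    using linear_cmul[OF has_derivative_linear[OF E'(2)[OF that]], of "norm v + 1" w] nv
    by (simp add: fr[OF that] w_def)
  have "((\<lambda>y. (norm v + 1) *\<^sub>R E' y [w]) \<longlongrightarrow> (norm v + 1) *\<^sub>R E' x [w]) (at x)"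
    using ucont_continuous[OF Ck_fam_ucont[OF E'(1) U(2)] w]
    by (intro tendsto_scaleR tendsto_const) (simp add: continuous_at)
  moreover have "\<forall>\<^sub>F y in at x. y \<in> U" using U eventually_at_topological by blast
  then have "\<forall>\<^sub>F y in at x. (norm v + 1) *\<^sub>R E' y [w] = frechet_derivative f (at y) v"
    by eventually_elim (rule sc)
  ultimately show "continuous (at x) (\<lambda>y. frechet_derivative f (at y) v)"
    unfolding continuous_at sc[OF U(2), symmetric] by (rule Lim_transform_eventually)
qed


section \<open>Charts and tangent vectors\<close>

locale C1_manifold =
  fixes A :: "('m::t2_space, 'x::banach) chart set" and l :: enat
  assumes smooth: "smooth_structure l A" and l: "1 \<le> l"
begin

lemma chart: "c \<in> A \<Longrightarrow> is_chart c"
  using smooth by (auto simp: smooth_structure_def)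

lemma chart_open: "c \<in> A \<Longrightarrow> open (fst c)" "c \<in> A \<Longrightarrow> open (cimage c)"
  using chart by (auto simp: is_chart_def)

lemma cinv_chart: "c \<in> A \<Longrightarrow> x \<in> fst c \<Longrightarrow> cinv c (snd c x) = x"
  and chart_cinv: "c \<in> A \<Longrightarrow> y \<in> cimage c \<Longrightarrow> snd c (cinv c y) = y"
  using chart unfolding is_chart_def homeomorphism_def by blast+

lemma cinv_in: "c \<in> A \<Longrightarrow> y \<in> cimage c \<Longrightarrow> cinv c y \<in> fst c"
  using chart unfolding is_chart_def homeomorphism_def by blast

lemma chart_in: "x \<in> fst c \<Longrightarrow> snd c x \<in> cimage c"
  by (simp add: cimage_def)

lemma open_chart_image: "c \<in> A \<Longrightarrow> open N \<Longrightarrow> N \<subseteq> fst c \<Longrightarrow> open (snd c ` N)"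
proof -
  assume c: "c \<in> A" and N: "open N" "N \<subseteq> fst c"
  have h: "homeomorphism (fst c) (cimage c) (snd c) (cinv c)" using chart[OF c] by (simp add: is_chart_def)
  have "openin (top_of_set (fst c)) N" using N by (auto simp: openin_open)
  then have "openin (top_of_set (cimage c)) (snd c ` N)"
    by (rule homeomorphism_imp_open_map[OF h])
  then show ?thesis using chart_open[OF c] by (auto simp: openin_open_eq)
qed

lemma open_chart_preimage: "c \<in> A \<Longrightarrow> open V \<Longrightarrow> open {x \<in> fst c. snd c x \<in> V}"
proof -
  assume c: "c \<in> A" and V: "open V"
  have "continuous_on (fst c) (snd c)"
    using chart[OF c] by (simp add: is_chart_def homeomorphism_def)
  then have "open (fst c \<inter> snd c -` V)"
    using chart_open[OF c] V by (metis continuous_on_open_vimage Int_commute)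
  moreover have "{x \<in> fst c. snd c x \<in> V} = fst c \<inter> snd c -` V" by auto
  ultimately show ?thesis by simp
qed

lemma transition_at: "c \<in> A \<Longrightarrow> x \<in> fst c \<Longrightarrow> transition c d (snd c x) = snd d x"
  by (simp add: transition_def cinv_chart)

lemma transition_domain: "c \<in> A \<Longrightarrow> d \<in> A \<Longrightarrow> open (snd c ` (fst c \<inter> fst d))"
  by (intro open_chart_image) (auto simp: chart_open)

lemma transition_Ck: "c \<in> A \<Longrightarrow> d \<in> A \<Longrightarrow> Ck_on l (snd c ` (fst c \<inter> fst d)) (transition c d)"
  using smooth by (auto simp: smooth_structure_def compatible_def)

lemma transition_has_derivative:
  assumes "c \<in> A" "d \<in> A" "x \<in> fst c" "x \<in> fst d"
  shows "(transition c d has_derivative frechet_derivative (transition c d) (at (snd c x))) (at (snd c x))"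
  using assms by (intro Ck_on_strict_derivative(1)[OF transition_domain _ transition_Ck l]) auto

text \<open>The cocycle rule, by the chain rule; it makes \<open>tangent_rel\<close> transitive and
  the class of a tangent vector independent of the chart used to represent it.\<close>

lemma transition_derivative_comp:
  assumes c: "c \<in> A" "d \<in> A" "e \<in> A" "x \<in> fst c" "x \<in> fst d" "x \<in> fst e"
  shows "frechet_derivative (transition c e) (at (snd c x)) v =
    frechet_derivative (transition d e) (at (snd d x)) (frechet_derivative (transition c d) (at (snd c x)) v)"
proof -
  let ?N = "fst c \<inter> fst d \<inter> fst e"
  have "(transition d e has_derivative frechet_derivative (transition d e) (at (snd d x))) (at (transition c d (snd c x)))"
    using transition_has_derivative[of d e x] c by (simp add: transition_at)
  then have "(transition d e \<circ> transition c d has_derivative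
      frechet_derivative (transition d e) (at (snd d x)) \<circ> frechet_derivative (transition c d) (at (snd c x))) (at (snd c x))"
    by (rule diff_chain_at[OF transition_has_derivative[OF c(1,2,4,5)]])
  then have "(transition c e has_derivative
      frechet_derivative (transition d e) (at (snd d x)) \<circ> frechet_derivative (transition c d) (at (snd c x))) (at (snd c x))"
  proof (rule has_derivative_transform_within_open)
    show "open (snd c ` ?N)" using c by (intro open_chart_image open_Int chart_open) auto
    fix y assume "y \<in> snd c ` ?N"
    then show "(transition d e \<circ> transition c d) y = transition c e y"
      using c by (auto simp: transition_at)
  qed (use c in auto)
  from fun_cong[OF frechet_derivative_at[OF this], of v] show ?thesis by simp
qed

lemma transition_self:
  assumes c: "c \<in> A" "x \<in> fst c"
  shows "frechet_derivative (transition c c) (at (snd c x)) v = v"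
proof -
  have "(transition c c has_derivative (\<lambda>v. v)) (at (snd c x))"
  proof (rule has_derivative_transform_within_open[OF has_derivative_ident])
    show "open (cimage c)" using c chart_open by blast
    fix y assume "y \<in> cimage c"
    then show "y = transition c c y" using c by (simp add: transition_def chart_cinv)
  qed (use chart_in[OF c(2)] in simp)
  from fun_cong[OF frechet_derivative_at[OF this], of v] show ?thesis by simp
qed

lemma dchart_inv_eq:
  "c \<in> A \<Longrightarrow> p \<in> fst c \<Longrightarrow> dchart_inv A c p v =
     {(d, frechet_derivative (transition c d) (at (snd c p)) v) |d. d \<in> A \<and> p \<in> fst d}"
  by (auto simp: dchart_inv_def tangent_rel_def)

lemma dchart_inv_mem:
  "c \<in> A \<Longrightarrow> p \<in> fst c \<Longrightarrow> (d, w) \<in> dchart_inv A c p v \<longleftrightarrow>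
     d \<in> A \<and> p \<in> fst d \<and> w = frechet_derivative (transition c d) (at (snd c p)) v"
  by (auto simp: dchart_inv_def tangent_rel_def)

lemma dchart_inv_change:
  assumes "c \<in> A" "d \<in> A" "p \<in> fst c" "p \<in> fst d"
  shows "dchart_inv A d p (frechet_derivative (transition c d) (at (snd c p)) v) = dchart_inv A c p v"
  using assms transition_derivative_comp[of c d _ p v]
  by (fastforce simp: dchart_inv_eq)

lemma tangent_space_eq: "c \<in> A \<Longrightarrow> p \<in> fst c \<Longrightarrow> tangent_space A p = range (dchart_inv A c p)"
proof -
  assume c: "c \<in> A" "p \<in> fst c"
  have "a \<in> range (dchart_inv A c p)" if "a \<in> tangent_space A p" for a
  proof -
    obtain d w where "d \<in> A" "p \<in> fst d" "a = dchart_inv A d p w"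
      using \<open>a \<in> tangent_space A p\<close> unfolding tangent_space_def quotient_def dchart_inv_def by blast
    then show ?thesis using dchart_inv_change[of d c p w] c by (metis rangeI)
  qed
  moreover have "dchart_inv A c p v \<in> tangent_space A p" for v
    using c unfolding tangent_space_def dchart_inv_def by (auto intro: quotientI)
  ultimately show ?thesis by auto
qed

lemma dchart_dchart_inv: "c \<in> A \<Longrightarrow> p \<in> fst c \<Longrightarrow> dchart c (dchart_inv A c p v) = v"
  unfolding dchart_def by (rule the_equality) (simp_all add: dchart_inv_mem transition_self)

end

section \<open>Regularity of paracompact Hausdorff spaces\<close>

text \<open>The set \<open>U\<close> and the open sets whose closure misses \<open>x\<close> cover
  the space. In a locally finite refinement, the members not contained in \<open>U\<close> have
  closures missing \<open>x\<close>; by local finiteness the closure of their union misses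
  \<open>x\<close> too, and its complement is the required neighbourhood.\<close>

lemma paracompact_regular:
  fixes x :: "'m::t2_space"
  assumes para: "paracompact TYPE('m)" and U: "open U" "x \<in> U"
  obtains N where "open N" "x \<in> N" "closure N \<subseteq> U"
proof -
  let ?\<U> = "insert U {V. open V \<and> x \<notin> closure V}"
  have "\<exists>V. open V \<and> y \<in> V \<and> x \<notin> closure V" if neq: "y \<noteq> x" for y
  proof -
    obtain S V where "open S" "open V" "x \<in> S" "y \<in> V" "S \<inter> V = {}"
      using hausdorff[of x y] neq by blast
    then show ?thesis using open_Int_closure_eq_empty[of S V] by blast
  qed
  then have "\<Union>?\<U> = UNIV" using U by blast
  moreover have "\<forall>V\<in>?\<U>. open V" using U by blast
  ultimately have "(\<forall>V\<in>?\<U>. open V) \<and> \<Union>?\<U> = UNIV" by blast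
  from para[unfolded paracompact_def, THEN spec, THEN mp, OF this]
  obtain \<V> where \<V>: "\<forall>V\<in>\<V>. open V" "\<Union>\<V> = UNIV"
    "\<forall>V\<in>\<V>. \<exists>U\<in>?\<U>. V \<subseteq> U" "locally_finite_in euclidean \<V>"
    by (elim exE conjE)
  define \<W> where "\<W> = {V \<in> \<V>. \<not> V \<subseteq> U}"
  have "x \<notin> closure V" if V: "V \<in> \<W>" for V
  proof -
    obtain V' where "V' \<in> ?\<U>" "V \<subseteq> V'" using V \<V>(3) unfolding \<W>_def by blast
    moreover then have "V' \<noteq> U" using V unfolding \<W>_def by blast
    ultimately show ?thesis using closure_mono[of V V'] by blast
  qed
  moreover have "closure (\<Union>\<W>) = \<Union>(closure ` \<W>)"
  proof -
    have "locally_finite_in euclidean \<W>"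
      using \<V>(4) by (rule locally_finite_in_subset) (auto simp: \<W>_def)
    from closure_of_locally_finite_Union[OF this] show ?thesis by simp
  qed
  ultimately have "x \<in> - closure (\<Union>\<W>)" by blast
  moreover have "closure (- closure (\<Union>\<W>)) \<subseteq> U"
  proof -
    have "- U \<subseteq> \<Union>\<W>"
    proof
      fix y assume y: "y \<in> - U"
      have "y \<in> \<Union>\<V>" using \<V>(2) by simp
      then obtain V where "V \<in> \<V>" "y \<in> V" by (rule UnionE)
      then show "y \<in> \<Union>\<W>" using y unfolding \<W>_def by blast
    qed
    then have "- \<Union>\<W> \<subseteq> U" by blast
    moreover have "open (\<Union>\<W>)" using \<V>(1) unfolding \<W>_def by (intro open_Union) blast
    then have "closure (- closure (\<Union>\<W>)) \<subseteq> - \<Union>\<W>"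
      by (intro closure_minimal) (simp_all add: closure_subset closed_Compl)
    ultimately show ?thesis by (rule order_trans[rotated])
  qed
  ultimately show ?thesis using that[of "- closure (\<Union>\<W>)"] by (simp add: open_Compl)
qed

section \<open>Lipschitz functions on a manifold\<close>

text \<open>Bisection chains the local estimates. \<open>P\<close> is vacuous for pairs outside
  \<open>{a..b}\<close>, because the small intervals around \<open>t\<close> considered by
  \<open>Bolzano\<close> may stick out.\<close>

lemma lipschitz_on_interval_if_locally:
  fixes \<phi> :: "real \<Rightarrow> real"
  assumes "a \<le> b" and local: "\<And>t. t \<in> {a..b} \<Longrightarrow> \<exists>d>0. \<forall>s\<in>{a..b}. \<forall>r\<in>{a..b}.
    \<bar>s - t\<bar> < d \<longrightarrow> \<bar>r - t\<bar> < d \<longrightarrow> \<bar>\<phi> s - \<phi> r\<bar> \<le> M * \<bar>s - r\<bar>"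
  shows "\<bar>\<phi> a - \<phi> b\<bar> \<le> M * (b - a)"
proof -
  define P where "P s r \<longleftrightarrow> (a \<le> s \<and> s \<le> r \<and> r \<le> b \<longrightarrow> \<bar>\<phi> s - \<phi> r\<bar> \<le> M * (r - s))" for s r
  have "P a b"
    using assms(1)
  proof (induct rule: Bolzano)
    case (trans x y z)
    then show ?case unfolding P_def by (auto simp: algebra_simps)
  next
    case (local t)
    then obtain d where d: "d > 0" "\<forall>s\<in>{a..b}. \<forall>r\<in>{a..b}.
        \<bar>s - t\<bar> < d \<longrightarrow> \<bar>r - t\<bar> < d \<longrightarrow> \<bar>\<phi> s - \<phi> r\<bar> \<le> M * \<bar>s - r\<bar>"
      using assms(2)[of t] by auto
    have "P s r" if "s \<le> t \<and> t \<le> r \<and> r - s < d" for s r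
      unfolding P_def
    proof (intro impI)
      assume "a \<le> s \<and> s \<le> r \<and> r \<le> b"
      then have "\<bar>\<phi> s - \<phi> r\<bar> \<le> M * \<bar>s - r\<bar>"
        using that by (intro d(2)[rule_format]) auto
      then show "\<bar>\<phi> s - \<phi> r\<bar> \<le> M * (r - s)" using \<open>a \<le> s \<and> s \<le> r \<and> r \<le> b\<close> by simp
    qed
    then show ?case using d(1) by blast
  qed
  then show ?thesis using assms(1) by (simp add: P_def)
qed

text \<open>
  \<open>closed_half\<close> is a genuine condition: in infinite dimensions a closed ball of a chart need not be
  closed in the manifold.
\<close>

locale patches = C1_manifold A l for A :: "('m::t2_space, 'x::banach) chart set" and l :: enat +
  fixes F :: "('m, 'x) finsler" and k :: enat and K C0 :: real
    and ch :: "'m \<Rightarrow> ('m, 'x) chart" and \<nu> :: "'m \<Rightarrow> 'x \<Rightarrow> real" and rad :: "'m \<Rightarrow> real"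
  assumes k: "1 \<le> k" and K: "1 \<le> K" and C0: "1 \<le> C0"
    and ch: "ch i \<in> A" "i \<in> fst (ch i)"
    and eqn: "equivalent_norm (\<nu> i)"
    and star: "star_property k (\<nu> i) C0"
    and F_lower: "x \<in> fst (ch i) \<Longrightarrow> \<nu> i v \<le> K * F (x, dchart_inv A (ch i) x v)"
    and F_upper: "x \<in> fst (ch i) \<Longrightarrow> F (x, dchart_inv A (ch i) x v) \<le> K * \<nu> i v"
    and rad: "rad i > 0"
    and ball_chart: "\<nu> i (z - snd (ch i) i) < rad i \<Longrightarrow> z \<in> cimage (ch i)"
    and closed_half: "closed {x \<in> fst (ch i). \<nu> i (snd (ch i) x - snd (ch i) i) \<le> rad i / 2}"
begin

definition "crd i = snd (ch i)"
definition "patch i = {x \<in> fst (ch i). \<nu> i (crd i x - crd i i) < rad i}"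
definition "kap = K * K + 1"

lemma norm_nonneg: "\<nu> i v \<ge> 0" and norm_zero: "\<nu> i 0 = 0"
  and norm_scale: "\<nu> i (r *\<^sub>R v) = \<bar>r\<bar> * \<nu> i v" and norm_tri: "\<nu> i (v + w) \<le> \<nu> i v + \<nu> i w"
  using eqn[of i] by (auto simp: equivalent_norm_def is_norm_def)

lemma norm_minus: "\<nu> i (- v) = \<nu> i v"
  using norm_scale[of i "-1" v] by simp

lemma norm_sym: "\<nu> i (v - w) = \<nu> i (w - v)"
  using norm_minus[of i "v - w"] by simp

lemma norm_equiv: obtains a b where "a > 0" "b > 0" "\<And>v. a * norm v \<le> \<nu> i v" "\<And>v. \<nu> i v \<le> b * norm v"
  using eqn[of i] by (auto simp: equivalent_norm_def)

lemma kap: "kap \<ge> 1"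
  using K by (simp add: kap_def)

lemma continuous_norm: "continuous_on UNIV (\<nu> i)"
proof -
  obtain a b where b: "b > 0" "\<And>v. \<nu> i v \<le> b * norm v"
    by (rule norm_equiv[of i]) blast
  have "\<bar>\<nu> i v - \<nu> i w\<bar> \<le> b * norm (v - w)" for v w
  proof -
    have "\<nu> i v \<le> \<nu> i w + \<nu> i (v - w)" "\<nu> i w \<le> \<nu> i v + \<nu> i (v - w)"
      using norm_tri[of i w "v - w"] norm_tri[of i v "w - v"] norm_sym[of i v w] by simp_all
    then show ?thesis using b(2)[of "v - w"] by linarith
  qed
  then have "b-lipschitz_on UNIV (\<nu> i)"
    using b by (intro lipschitz_onI) (auto simp: dist_norm)
  then show ?thesis by (rule lipschitz_on_continuous_on)
qed

lemma open_norm_ball: "open {z. \<nu> i (z - p) < r}"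
  by (intro open_Collect_less continuous_intros continuous_on_compose2[OF continuous_norm]) auto

lemma patch_self: "i \<in> patch i"
  using ch rad by (simp add: patch_def norm_zero)

lemma patch_chart: "patch i \<subseteq> fst (ch i)"
  by (auto simp: patch_def)

lemma open_patch: "open (patch i)"
proof -
  have "patch i = {x \<in> fst (ch i). snd (ch i) x \<in> {z. \<nu> i (z - crd i i) < rad i}}"
    by (auto simp: patch_def crd_def)
  then show ?thesis using open_chart_preimage[OF ch(1) open_norm_ball] by simp
qed

lemma open_sub_ball: "open {y \<in> patch i. \<nu> i (crd i y - crd i x) < r}"
proof -
  have "{y \<in> patch i. \<nu> i (crd i y - crd i x) < r} =
      patch i \<inter> {y \<in> fst (ch i). snd (ch i) y \<in> {z. \<nu> i (z - crd i x) < r}}"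
    by (auto simp: patch_def crd_def)
  then show ?thesis using open_chart_preimage[OF ch(1) open_norm_ball] open_patch by (simp add: open_Int)
qed

lemma cinv_crd: "x \<in> fst (ch i) \<Longrightarrow> cinv (ch i) (crd i x) = x"
  unfolding crd_def by (rule cinv_chart[OF ch(1)])

lemma crd_image: "crd i ` patch i = {z. \<nu> i (z - crd i i) < rad i}"
proof
  show "{z. \<nu> i (z - crd i i) < rad i} \<subseteq> crd i ` patch i"
  proof
    fix z assume z: "z \<in> {z. \<nu> i (z - crd i i) < rad i}"
    then have "z \<in> cimage (ch i)" using ball_chart by (simp add: crd_def)
    then have "cinv (ch i) z \<in> fst (ch i)" "crd i (cinv (ch i) z) = z"
      using cinv_in[OF ch(1)] chart_cinv[OF ch(1)] by (auto simp: crd_def)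
    then show "z \<in> crd i ` patch i" using z by (force simp: patch_def intro: rev_image_eqI[of "cinv (ch i) z"])
  qed
qed (auto simp: patch_def)

lemma convex_crd_image: "convex (crd i ` patch i)"
  unfolding crd_image convex_def
proof (intro ballI allI impI CollectI)
  fix x y u v assume xy: "x \<in> {z. \<nu> i (z - crd i i) < rad i}" "y \<in> {z. \<nu> i (z - crd i i) < rad i}"
    and uv: "0 \<le> u" "0 \<le> v" "u + v = (1::real)"
  have "u *\<^sub>R x + v *\<^sub>R y - crd i i = u *\<^sub>R (x - crd i i) + v *\<^sub>R (y - crd i i)"
    using uv by (simp add: algebra_simps) (metis scaleR_add_left scaleR_one)
  then have "\<nu> i (u *\<^sub>R x + v *\<^sub>R y - crd i i) \<le> u * \<nu> i (x - crd i i) + v * \<nu> i (y - crd i i)"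
    using norm_tri[of i "u *\<^sub>R (x - crd i i)" "v *\<^sub>R (y - crd i i)"] uv by (simp add: norm_scale)
  also have "\<dots> < rad i"
    using convex_bound_lt[of "\<nu> i (x - crd i i)" "rad i" "\<nu> i (y - crd i i)" u v] xy uv by simp
  finally show "\<nu> i (u *\<^sub>R x + v *\<^sub>R y - crd i i) < rad i" .
qed

section \<open>Functions that are Lipschitz in every patch\<close>

definition plip :: "real \<Rightarrow> ('m \<Rightarrow> real) \<Rightarrow> bool" where
  "plip L u \<longleftrightarrow> (\<forall>i. \<forall>y\<in>patch i. \<forall>z\<in>patch i. \<bar>u y - u z\<bar> \<le> L * \<nu> i (crd i y - crd i z))"

text \<open>
  The Finsler norm compares the norms of different patches up to the factor \<open>K\<^sup>2\<close>. Strict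
  differentiability of the transition map turns this into a statement on coordinate differences;
  the summand \<open>1\<close> in \<open>kap\<close> absorbs the remainder.
\<close>

lemma patch_change:
  assumes x: "x \<in> patch i" "x \<in> patch j"
  obtains N where "open N" "x \<in> N" "N \<subseteq> patch i \<inter> patch j"
    "\<And>y z. y \<in> N \<Longrightarrow> z \<in> N \<Longrightarrow> \<nu> j (crd j y - crd j z) \<le> kap * \<nu> i (crd i y - crd i z)"
proof -
  have xf: "x \<in> fst (ch i)" "x \<in> fst (ch j)" using x patch_chart by auto
  define T where "T = transition (ch i) (ch j)"
  define D where "D = frechet_derivative T (at (crd i x))"
  obtain a b' where a: "a > 0" "\<And>v. a * norm v \<le> \<nu> i v"
    by (rule norm_equiv[of i]) blast
  obtain a' b where b: "b > 0" "\<And>v. \<nu> j v \<le> b * norm v"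
    by (rule norm_equiv[of j]) blast
  let ?S = "snd (ch i) ` (fst (ch i) \<inter> fst (ch j))"
  \<comment> \<open>The accuracy \<open>a / b\<close> makes the remainder, measured in
    \<open>\<nu> j\<close>, at most the coordinate difference in \<open>\<nu> i\<close>.\<close>
  have "\<exists>d>0. ball (crd i x) d \<subseteq> ?S \<and> (\<forall>y\<in>ball (crd i x) d. \<forall>z\<in>ball (crd i x) d.
      norm (T y - T z - D (y - z)) \<le> a / b * norm (y - z))"
    unfolding T_def D_def using xf a b
    by (intro Ck_on_strict_derivative(2)[OF transition_domain[OF ch(1) ch(1)] _ transition_Ck[OF ch(1) ch(1)] l])
      (auto simp: crd_def)
  then obtain d where d: "d > 0" "\<And>y z. y \<in> ball (crd i x) d \<Longrightarrow> z \<in> ball (crd i x) d \<Longrightarrow>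
      norm (T y - T z - D (y - z)) \<le> a / b * norm (y - z)"
    by blast
  define N where "N = patch i \<inter> patch j \<inter> {y \<in> fst (ch i). snd (ch i) y \<in> ball (crd i x) d}"
  have "open N"
    unfolding N_def by (intro open_Int open_patch open_chart_preimage[OF ch(1)]) simp
  moreover have "x \<in> N" using x xf d(1) by (simp add: N_def crd_def)
  moreover have "\<nu> j (crd j y - crd j z) \<le> kap * \<nu> i (crd i y - crd i z)" if "y \<in> N" "z \<in> N" for y z
  proof -
    have T: "T (crd i w) = crd j w" if "w \<in> N" for w
      using that transition_at[OF ch(1), of w i "ch j"] patch_chart[of i] by (auto simp: T_def crd_def N_def)
    have yz: "norm (T (crd i y) - T (crd i z) - D (crd i y - crd i z)) \<le> a / b * norm (crd i y - crd i z)"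
      using that by (intro d(2)) (auto simp: N_def crd_def)
    have "\<nu> j (D v) \<le> K * K * \<nu> i v" for v
    proof -
      have "\<nu> j (D v) \<le> K * F (x, dchart_inv A (ch j) x (D v))"
        by (rule F_lower[OF xf(2)])
      also have "dchart_inv A (ch j) x (D v) = dchart_inv A (ch i) x v"
        unfolding D_def T_def crd_def by (rule dchart_inv_change[OF ch(1) ch(1) xf])
      also have "K * F (x, dchart_inv A (ch i) x v) \<le> K * (K * \<nu> i v)"
        using F_upper[OF xf(1), of v] K by (intro mult_left_mono) auto
      finally show ?thesis by simp
    qed
    note DK = this[of "crd i y - crd i z"]
    have "crd j y - crd j z = D (crd i y - crd i z) + (T (crd i y) - T (crd i z) - D (crd i y - crd i z))"
      using that by (simp add: T)
    then have "\<nu> j (crd j y - crd j z) \<le> \<nu> j (D (crd i y - crd i z))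
        + \<nu> j (T (crd i y) - T (crd i z) - D (crd i y - crd i z))"
      using norm_tri by metis
    also have "\<nu> j (T (crd i y) - T (crd i z) - D (crd i y - crd i z)) \<le> b * (a / b * norm (crd i y - crd i z))"
      using b(2) yz b(1) by (meson mult_left_mono less_imp_le order_trans)
    also have "\<dots> = a * norm (crd i y - crd i z)" using b(1) by simp
    also have "\<dots> \<le> \<nu> i (crd i y - crd i z)" by (rule a(2))
    finally show ?thesis using DK by (simp add: kap_def algebra_simps)
  qed
  ultimately show ?thesis by (intro that[of N]) (auto simp: N_def)
qed

text \<open>In coordinates a patch is a ball, so two of its points are joined by a segment inside
  it. Near every point of the segment the local estimate, valid in some other patch, is carried over
  by \<open>patch_change\<close> at the price of \<open>kap\<close>, and the pieces are chained
  along the segment.\<close>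

lemma plip_if_locally:
  assumes L: "L \<ge> 0" and loc: "\<And>x. \<exists>N j. open N \<and> x \<in> N \<and> x \<in> patch j \<and>
    (\<forall>y\<in>N \<inter> patch j. \<forall>z\<in>N \<inter> patch j. \<bar>u y - u z\<bar> \<le> L * \<nu> j (crd j y - crd j z))"
  shows "plip (kap * L) u"
  unfolding plip_def
proof (intro allI ballI)
  fix i y z assume y: "y \<in> patch i" and z: "z \<in> patch i"
  define w where "w t = crd i y + t *\<^sub>R (crd i z - crd i y)" for t
  define \<gamma> where "\<gamma> t = cinv (ch i) (w t)" for t
  have w: "w t \<in> crd i ` patch i" if "t \<in> {0..1}" for t
  proof -
    have "w t = (1 - t) *\<^sub>R crd i y + t *\<^sub>R crd i z" by (simp add: w_def algebra_simps)
    then show ?thesis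
      using convexD[OF convex_crd_image imageI[OF y] imageI[OF z], of "1 - t" t] that by simp
  qed
  have \<gamma>: "\<gamma> t \<in> patch i" "crd i (\<gamma> t) = w t" if t: "t \<in> {0..1}" for t
  proof -
    obtain q where "q \<in> patch i" "w t = crd i q" using w[OF t] by blast
    then show "\<gamma> t \<in> patch i" "crd i (\<gamma> t) = w t"
      using cinv_crd patch_chart[of i] by (auto simp: \<gamma>_def)
  qed
  let ?n = "\<nu> i (crd i z - crd i y)"
  have wst: "\<nu> i (w s - w r) = \<bar>s - r\<bar> * ?n" for s r
  proof -
    have "w s - w r = (s - r) *\<^sub>R (crd i z - crd i y)" by (simp add: w_def algebra_simps)
    then show ?thesis by (simp add: norm_scale)
  qed
  have "\<bar>u (\<gamma> 0) - u (\<gamma> 1)\<bar> \<le> (kap * L * ?n) * (1 - 0)"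
  proof (rule lipschitz_on_interval_if_locally[of 0 1 "\<lambda>t. u (\<gamma> t)"])
    fix t :: real assume t: "t \<in> {0..1}"
    obtain N j where N: "open N" "\<gamma> t \<in> N" "\<gamma> t \<in> patch j"
      "\<And>y z. y \<in> N \<inter> patch j \<Longrightarrow> z \<in> N \<inter> patch j \<Longrightarrow> \<bar>u y - u z\<bar> \<le> L * \<nu> j (crd j y - crd j z)"
      using loc[of "\<gamma> t"] by blast
    obtain N' where N': "open N'" "\<gamma> t \<in> N'" "N' \<subseteq> patch i \<inter> patch j"
      "\<And>y z. y \<in> N' \<Longrightarrow> z \<in> N' \<Longrightarrow> \<nu> j (crd j y - crd j z) \<le> kap * \<nu> i (crd i y - crd i z)"
      using patch_change[OF \<gamma>(1)[OF t] N(3)] by blast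
    have "open (crd i ` (N \<inter> N'))"
      unfolding crd_def using N N' patch_chart[of i] by (intro open_chart_image[OF ch(1)]) auto
    moreover have "w t \<in> crd i ` (N \<inter> N')"
      using N N' \<gamma>[OF t] by (metis IntI imageI)
    moreover have "isCont w t" unfolding w_def by (intro continuous_intros)
    ultimately obtain d where d: "d > 0" "\<And>s. \<bar>s - t\<bar> < d \<Longrightarrow> w s \<in> crd i ` (N \<inter> N')"
      unfolding continuous_at_open by (metis open_dist dist_real_def)
    have mem: "\<gamma> s \<in> N \<inter> N'" if s: "\<bar>s - t\<bar> < d" for s
    proof -
      obtain q where "q \<in> N \<inter> N'" "w s = crd i q" using d(2)[OF s] by blast
      then show ?thesis
        using cinv_crd[of q i] N'(3) patch_chart[of i] by (auto simp: \<gamma>_def)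
    qed
    have "\<bar>u (\<gamma> s) - u (\<gamma> r)\<bar> \<le> kap * L * ?n * \<bar>s - r\<bar>"
      if "s \<in> {0..1}" "r \<in> {0..1}" "\<bar>s - t\<bar> < d" "\<bar>r - t\<bar> < d" for s r
    proof -
      have "\<bar>u (\<gamma> s) - u (\<gamma> r)\<bar> \<le> L * \<nu> j (crd j (\<gamma> s) - crd j (\<gamma> r))"
        using mem[OF that(3)] mem[OF that(4)] N'(3) by (intro N(4)) auto
      also have "\<dots> \<le> L * (kap * \<nu> i (crd i (\<gamma> s) - crd i (\<gamma> r)))"
        using mem[OF that(3)] mem[OF that(4)] L by (intro mult_left_mono N'(4)) auto
      also have "\<dots> = kap * L * ?n * \<bar>s - r\<bar>"
        using that by (simp add: \<gamma>(2) wst)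
      finally show ?thesis .
    qed
    then show "\<exists>d>0. \<forall>s\<in>{0..1}. \<forall>r\<in>{0..1}. \<bar>s - t\<bar> < d \<longrightarrow> \<bar>r - t\<bar> < d \<longrightarrow>
        \<bar>u (\<gamma> s) - u (\<gamma> r)\<bar> \<le> kap * L * ?n * \<bar>s - r\<bar>"
      using d(1) by blast
  qed simp
  moreover have "\<gamma> 0 = y" "\<gamma> 1 = z"
    using cinv_crd y z patch_chart[of i] by (auto simp: \<gamma>_def w_def)
  ultimately show "\<bar>u y - u z\<bar> \<le> kap * L * \<nu> i (crd i y - crd i z)"
    by (simp add: norm_sym)
qed

lemma plip_min:
  assumes "plip L u" "plip L v"
  shows "plip L (\<lambda>x. min (u x) (v x))"
  unfolding plip_def
proof (intro allI ballI)
  fix i y z assume "y \<in> patch i" "z \<in> patch i"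
  then have "\<bar>u y - u z\<bar> \<le> L * \<nu> i (crd i y - crd i z)" "\<bar>v y - v z\<bar> \<le> L * \<nu> i (crd i y - crd i z)"
    using assms unfolding plip_def by auto
  then show "\<bar>min (u y) (v y) - min (u z) (v z)\<bar> \<le> L * \<nu> i (crd i y - crd i z)" by linarith
qed

lemma plip_affine: "plip L u \<Longrightarrow> \<bar>a\<bar> \<le> 1 \<Longrightarrow> plip L (\<lambda>x. a * u x + b)"
  unfolding plip_def
proof (intro allI ballI)
  fix i y z assume "\<forall>i. \<forall>y\<in>patch i. \<forall>z\<in>patch i. \<bar>u y - u z\<bar> \<le> L * \<nu> i (crd i y - crd i z)"
    and a: "\<bar>a\<bar> \<le> 1" and yz: "y \<in> patch i" "z \<in> patch i"
  then have "\<bar>u y - u z\<bar> \<le> L * \<nu> i (crd i y - crd i z)" by blast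
  moreover have "\<bar>a\<bar> * \<bar>u y - u z\<bar> \<le> 1 * \<bar>u y - u z\<bar>" using a by (rule mult_right_mono) simp
  ultimately show "\<bar>a * u y + b - (a * u z + b)\<bar> \<le> L * \<nu> i (crd i y - crd i z)"
    by (simp add: abs_mult[symmetric] right_diff_distrib)
qed

text \<open>The Lipschitz constant is not affected by the number of functions, which is why the
  layers are built from suprema of tents rather than sums.\<close>

lemma plip_Sup:
  assumes S: "S \<noteq> {}" and "\<And>s. s \<in> S \<Longrightarrow> plip L (u s)" and bd: "\<And>s x. s \<in> S \<Longrightarrow> u s x \<le> (B::real)"
  shows "plip L (\<lambda>x. SUP s\<in>S. u s x)"
  unfolding plip_def
proof (intro allI ballI)
  fix i y z assume yz: "y \<in> patch i" "z \<in> patch i"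
  have le: "(SUP s\<in>S. u s y) \<le> (SUP s\<in>S. u s z) + L * \<nu> i (crd i y - crd i z)"
    if "y \<in> patch i" "z \<in> patch i" for y z
  proof (rule cSUP_least[OF S])
    fix s assume s: "s \<in> S"
    have "\<bar>u s y - u s z\<bar> \<le> L * \<nu> i (crd i y - crd i z)"
      using assms(2)[OF s] that unfolding plip_def by blast
    moreover have "u s z \<le> (SUP s\<in>S. u s z)"
      using s bd by (intro cSUP_upper bdd_aboveI2[of S _ B]) auto
    ultimately show "u s y \<le> (SUP s\<in>S. u s z) + L * \<nu> i (crd i y - crd i z)" by linarith
  qed
  from le[OF yz] le[OF yz(2,1)] norm_sym[of i "crd i y" "crd i z"]
  show "\<bar>(SUP s\<in>S. u s y) - (SUP s\<in>S. u s z)\<bar> \<le> L * \<nu> i (crd i y - crd i z)"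
    by simp
qed

lemma plip_mult_unit:
  assumes "plip L u" "plip M v" and "\<And>x. 0 \<le> u x \<and> u x \<le> 1" "\<And>x. 0 \<le> v x \<and> v x \<le> 1"
  shows "plip (L + M) (\<lambda>x. u x * v x)"
  unfolding plip_def
proof (intro allI ballI)
  fix i y z assume yz: "y \<in> patch i" "z \<in> patch i"
  let ?n = "\<nu> i (crd i y - crd i z)"
  have 1: "\<bar>u y - u z\<bar> \<le> L * ?n" "\<bar>v y - v z\<bar> \<le> M * ?n"
    using assms(1,2) yz unfolding plip_def by auto
  have "u y * v y - u z * v z = (u y - u z) * v y + u z * (v y - v z)" by (simp add: algebra_simps)
  then have "\<bar>u y * v y - u z * v z\<bar> \<le> \<bar>u y - u z\<bar> * \<bar>v y\<bar> + \<bar>u z\<bar> * \<bar>v y - v z\<bar>"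
    using abs_triangle_ineq[of "(u y - u z) * v y" "u z * (v y - v z)"] by (simp add: abs_mult)
  also have "\<dots> \<le> \<bar>u y - u z\<bar> * 1 + 1 * \<bar>v y - v z\<bar>"
    using assms(3)[of z] assms(4)[of y] by (intro add_mono mult_left_mono mult_right_mono) auto
  finally show "\<bar>u y * v y - u z * v z\<bar> \<le> (L + M) * ?n" using 1 by (simp add: algebra_simps)
qed

lemma plip_nhd:
  assumes "plip L u" "e > 0"
  obtains N where "open N" "x \<in> N" "N \<subseteq> patch x" "\<And>y. y \<in> N \<Longrightarrow> \<bar>u y - u x\<bar> < e"
proof -
  define r where "r = e / (\<bar>L\<bar> + 1)"
  have r: "r > 0" using assms by (simp add: r_def)
  let ?N = "{y \<in> patch x. \<nu> x (crd x y - crd x x) < r}"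
  have "\<bar>u y - u x\<bar> < e" if "y \<in> ?N" for y
  proof -
    have "\<bar>u y - u x\<bar> \<le> L * \<nu> x (crd x y - crd x x)"
      using assms(1) that patch_self unfolding plip_def by blast
    also have "\<dots> \<le> (\<bar>L\<bar> + 1) * \<nu> x (crd x y - crd x x)"
      using norm_nonneg by (intro mult_right_mono) auto
    also have "\<dots> < (\<bar>L\<bar> + 1) * r" using that by (intro mult_strict_left_mono) auto
    also have "\<dots> = e" by (simp add: r_def)
    finally show ?thesis .
  qed
  then show ?thesis
    using patch_self r by (intro that[of ?N] open_sub_ball) (auto simp: norm_zero)
qed

section \<open>Tents on the patches\<close>

text \<open>Half the radius is used so that the tent is 0 off the closed set of
  \<open>closed_half\<close>; \<open>min 1\<close> bounds all heights by 1 whatever the radii, as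
  suprema over many tents are to be taken; division by \<open>kap\<close> prepays the loss in
  \<open>plip_if_locally\<close>, which leaves Lipschitz constant 1.\<close>

definition tent :: "'m \<Rightarrow> 'm \<Rightarrow> real" where
  "tent i x = (if x \<in> patch i then max 0 (min 1 (rad i / 2 - \<nu> i (crd i x - crd i i))) / kap else 0)"

lemma tent: "tent i x \<ge> 0" "tent i x \<le> 1" "tent i i > 0" "tent i x > 0 \<Longrightarrow> x \<in> patch i"
proof -
  show "tent i x \<ge> 0" "tent i x \<le> 1" using kap by (auto simp: tent_def divide_simps)
  show "tent i i > 0" using kap rad[of i] patch_self by (auto simp: tent_def norm_zero)
  show "tent i x > 0 \<Longrightarrow> x \<in> patch i" by (auto simp: tent_def split: if_splits)
qed

text \<open>At a point of the patch the estimate holds in the coordinates of the patch itself. At a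
  point outside, the complement of the closed half ball is a neighbourhood on which the tent
  vanishes; this is what \<open>closed_half\<close> is for.\<close>

lemma plip_tent: "plip 1 (tent i)"
proof -
  have "plip (kap * (1 / kap)) (tent i)"
  proof (rule plip_if_locally)
    show "0 \<le> 1 / kap" using kap by simp
    fix x
    show "\<exists>N j. open N \<and> x \<in> N \<and> x \<in> patch j \<and> (\<forall>y\<in>N \<inter> patch j. \<forall>z\<in>N \<inter> patch j.
        \<bar>tent i y - tent i z\<bar> \<le> 1 / kap * \<nu> j (crd j y - crd j z))"
    proof (cases "x \<in> patch i")
      case True
      have "\<bar>tent i y - tent i z\<bar> \<le> 1 / kap * \<nu> i (crd i y - crd i z)"
        if "y \<in> UNIV \<inter> patch i" "z \<in> UNIV \<inter> patch i" for y z
      proof -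
        have "\<nu> i (crd i y - crd i i) \<le> \<nu> i (crd i y - crd i z) + \<nu> i (crd i z - crd i i)"
          "\<nu> i (crd i z - crd i i) \<le> \<nu> i (crd i y - crd i z) + \<nu> i (crd i y - crd i i)"
          using norm_tri[of i "crd i y - crd i z" "crd i z - crd i i"]
            norm_tri[of i "crd i z - crd i y" "crd i y - crd i i"] norm_sym[of i "crd i y" "crd i z"] by simp_all
        then have "\<bar>max 0 (min 1 (rad i / 2 - \<nu> i (crd i y - crd i i))) -
            max 0 (min 1 (rad i / 2 - \<nu> i (crd i z - crd i i)))\<bar> \<le> \<nu> i (crd i y - crd i z)"
          by linarith
        then show ?thesis
          using that kap by (simp add: tent_def diff_divide_distrib[symmetric] divide_right_mono)
      qed
      then show ?thesis using True by (intro exI[of _ UNIV] exI[of _ i]) blast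
    next
      case False
      define S where "S = {x \<in> fst (ch i). \<nu> i (snd (ch i) x - snd (ch i) i) \<le> rad i / 2}"
      have "S \<subseteq> patch i" using rad[of i] by (auto simp: S_def patch_def crd_def)
      then have "x \<in> - S" "open (- S)" using False closed_half[of i] by (auto simp: S_def open_Compl)
      moreover have "tent i y = 0" if "y \<in> - S" for y
        using that patch_chart[of i] by (auto simp: tent_def S_def crd_def)
      ultimately show ?thesis
        using patch_self[of x] norm_nonneg kap by (intro exI[of _ "- S"] exI[of _ x]) auto
    qed
  qed
  then show ?thesis using kap by simp
qed

end

section \<open>Lipschitz constants, and extension from a subset\<close>

text \<open>Needed to turn the bounds on \<open>Lip\<close> in \<open>star_property\<close> into
  estimates for pairs of points. Where \<open>\<nu> (x - y)\<close> is positive, every admissible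
  constant is at least the difference quotient, hence so is the infimum.\<close>

lemma lipschitz_wrt_Lip:
  assumes \<nu>: "is_norm \<nu>" and h: "lipschitz_wrt \<nu> L h"
  shows "lipschitz_wrt \<nu> (Lip \<nu> h) h" and "Lip \<nu> h \<le> L"
proof -
  let ?S = "{L. lipschitz_wrt \<nu> L h}"
  have bd: "bdd_below ?S" by (rule bdd_belowI[of _ 0]) (auto simp: lipschitz_wrt_def)
  then show "Lip \<nu> h \<le> L" unfolding Lip_def using h by (intro cInf_lower) auto
  have "0 \<le> Lip \<nu> h"
    unfolding Lip_def using h by (intro cInf_greatest) (auto simp: lipschitz_wrt_def)
  moreover have "\<bar>h x - h y\<bar> \<le> Lip \<nu> h * \<nu> (x - y)" for x y
  proof (cases "\<nu> (x - y) = 0")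
    case True
    then show ?thesis using h by (auto simp: lipschitz_wrt_def dest: spec2[of _ x y])
  next
    case False
    then have pos: "\<nu> (x - y) > 0" using \<nu> by (simp add: is_norm_def order_less_le)
    have "\<bar>h x - h y\<bar> / \<nu> (x - y) \<le> Lip \<nu> h"
      unfolding Lip_def
    proof (rule cInf_greatest)
      fix M assume "M \<in> ?S"
      then have "\<bar>h x - h y\<bar> \<le> M * \<nu> (x - y)" by (simp add: lipschitz_wrt_def)
      then show "\<bar>h x - h y\<bar> / \<nu> (x - y) \<le> M" using pos by (simp add: pos_divide_le_eq)
    qed (use h in auto)
    then show ?thesis using pos by (simp add: pos_divide_le_eq)
  qed
  ultimately show "lipschitz_wrt \<nu> (Lip \<nu> h) h" by (simp add: lipschitz_wrt_def)
qed

text \<open>The extension is the infimum of the cones \<open>g y + L * \<nu> (x - y)\<close>. It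
  lets functions known on a ball be fed into \<open>star_property\<close>, which speaks of functions
  on the whole space.\<close>

lemma mcshane_extension:
  assumes \<nu>: "is_norm \<nu>" and L: "L \<ge> 0" and S: "S \<noteq> {}"
    and g: "\<And>y z. y \<in> S \<Longrightarrow> z \<in> S \<Longrightarrow> \<bar>g y - g z\<bar> \<le> L * \<nu> (y - z)"
  obtains h where "lipschitz_wrt \<nu> L h" "\<And>y. y \<in> S \<Longrightarrow> h y = g y"
proof -
  define h where "h x = (INF y\<in>S. g y + L * \<nu> (x - y))" for x
  have tri: "\<nu> (v + w) \<le> \<nu> v + \<nu> w" for v w using \<nu> by (simp add: is_norm_def)
  have minus: "\<nu> (v - w) = \<nu> (w - v)" for v w
  proof -
    have "\<nu> ((- 1) *\<^sub>R (w - v)) = \<bar>- 1\<bar> * \<nu> (w - v)"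
      using \<nu> unfolding is_norm_def by blast
    then show ?thesis by simp
  qed
  have zero: "\<nu> 0 = 0" using \<nu> by (simp add: is_norm_def)
  obtain y0 where y0: "y0 \<in> S" using S by blast
  have bd: "bdd_below ((\<lambda>y. g y + L * \<nu> (x - y)) ` S)" for x
  proof (rule bdd_belowI2)
    fix y assume y: "y \<in> S"
    have "\<nu> (y0 - y) \<le> \<nu> (x - y0) + \<nu> (x - y)"
      using tri[of "y0 - x" "x - y"] minus[of y0 x] by simp
    then have "L * \<nu> (y0 - y) \<le> L * \<nu> (x - y0) + L * \<nu> (x - y)"
      using L by (metis distrib_left mult_left_mono)
    then show "g y0 - L * \<nu> (x - y0) \<le> g y + L * \<nu> (x - y)"
      using g[OF y0 y] by linarith
  qed
  have le: "h x \<le> h z + L * \<nu> (x - z)" for x z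
  proof -
    have "h x - L * \<nu> (x - z) \<le> h z"
      unfolding h_def[of z]
    proof (rule cINF_greatest[OF S])
      fix y assume y: "y \<in> S"
      have "h x \<le> g y + L * \<nu> (x - y)"
        unfolding h_def by (rule cINF_lower[OF bd y])
      also have "L * \<nu> (x - y) \<le> L * (\<nu> (x - z) + \<nu> (z - y))"
        using tri[of "x - z" "z - y"] L by (intro mult_left_mono) auto
      finally show "h x - L * \<nu> (x - z) \<le> g y + L * \<nu> (z - y)" by (simp add: algebra_simps)
    qed
    then show ?thesis by simp
  qed
  have "lipschitz_wrt \<nu> L h"
    unfolding lipschitz_wrt_def
  proof (intro conjI L allI)
    show "\<bar>h x - h y\<bar> \<le> L * \<nu> (x - y)" for x y
      using le[of x y] le[of y x] minus[of x y] by simp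
  qed
  moreover have "h y = g y" if y: "y \<in> S" for y
  proof (rule antisym)
    show "h y \<le> g y"
      using cINF_lower[OF bd y, of y] by (simp add: h_def zero)
    show "g y \<le> h y"
      unfolding h_def
    proof (rule cINF_greatest[OF S])
      fix z assume "z \<in> S"
      from g[OF y this] show "g y \<le> g z + L * \<nu> (y - z)" by linarith
    qed
  qed
  ultimately show ?thesis by (rule that)
qed

section \<open>Smoothness at a point of the manifold\<close>

context C1_manifold
begin

text \<open>Gluing produces functions given by different formulas on different open sets; in this
  pointwise form only the formula near \<open>x\<close> matters. The neighbourhood may depend on the
  chart.\<close>

definition smooth_at :: "enat \<Rightarrow> ('m \<Rightarrow> real) \<Rightarrow> 'm \<Rightarrow> bool" where
  "smooth_at m b x \<longleftrightarrow> (\<forall>d\<in>A. x \<in> fst d \<longrightarrow>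
     (\<exists>V. open V \<and> snd d x \<in> V \<and> V \<subseteq> cimage d \<and> Ck_on m V (b \<circ> cinv d)))"

lemma smooth_funI: "(\<And>x. smooth_at m b x) \<Longrightarrow> smooth_fun m A b"
  unfolding smooth_fun_def
proof (intro ballI Ck_on_local)
  fix c y assume smooth_at: "\<And>x. smooth_at m b x" and c: "c \<in> A" and y: "y \<in> cimage c"
  show "\<exists>V. open V \<and> y \<in> V \<and> Ck_on m V (b \<circ> cinv c)"
    using smooth_at[of "cinv c y"] c y cinv_in[OF c y] chart_cinv[OF c y] unfolding smooth_at_def by metis
qed (rule chart_open)

lemma smooth_at_cong:
  assumes N: "open N" "x \<in> N" "\<And>y. y \<in> N \<Longrightarrow> b y = b' y" and b: "smooth_at m b x"
  shows "smooth_at m b' x"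
  unfolding smooth_at_def
proof (intro ballI impI)
  fix d assume d: "d \<in> A" "x \<in> fst d"
  then obtain V where V: "open V" "snd d x \<in> V" "V \<subseteq> cimage d" "Ck_on m V (b \<circ> cinv d)"
    using b unfolding smooth_at_def by blast
  let ?W = "V \<inter> snd d ` (N \<inter> fst d)"
  have W: "open ?W"
    using V(1) N(1) by (intro open_Int open_chart_image d chart_open) auto
  have "Ck_on m ?W (b' \<circ> cinv d)"
  proof (rule Ck_on_cong[OF W])
    show "Ck_on m ?W (b \<circ> cinv d)" by (rule Ck_on_subset[OF V(1) W _ V(4)]) simp
    fix y assume "y \<in> ?W"
    then show "(b \<circ> cinv d) y = (b' \<circ> cinv d) y"
      using N(3) cinv_chart[OF d(1)] by auto
  qed
  then show "\<exists>V. open V \<and> snd d x \<in> V \<and> V \<subseteq> cimage d \<and> Ck_on m V (b' \<circ> cinv d)"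
    using W V N(2) d(2) by (intro exI[of _ ?W]) auto
qed

lemma smooth_at_const: "smooth_at m (\<lambda>_. r) x"
  unfolding smooth_at_def
proof (intro ballI impI)
  fix d assume d: "d \<in> A" "x \<in> fst d"
  then show "\<exists>V. open V \<and> snd d x \<in> V \<and> V \<subseteq> cimage d \<and> Ck_on m V ((\<lambda>_. r) \<circ> cinv d)"
    using chart_open chart_in Ck_on_const[of "cimage d" m r]
    by (intro exI[of _ "cimage d"]) (simp add: comp_def)
qed

text \<open>The transition map contributes the order \<open>l\<close> and the function
  \<open>h\<close> the order \<open>k\<close>; this is where the minimum comes from.\<close>

lemma smooth_at_chart:
  assumes c: "c \<in> A" "x \<in> fst c" and h: "Ck_on k UNIV h"
  shows "smooth_at (min l k) (\<lambda>y. h (snd c y)) x"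
  unfolding smooth_at_def
proof (intro ballI impI)
  fix d assume d: "d \<in> A" "x \<in> fst d"
  let ?V = "snd d ` (fst d \<inter> fst c)"
  have V: "open ?V" by (rule transition_domain[OF d(1) c(1)])
  have "Ck_on (min l k) ?V (\<lambda>y. h (transition d c y))"
  proof (rule Ck_on_compose[OF V open_UNIV, where T="transition d c" and h=h])
    show "Ck_on (min l k) UNIV h" by (rule Ck_on_mono[OF h]) simp
    show "Ck_on (min l k) ?V (transition d c)" by (rule Ck_on_mono[OF transition_Ck[OF d(1) c(1)]]) simp
  qed simp
  then have "Ck_on (min l k) ?V ((\<lambda>y. h (snd c y)) \<circ> cinv d)"
    by (simp add: transition_def comp_def)
  then show "\<exists>V. open V \<and> snd d x \<in> V \<and> V \<subseteq> cimage d \<and>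
      Ck_on (min l k) V ((\<lambda>y. h (snd c y)) \<circ> cinv d)"
    using V c d by (intro exI[of _ ?V]) (auto simp: cimage_def)
qed

lemma smooth_at_compose:
  assumes h: "Ck_on m UNIV h" and b: "smooth_at m b x"
  shows "smooth_at m (\<lambda>y. h (b y)) x"
  unfolding smooth_at_def
proof (intro ballI impI)
  fix d assume "d \<in> A" "x \<in> fst d"
  then obtain V where V: "open V" "snd d x \<in> V" "V \<subseteq> cimage d" "Ck_on m V (b \<circ> cinv d)"
    using b unfolding smooth_at_def by blast
  have "Ck_on m V (\<lambda>y. h ((b \<circ> cinv d) y))"
    by (rule Ck_on_compose[OF V(1) open_UNIV _ h V(4)]) simp
  then show "\<exists>V. open V \<and> snd d x \<in> V \<and> V \<subseteq> cimage d \<and> Ck_on m V ((\<lambda>y. h (b y)) \<circ> cinv d)"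
    using V by (intro exI[of _ V]) (simp add: comp_def)
qed

lemma smooth_at_binary:
  assumes op: "\<And>V (f :: 'x \<Rightarrow> real) g. open V \<Longrightarrow> Ck_on m V f \<Longrightarrow> Ck_on m V g \<Longrightarrow> Ck_on m V (\<lambda>y. op (f y) (g y))"
    and a: "smooth_at m a x" and b: "smooth_at m b x"
  shows "smooth_at m (\<lambda>y. op (a y) (b y)) x"
  unfolding smooth_at_def
proof (intro ballI impI)
  fix d assume d: "d \<in> A" "x \<in> fst d"
  obtain V where V: "open V" "snd d x \<in> V" "V \<subseteq> cimage d" "Ck_on m V (a \<circ> cinv d)"
    using a d unfolding smooth_at_def by blast
  obtain W where W: "open W" "snd d x \<in> W" "W \<subseteq> cimage d" "Ck_on m W (b \<circ> cinv d)"
    using b d unfolding smooth_at_def by blast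
  have "Ck_on m (V \<inter> W) (\<lambda>y. op ((a \<circ> cinv d) y) ((b \<circ> cinv d) y))"
    using V W by (intro op Ck_on_subset[OF V(1) _ _ V(4)] Ck_on_subset[OF W(1) _ _ W(4)]) auto
  then show "\<exists>V. open V \<and> snd d x \<in> V \<and> V \<subseteq> cimage d \<and> Ck_on m V ((\<lambda>y. op (a y) (b y)) \<circ> cinv d)"
    using V W by (intro exI[of _ "V \<inter> W"]) (auto simp: comp_def)
qed

lemma smooth_at_add: "smooth_at m a x \<Longrightarrow> smooth_at m b x \<Longrightarrow> smooth_at m (\<lambda>y. a y + b y) x"
  by (rule smooth_at_binary) (rule Ck_on_add)

lemma smooth_at_mult: "smooth_at m a x \<Longrightarrow> smooth_at m b x \<Longrightarrow> smooth_at m (\<lambda>y. a y * b y) x"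
  by (rule smooth_at_binary) (rule Ck_on_mult)

lemma smooth_at_sum: "(\<And>i. i \<in> I \<Longrightarrow> smooth_at m (a i) x) \<Longrightarrow> smooth_at m (\<lambda>y. \<Sum>i\<in>I. a i y) x"
  by (induction I rule: infinite_finite_induct) (auto intro: smooth_at_const smooth_at_add)

lemma smooth_at_prod: "(\<And>i. i \<in> I \<Longrightarrow> smooth_at m (a i) x) \<Longrightarrow> smooth_at m (\<lambda>y. \<Prod>i\<in>I. a i y) x"
  by (induction I rule: infinite_finite_induct) (auto intro: smooth_at_const smooth_at_mult)

end

section \<open>Approximation in a patch, and the layers of the cover\<close>

context patches
begin

lemma norm_is_norm: "is_norm (\<nu> i)"
  using eqn[of i] by (simp add: equivalent_norm_def)

text \<open>In coordinates \<open>g\<close> lives on a ball only, so it is extended to the model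
  space with the same constant before \<open>star_property\<close> applies. The smooth
  \<open>h\<close> is close to \<open>g\<close> on the patch and Lipschitz everywhere.\<close>

lemma patch_approx:
  assumes g: "plip L g" and L: "L \<ge> 0" and \<eta>: "\<eta> > 0"
  obtains h where "Ck_on k UNIV h" "\<And>y. y \<in> patch i \<Longrightarrow> \<bar>g y - h (crd i y)\<bar> < \<eta>"
    "\<And>x y. \<bar>h x - h y\<bar> \<le> C0 * L * \<nu> i (x - y)"
proof -
  define g' where "g' z = g (cinv (ch i) z)" for z
  have g': "g' (crd i y) = g y" if "y \<in> patch i" for y
    using that patch_chart[of i] cinv_crd by (auto simp: g'_def)
  obtain e where e: "lipschitz_wrt (\<nu> i) L e" "\<And>z. z \<in> crd i ` patch i \<Longrightarrow> e z = g' z"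
  proof (rule mcshane_extension[OF norm_is_norm L])
    show "crd i ` patch i \<noteq> {}" using patch_self by auto
    show "\<bar>g' y - g' z\<bar> \<le> L * \<nu> i (y - z)" if "y \<in> crd i ` patch i" "z \<in> crd i ` patch i" for y z
      using that g by (auto simp: g' plip_def)
  qed blast
  obtain h where h: "\<exists>L. lipschitz_wrt (\<nu> i) L h" "Ck_on k UNIV h" "\<And>x. \<bar>e x - h x\<bar> < \<eta>"
    "Lip (\<nu> i) h \<le> C0 * Lip (\<nu> i) e"
    using star[of i] e(1) \<eta> unfolding star_property_def by blast
  have "\<bar>h x - h y\<bar> \<le> C0 * L * \<nu> i (x - y)" for x y
  proof -
    have "\<bar>h x - h y\<bar> \<le> Lip (\<nu> i) h * \<nu> i (x - y)"
      using lipschitz_wrt_Lip(1)[OF norm_is_norm] h(1) unfolding lipschitz_wrt_def by blast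
    also have "\<dots> \<le> C0 * L * \<nu> i (x - y)"
      using h(4) lipschitz_wrt_Lip(2)[OF norm_is_norm e(1)] C0 norm_nonneg
      by (intro mult_right_mono) (auto intro: order_trans mult_left_mono)
    finally show ?thesis .
  qed
  moreover have "\<bar>g y - h (crd i y)\<bar> < \<eta>" if "y \<in> patch i" for y
    using h(3)[of "crd i y"] e(2)[of "crd i y"] g'[OF that] that by simp
  ultimately show ?thesis using h(2) by (intro that)
qed

text \<open>
  For a well-order \<open>R\<close> of the index set, \<open>below R i\<close> is the supremum of the tents with smaller index,
  so that for fixed \<open>n\<close> the sets where \<open>level R i n\<close> is positive are disjoint: on two of
  them, the tent of the smaller index would both exceed and fall below \<open>2/2\<^sup>n\<close>.
\<close>

definition below :: "('m \<times> 'm) set \<Rightarrow> 'm \<Rightarrow> 'm \<Rightarrow> real" where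
  "below R i x = (SUP j\<in>{j. j = i \<or> (j, i) \<in> R}. if j = i then 0 else tent j x)"

definition level :: "('m \<times> 'm) set \<Rightarrow> 'm \<Rightarrow> nat \<Rightarrow> 'm \<Rightarrow> real" where
  "level R i n x = min (tent i x - 2 * (1/2) ^ n) (2 * (1/2) ^ n - below R i x)"

lemma plip_level: "plip 1 (level R i n)"
proof -
  \<comment> \<open>The index \<open>i\<close> itself enters the supremum with value 0, which keeps
    the index set nonempty even for the least \<open>i\<close>; the bound 1 on the tents keeps the
    supremum finite.\<close>
  have "plip 1 (below R i)"
    unfolding below_def using tent(2) plip_tent
    by (intro plip_Sup[where B=1]) (auto simp: plip_def norm_nonneg)
  from plip_affine[OF this, where a="-1" and b="2 * (1/2) ^ n"]
  have "plip 1 (\<lambda>x. 2 * (1/2) ^ n - below R i x)" by simp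
  moreover from plip_affine[OF plip_tent, where a=1 and b="- (2 * (1/2) ^ n)" and i1=i]
  have "plip 1 (\<lambda>x. tent i x - 2 * (1/2) ^ n)" by simp
  ultimately show ?thesis unfolding level_def by (intro plip_min)
qed

lemma level_pos_patch: "level R i n x > 0 \<Longrightarrow> x \<in> patch i"
proof (rule tent(4))
  assume "level R i n x > 0"
  then have "tent i x - 2 * (1/2) ^ n > 0" by (simp add: level_def)
  moreover have "2 * (1/2) ^ n > (0::real)" by simp
  ultimately show "tent i x > 0" by linarith
qed

lemma tent_le_below:
  assumes "(j, i) \<in> R" "j \<noteq> i"
  shows "tent j x \<le> below R i x"
proof -
  have "(if j = i then 0 else tent j x) \<le> below R i x"
    unfolding below_def
  proof (rule cSUP_upper)
    show "bdd_above ((\<lambda>j. if j = i then 0 else tent j x) ` {j. j = i \<or> (j, i) \<in> R})"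
      using tent(2) by (intro bdd_aboveI2[of _ _ 1]) simp
  qed (use assms in simp)
  then show ?thesis using assms by simp
qed

lemma level_disjoint:
  assumes "level R i n x > 0" "level R j n x > 0" and total: "\<And>i j. i \<noteq> j \<Longrightarrow> (i, j) \<in> R \<or> (j, i) \<in> R"
  shows "i = j"
proof (rule ccontr)
  assume "i \<noteq> j"
  then consider "(i, j) \<in> R" | "(j, i) \<in> R" using total by blast
  then show False
    using tent_le_below[of i j R x] tent_le_below[of j i R x] assms \<open>i \<noteq> j\<close>
    by cases (auto simp: level_def)
qed

text \<open>Take a minimal index whose tent is positive at \<open>x\<close>. Then
  \<open>below\<close> is 0 there, and once \<open>3 * (1/2) ^ n\<close> is smaller than the tent,
  both arguments of the minimum exceed \<open>(1/2) ^ n\<close>; the factors 2 in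
  \<open>level\<close> leave this margin.\<close>

lemma level_cover:
  assumes "wf R"
  obtains i n where "level R i n x > (1/2) ^ n"
proof -
  obtain i where i: "tent i x > 0" "\<And>j. (j, i) \<in> R \<Longrightarrow> \<not> tent j x > 0"
    using wfE_min[OF assms, of x "{i. tent i x > 0}"] tent(3)[of x] by auto
  have "below R i x = (SUP j\<in>{j. j = i \<or> (j, i) \<in> R}. 0)"
    unfolding below_def using i(2) tent(1) by (intro SUP_cong refl) (auto simp: not_less intro: antisym)
  also have "\<dots> = 0" by (rule cSUP_const) auto
  finally have b: "below R i x = 0" .
  obtain n where "(1/2) ^ n < tent i x / 3"
    using i(1) real_arch_pow_inv[of "tent i x / 3" "1/2"] by auto
  then have "level R i n x > (1/2) ^ n" unfolding level_def b by simp
  then show ?thesis by (rule that)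
qed

end

section \<open>The partition of unity\<close>

text \<open>All choices are fixed before a function to be approximated is given: \<open>R\<close> is
  a strict well-order, and \<open>U i n\<close> is a smooth version of \<open>level R i n\<close> in
  the coordinates of the patch \<open>i\<close>, with an error that is a fixed fraction of the scale
  \<open>(1/2) ^ n\<close> of the layer.\<close>

locale partition = patches A l F k K C0 ch \<nu> rad
  for A :: "('m::t2_space, 'x::banach) chart set" and l F k K C0 ch \<nu> rad +
  fixes R :: "('m \<times> 'm) set" and \<sigma> :: "real \<Rightarrow> real" and Ls :: real and U :: "'m \<Rightarrow> nat \<Rightarrow> 'x \<Rightarrow> real"
  assumes wf: "wf R" and total: "\<And>i j. i \<noteq> j \<Longrightarrow> (i, j) \<in> R \<or> (j, i) \<in> R"
    and \<sigma>_Ck: "\<And>m. Ck_on m UNIV \<sigma>" and \<sigma>_0: "\<And>t. t \<le> 0 \<Longrightarrow> \<sigma> t = 0" and \<sigma>_1: "\<And>t. t \<ge> 1 \<Longrightarrow> \<sigma> t = 1"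
    and \<sigma>_ge: "\<And>t. 0 \<le> \<sigma> t" and \<sigma>_le: "\<And>t. \<sigma> t \<le> 1"
    and Ls: "Ls \<ge> 1" and \<sigma>_lip: "\<And>s t. \<bar>\<sigma> s - \<sigma> t\<bar> \<le> Ls * \<bar>s - t\<bar>"
    and U_Ck: "\<And>i n. Ck_on k UNIV (U i n)"
    and U_approx: "\<And>i n y. y \<in> patch i \<Longrightarrow> \<bar>level R i n y - U i n (crd i y)\<bar> < (1/2) ^ n / 8"
    and U_lip: "\<And>i n x y. \<bar>U i n x - U i n y\<bar> \<le> C0 * \<nu> i (x - y)"
begin

text \<open>With \<open>e = (1/2) ^ n\<close>, the step rises while \<open>U i n\<close> goes from
  \<open>e / 2\<close> to \<open>7 * e / 8\<close>. Since \<open>U i n\<close> is within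
  \<open>e / 8\<close> of the level, a level at most \<open>e / 4\<close> gives 0 and a level above
  \<open>e\<close> gives 1; \<open>scl n\<close> rescales the gap \<open>3 * e / 8\<close> to
  1.\<close>

definition scl :: "nat \<Rightarrow> real" where "scl n = 8 / (3 * (1/2) ^ n)"
definition "bump i n z = \<sigma> ((U i n z - (1/2) ^ n / 2) * scl n)"
text \<open>At most one index has positive level at \<open>x\<close>; where there is none the value
  is unspecified, and \<open>\<phi>\<close> is set to 0.\<close>

definition "idx n x = (THE i. level R i n x > 0)"
definition "\<phi> n x = (if \<exists>i. level R i n x > 0 then bump (idx n x) n (crd (idx n x) x) else 0)"
definition "phi_lip n = kap * (Ls * scl n * C0)"

lemma scl: "scl n > 0" "3 * (1/2) ^ n / 8 * scl n = 1"
  by (simp_all add: scl_def)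

lemma idx: "level R i n x > 0 \<Longrightarrow> idx n x = i"
  unfolding idx_def using level_disjoint total by blast

lemma phi_range: "0 \<le> \<phi> n x \<and> \<phi> n x \<le> 1"
  by (auto simp: \<phi>_def bump_def \<sigma>_ge \<sigma>_le)

lemma phi_eq: "level R i n x > 0 \<Longrightarrow> \<phi> n x = bump i n (crd i x)"
  unfolding \<phi>_def by (auto simp: idx)

lemma phi_eq_0:
  assumes "\<And>i. level R i n x \<le> (1/2) ^ n / 4"
  shows "\<phi> n x = 0"
proof (cases "\<exists>i. level R i n x > 0")
  case True
  then obtain i where i: "level R i n x > 0" by blast
  have "U i n (crd i x) \<le> (1/2) ^ n / 2"
    using U_approx[OF level_pos_patch[OF i], of n] assms[of i] zero_less_power[of "1/2::real" n] by linarith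
  then have "(U i n (crd i x) - (1/2) ^ n / 2) * scl n \<le> 0"
    using scl(1)[of n] by (intro mult_nonpos_nonneg) auto
  then show ?thesis by (simp add: phi_eq[OF i] bump_def \<sigma>_0)
qed (simp add: \<phi>_def)

lemma phi_eq_1:
  assumes i: "level R i n x > (1/2) ^ n"
  shows "\<phi> n x = 1"
proof -
  have e: "(1/2::real) ^ n > 0" by simp
  have pos: "level R i n x > 0" using i e by linarith
  have "U i n (crd i x) - (1/2) ^ n / 2 \<ge> 3 * (1/2) ^ n / 8"
    using U_approx[OF level_pos_patch[OF pos], of n] i by linarith
  from mult_right_mono[OF this less_imp_le[OF scl(1)[of n]]]
  have "(U i n (crd i x) - (1/2) ^ n / 2) * scl n \<ge> 1" unfolding scl(2) .
  then show ?thesis by (simp add: phi_eq[OF pos] bump_def \<sigma>_1)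
qed

text \<open>One neighbourhood serves all indices \<open>i\<close>, since all levels have Lipschitz
  constant 1 in the patch of \<open>x\<close>. This makes the supports in one layer locally discrete
  and not merely disjoint.\<close>

lemma level_nhd:
  obtains N where "open N" "x \<in> N" "N \<subseteq> patch x" "\<And>i y. y \<in> N \<Longrightarrow> \<bar>level R i n y - level R i n x\<bar> < (1/2) ^ n / 8"
proof
  let ?N = "{y \<in> patch x. \<nu> x (crd x y - crd x x) < (1/2) ^ n / 8}"
  show "open ?N" by (rule open_sub_ball)
  show "x \<in> ?N" using patch_self by (simp add: norm_zero)
  show "\<bar>level R i n y - level R i n x\<bar> < (1/2) ^ n / 8" if "y \<in> ?N" for i y
  proof -
    have "\<bar>level R i n y - level R i n x\<bar> \<le> 1 * \<nu> x (crd x y - crd x x)"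
      using plip_level[of R i n] that patch_self unfolding plip_def by blast
    then show ?thesis using that by simp
  qed
qed auto

text \<open>If some level at \<open>x\<close> exceeds \<open>(1/2) ^ n / 8\<close>, it stays
  positive on the neighbourhood and fixes the index. Otherwise all levels stay at most
  \<open>(1/2) ^ n / 4\<close> there, which \<open>phi_eq_0\<close> turns into 0.\<close>

lemma phi_local:
  obtains N where "open N" "x \<in> N" "N \<subseteq> patch x" "\<And>y. y \<in> N \<Longrightarrow> \<phi> n y = 0"
  | N i where "open N" "x \<in> N" "N \<subseteq> patch x" "N \<subseteq> patch i" "\<And>y. y \<in> N \<Longrightarrow> idx n y = i"
      "\<And>y. y \<in> N \<Longrightarrow> \<phi> n y = bump i n (crd i y)"
proof -
  obtain N where N: "open N" "x \<in> N" "N \<subseteq> patch x"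
    "\<And>i y. y \<in> N \<Longrightarrow> \<bar>level R i n y - level R i n x\<bar> < (1/2) ^ n / 8"
    by (rule level_nhd[of x n]) blast
  show ?thesis
  proof (cases "\<exists>i. level R i n x > (1/2) ^ n / 8")
    case True
    then obtain i where i: "level R i n x > (1/2) ^ n / 8" by blast
    have "level R i n y > 0" if "y \<in> N" for y using N(4)[OF that, of i] i by linarith
    moreover then have "N \<subseteq> patch i" using level_pos_patch by blast
    ultimately show ?thesis using N idx phi_eq by (intro that(2)[of N i]) auto
  next
    case False
    have "\<phi> n y = 0" if "y \<in> N" for y
    proof (rule phi_eq_0)
      show "level R i n y \<le> (1/2) ^ n / 4" for i
      proof -
        have "level R i n x \<le> (1/2) ^ n / 8" using False by (simp add: not_less)
        then show ?thesis using N(4)[OF that, of i] by linarith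
      qed
    qed
    then show ?thesis using N by (intro that(1)[of N]) auto
  qed
qed

lemma phi_lip_nonneg: "phi_lip n \<ge> 0"
  using kap Ls C0 scl(1)[of n] by (simp add: phi_lip_def)

lemma plip_phi: "plip (phi_lip n) (\<phi> n)"
  unfolding phi_lip_def
proof (rule plip_if_locally)
  let ?q = "scl n"
  have q: "?q \<ge> 0" using scl(1)[of n] by simp
  show L: "0 \<le> Ls * ?q * C0" using Ls C0 q by simp
  fix x
  show "\<exists>N j. open N \<and> x \<in> N \<and> x \<in> patch j \<and> (\<forall>y\<in>N \<inter> patch j. \<forall>z\<in>N \<inter> patch j.
      \<bar>\<phi> n y - \<phi> n z\<bar> \<le> Ls * ?q * C0 * \<nu> j (crd j y - crd j z))"
  proof (rule phi_local[of x n])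
    fix N assume N: "open N" "x \<in> N" "N \<subseteq> patch x" "\<And>y. y \<in> N \<Longrightarrow> \<phi> n y = 0"
    have "\<bar>\<phi> n y - \<phi> n z\<bar> \<le> Ls * ?q * C0 * \<nu> x (crd x y - crd x z)" if "y \<in> N" "z \<in> N" for y z
      using mult_nonneg_nonneg[OF L norm_nonneg] by (simp only: N(4)[OF that(1)] N(4)[OF that(2)]) simp
    then show ?thesis using N patch_self by (intro exI[of _ N] exI[of _ x]) blast
  next
    fix N i assume N: "open N" "x \<in> N" "N \<subseteq> patch x" "N \<subseteq> patch i"
      "\<And>y. y \<in> N \<Longrightarrow> \<phi> n y = bump i n (crd i y)"
    have "\<bar>bump i n y - bump i n z\<bar> \<le> Ls * ?q * C0 * \<nu> i (y - z)" for y z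
    proof -
      have "\<bar>bump i n y - bump i n z\<bar> \<le> Ls * \<bar>(U i n y - (1/2) ^ n / 2) * ?q - (U i n z - (1/2) ^ n / 2) * ?q\<bar>"
        unfolding bump_def by (rule \<sigma>_lip)
      also have "\<dots> = Ls * ?q * \<bar>U i n y - U i n z\<bar>"
        using q by (simp add: left_diff_distrib[symmetric] abs_mult)
      also have "\<dots> \<le> Ls * ?q * (C0 * \<nu> i (y - z))"
        using Ls q by (intro mult_left_mono U_lip) auto
      finally show ?thesis by (simp add: mult.assoc)
    qed
    then have "\<bar>\<phi> n y - \<phi> n z\<bar> \<le> Ls * ?q * C0 * \<nu> i (crd i y - crd i z)" if "y \<in> N" "z \<in> N" for y z
      using that N(5) by simp
    then show ?thesis using N by (intro exI[of _ N] exI[of _ i]) blast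
  qed
qed

text \<open>The factor \<open>H (idx n y)\<close> jumps with the index, but \<open>\<phi> n\<close>
  vanishes near every point at which the index is not locally constant.\<close>

lemma smooth_at_phi_mult:
  assumes "\<And>i. Ck_on k UNIV (H i)"
  shows "smooth_at (min l k) (\<lambda>y. \<phi> n y * H (idx n y) (crd (idx n y) y)) x"
proof (rule phi_local[of x n])
  fix N assume N: "open N" "x \<in> N" "\<And>y. y \<in> N \<Longrightarrow> \<phi> n y = 0"
  show ?thesis by (rule smooth_at_cong[OF N(1,2) _ smooth_at_const[of _ 0]]) (simp add: N(3))
next
  fix N i assume N: "open N" "x \<in> N" "N \<subseteq> patch i" "\<And>y. y \<in> N \<Longrightarrow> idx n y = i"
    "\<And>y. y \<in> N \<Longrightarrow> \<phi> n y = bump i n (crd i y)"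
  have x: "x \<in> fst (ch i)" using N patch_chart by blast
  have U: "smooth_at (min l k) (\<lambda>y. U i n (crd i y)) x"
    unfolding crd_def by (rule smooth_at_chart[OF ch(1) x U_Ck])
  have "Ck_on (min l k) UNIV (\<lambda>t. \<sigma> (scl n * t + (- ((1/2) ^ n / 2 * scl n))))"
    by (rule Ck_on_compose[OF open_UNIV open_UNIV _ \<sigma>_Ck Ck_on_affine]) simp
  from smooth_at_compose[OF this U]
  have "smooth_at (min l k) (\<lambda>y. bump i n (crd i y)) x"
    by (simp add: bump_def algebra_simps)
  moreover have "smooth_at (min l k) (\<lambda>y. H i (crd i y)) x"
    unfolding crd_def by (rule smooth_at_chart[OF ch(1) x assms])
  ultimately have "smooth_at (min l k) (\<lambda>y. bump i n (crd i y) * H i (crd i y)) x" by (rule smooth_at_mult)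
  then show ?thesis by (rule smooth_at_cong[OF N(1,2), rotated]) (simp add: N)
qed

lemma smooth_at_phi: "smooth_at (min l k) (\<phi> n) x"
  using smooth_at_phi_mult[of "\<lambda>_ _. 1" n x] Ck_on_const[of UNIV k "1::real"] by simp

text \<open>The usual passage from a cover to a partition of unity: \<open>1 - P n\<close> is the
  sum of the weights \<open>P j * \<phi> j\<close> for \<open>j < n\<close>, by telescoping.\<close>

definition "P n x = (\<Prod>j<n. 1 - \<phi> j x)"

lemma P_range: "0 \<le> P n x \<and> P n x \<le> 1"
  unfolding P_def using phi_range by (auto intro!: prod_nonneg prod_le_1)

lemma P_Suc: "P (Suc n) x = P n x - P n x * \<phi> n x"
  by (simp add: P_def algebra_simps)

lemma P_mono_0: "P n x = 0 \<Longrightarrow> n \<le> m \<Longrightarrow> P m x = 0"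
  unfolding P_def by (auto simp: prod_zero_iff)

lemma plip_P: "plip (\<Sum>j<n. phi_lip j) (P n)"
proof (induction n)
  case 0
  then show ?case by (simp add: plip_def P_def)
next
  case (Suc n)
  have "plip (phi_lip n) (\<lambda>x. 1 - \<phi> n x)"
    using plip_affine[OF plip_phi, of "-1" n 1] by simp
  from plip_mult_unit[OF Suc.IH this] P_range phi_range
  show ?case by (simp add: P_def)
qed

lemma smooth_at_P: "smooth_at (min l k) (P n) x"
proof -
  have "smooth_at (min l k) (\<lambda>y. 1 - \<phi> j y) x" for j
    using smooth_at_add[OF smooth_at_const[of _ 1] smooth_at_mult[OF smooth_at_const[of _ "-1"] smooth_at_phi[of j x]]] by simp
  then show ?thesis unfolding P_def by (intro smooth_at_prod)
qed

text \<open>Some level exceeds its threshold at \<open>x\<close>, hence on a neighbourhood, where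
  the factor \<open>1 - \<phi> n\<close> is 0. All later products vanish there too, so every sum
  over the layers is finite near \<open>x\<close>.\<close>

lemma P_vanishes:
  obtains n N where "open N" "x \<in> N" "\<And>y. y \<in> N \<Longrightarrow> P n y = 0"
proof -
  obtain i n where i: "level R i n x > (1/2) ^ n" by (rule level_cover[OF wf])
  obtain N where N: "open N" "x \<in> N" "\<And>y. y \<in> N \<Longrightarrow> \<bar>level R i n y - level R i n x\<bar> < level R i n x - (1/2) ^ n"
    by (rule plip_nhd[OF plip_level, of "level R i n x - (1/2) ^ n" x R i n]) (use i in auto)
  have "P (Suc n) y = 0" if "y \<in> N" for y
    using phi_eq_1[of n i y] N(3)[OF that] by (simp add: P_Suc)
  then show ?thesis using N by (intro that[of N "Suc n"]) auto
qed

end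

lemma sum_half_powers_le: "(\<Sum>j<n. (1/2::real) ^ Suc j) \<le> 1"
proof -
  have "(\<Sum>j<n. (1/2::real) ^ Suc j) = 1 - (1/2) ^ n"
    by (induction n) auto
  then show ?thesis by simp
qed

section \<open>Gluing smooth approximations\<close>

context partition
begin

text \<open>Let \<open>g\<close> be the sum of the weights \<open>\<psi> n\<close> times the
  approximations \<open>gg n\<close>. Then \<open>g y - g z\<close> consists of the terms
  \<open>\<psi> n y * (gg n y - gg n z)\<close>, together at most \<open>kap * (C0 * L)\<close>
  times the distance because the weights sum to 1, and of the terms
  \<open>(\<psi> n y - \<psi> n z) * (gg n z - f z)\<close>, in which the error \<open>e n\<close>
  outweighs the Lipschitz constant \<open>\<Lambda> n\<close> of the weight. The latter contribute
  the summand 1, whatever \<open>\<eta>\<close> is. A local estimate in the patch of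
  \<open>x\<close> suffices for the differential at \<open>x\<close> and avoids another factor
  \<open>kap\<close>.\<close>

lemma plip_smooth_approx:
  assumes f: "plip L f" and L: "L \<ge> 0" and \<eta>: "\<eta> > 0"
  obtains g where "smooth_fun (min l k) A g" "\<And>x. \<bar>f x - g x\<bar> \<le> \<eta>"
    "\<And>x. \<exists>N. open N \<and> x \<in> N \<and> N \<subseteq> patch x \<and>
      (\<forall>y\<in>N. \<forall>z\<in>N. \<bar>g y - g z\<bar> \<le> (kap * (C0 * L) + 1) * \<nu> x (crd x y - crd x z))"
proof -
  \<comment> \<open>A Lipschitz constant for the weight \<open>P n * \<phi> n\<close>: the constants
    of the first \<open>n\<close> factors and of \<open>\<phi> n\<close> add up.\<close>
  define \<Lambda> where "\<Lambda> n = (\<Sum>j<Suc n. phi_lip j)" for n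
  have \<Lambda>: "\<Lambda> n \<ge> 0" for n unfolding \<Lambda>_def by (intro sum_nonneg phi_lip_nonneg)
  \<comment> \<open>In the minimum, \<open>\<eta>\<close> is for the total error and 1 for the sum
    of \<open>e n * \<Lambda> n\<close>; the powers of 1/2 keep both sums bounded. The summand 1 in
    the denominator covers \<open>\<Lambda> n = 0\<close>.\<close>
  define e where "e n = min \<eta> 1 * (1/2) ^ Suc n / (1 + \<Lambda> n)" for n
  have e: "e n > 0" for n using \<eta> \<Lambda>[of n] by (simp add: e_def)
  have e1: "e n \<le> min \<eta> 1 * (1/2) ^ Suc n" for n
    using \<eta> \<Lambda>[of n] unfolding e_def by (subst pos_divide_le_eq) (auto simp: algebra_simps)
  have e2: "e n * \<Lambda> n \<le> (1/2) ^ Suc n" for n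
  proof -
    have "e n * \<Lambda> n \<le> e n * (1 + \<Lambda> n)" using e[of n] by (intro mult_left_mono) auto
    also have "\<dots> = min \<eta> 1 * (1/2) ^ Suc n"
    proof -
      have "1 + \<Lambda> n \<noteq> 0" using \<Lambda>[of n] by linarith
      then show ?thesis
        by (simp only: e_def times_divide_eq_left nonzero_mult_div_cancel_right not_False_eq_True)
    qed
    also have "\<dots> \<le> 1 * (1/2) ^ Suc n" by (intro mult_right_mono) auto
    finally show ?thesis by simp
  qed
  have sum_e: "(\<Sum>j<n. e j) \<le> \<eta>" for n
  proof -
    have "(\<Sum>j<n. e j) \<le> (\<Sum>j<n. min \<eta> 1 * (1/2) ^ Suc j)" by (intro sum_mono e1)
    also have "\<dots> = min \<eta> 1 * (\<Sum>j<n. (1/2) ^ Suc j)" by (simp only: sum_distrib_left)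
    also have "\<dots> \<le> \<eta> * 1" using \<eta> by (intro mult_mono sum_half_powers_le sum_nonneg) auto
    finally show ?thesis by simp
  qed
  have sum_e\<Lambda>: "(\<Sum>j<n. e j * \<Lambda> j) \<le> 1" for n
    using sum_mono[of "{..<n}", OF e2] sum_half_powers_le[of n] by (rule order_trans)
  have "\<exists>h. Ck_on k UNIV h \<and> (\<forall>y\<in>patch i. \<bar>f y - h (crd i y)\<bar> < e n) \<and>
      (\<forall>x y. \<bar>h x - h y\<bar> \<le> C0 * L * \<nu> i (x - y))" for i n
    by (rule patch_approx[OF f L e[of n], of i]) blast
  then obtain H where H_Ck: "\<And>i n. Ck_on k UNIV (H i n)"
    and H_approx: "\<And>i n y. y \<in> patch i \<Longrightarrow> \<bar>f y - H i n (crd i y)\<bar> < e n"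
    and H_lip: "\<And>i n x y. \<bar>H i n x - H i n y\<bar> \<le> C0 * L * \<nu> i (x - y)"
    by metis
  define gg where "gg n y = H (idx n y) n (crd (idx n y) y)" for n y
  define \<psi> where "\<psi> n y = P n y * \<phi> n y" for n y
  define G where "G n y = (\<Sum>j<n. \<psi> j y * gg j y)" for n y
  define L1 where "L1 = kap * (C0 * L)"
  have L1: "L1 \<ge> 0" using kap C0 L by (simp add: L1_def)
  have \<psi>_range: "0 \<le> \<psi> n y" "\<psi> n y \<le> 1" for n y
    using P_range[of n y] phi_range[of n y] by (auto simp: \<psi>_def mult_le_one)
  have P_Suc': "P (Suc n) y = P n y - \<psi> n y" for n y by (simp add: P_Suc \<psi>_def)
  have plip\<psi>: "plip (\<Lambda> n) (\<psi> n)" for n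
    using plip_mult_unit[OF plip_P plip_phi P_range phi_range, of n n] by (simp add: \<psi>_def[abs_def] \<Lambda>_def)
  have gg_approx: "\<bar>gg n y - f y\<bar> \<le> e n" if nz: "\<phi> n y \<noteq> 0" for n y
  proof -
    obtain i where i: "level R i n y > 0" using nz unfolding \<phi>_def by (auto split: if_splits)
    then show ?thesis
      using H_approx[OF level_pos_patch[OF i], of n] by (simp add: gg_def idx)
  qed
  \<comment> \<open>The weights used so far sum to \<open>1 - P n y\<close>, so the partial sum is
    compared with that portion of \<open>f\<close>.\<close>
  have G_close: "\<bar>G n y - (1 - P n y) * f y\<bar> \<le> (\<Sum>j<n. e j)" for n y
  proof (induction n)
    case 0
    then show ?case by (simp add: G_def P_def)
  next
    case (Suc n)
    have "\<bar>\<psi> n y * (gg n y - f y)\<bar> \<le> e n"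
    proof (cases "\<phi> n y = 0")
      case False
      have "\<bar>\<psi> n y * (gg n y - f y)\<bar> \<le> 1 * e n"
        unfolding abs_mult using \<psi>_range gg_approx[OF False] by (intro mult_mono) auto
      then show ?thesis by simp
    qed (use e[of n] in \<open>simp add: \<psi>_def\<close>)
    moreover have "G (Suc n) y - (1 - P (Suc n) y) * f y = (G n y - (1 - P n y) * f y) + \<psi> n y * (gg n y - f y)"
      by (simp add: G_def P_Suc' algebra_simps)
    ultimately show ?case using Suc by simp
  qed
  have step: "\<exists>N. open N \<and> x \<in> N \<and> N \<subseteq> patch x \<and> (\<forall>y\<in>N. \<forall>z\<in>N.
      \<bar>\<psi> n y * gg n y - \<psi> n z * gg n z - (\<psi> n y - \<psi> n z) * f z\<bar>
        \<le> (\<psi> n y * L1 + e n * \<Lambda> n) * \<nu> x (crd x y - crd x z))" for n x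
  proof (rule phi_local[of x n])
    fix N assume N: "open N" "x \<in> N" "N \<subseteq> patch x" "\<And>y. y \<in> N \<Longrightarrow> \<phi> n y = 0"
    have "\<psi> n y = 0" if "y \<in> N" for y using N(4)[OF that] by (simp add: \<psi>_def)
    then show ?thesis
      using N e[of n] \<Lambda>[of n] norm_nonneg by (intro exI[of _ N]) (simp add: mult_nonneg_nonneg)
  next
    fix N i assume N: "open N" "x \<in> N" "N \<subseteq> patch x" "N \<subseteq> patch i"
      "\<And>y. y \<in> N \<Longrightarrow> idx n y = i" "\<And>y. y \<in> N \<Longrightarrow> \<phi> n y = bump i n (crd i y)"
    obtain N' where N': "open N'" "x \<in> N'" "N' \<subseteq> patch x \<inter> patch i"
      "\<And>y z. y \<in> N' \<Longrightarrow> z \<in> N' \<Longrightarrow> \<nu> i (crd i y - crd i z) \<le> kap * \<nu> x (crd x y - crd x z)"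
      using patch_change[of x x i] N patch_self by (metis subsetD)
    have "\<bar>\<psi> n y * gg n y - \<psi> n z * gg n z - (\<psi> n y - \<psi> n z) * f z\<bar>
        \<le> (\<psi> n y * L1 + e n * \<Lambda> n) * \<nu> x (crd x y - crd x z)" if y: "y \<in> N \<inter> N'" and z: "z \<in> N \<inter> N'" for y z
    proof -
      let ?n = "\<nu> x (crd x y - crd x z)"
      have gg: "gg n w = H i n (crd i w)" if "w \<in> N" for w using N(5)[OF that] by (simp add: gg_def)
      have "\<bar>gg n y - gg n z\<bar> \<le> C0 * L * \<nu> i (crd i y - crd i z)"
        using H_lip y z by (simp add: gg)
      also have "\<dots> \<le> C0 * L * (kap * ?n)"
        using C0 L N'(4) y z by (intro mult_left_mono) auto
      finally have 1: "\<bar>gg n y - gg n z\<bar> \<le> L1 * ?n" by (simp add: L1_def mult_ac)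
      have 2: "\<bar>gg n z - f z\<bar> \<le> e n"
        using H_approx[of z i n] z N(4) gg[of z] by auto
      have 3: "\<bar>\<psi> n y - \<psi> n z\<bar> \<le> \<Lambda> n * ?n"
        using plip\<psi>[of n] N(3) y z unfolding plip_def by blast
      \<comment> \<open>The subtracted multiple of \<open>f z\<close> turns the value
        \<open>gg n z\<close> into the error \<open>gg n z - f z\<close>.\<close>
      have "\<psi> n y * gg n y - \<psi> n z * gg n z - (\<psi> n y - \<psi> n z) * f z =
          \<psi> n y * (gg n y - gg n z) + (\<psi> n y - \<psi> n z) * (gg n z - f z)"
        by (simp add: algebra_simps)
      also have "\<bar>\<dots>\<bar> \<le> \<psi> n y * \<bar>gg n y - gg n z\<bar> + \<bar>\<psi> n y - \<psi> n z\<bar> * \<bar>gg n z - f z\<bar>"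
        using abs_triangle_ineq[of "\<psi> n y * (gg n y - gg n z)" "(\<psi> n y - \<psi> n z) * (gg n z - f z)"]
          \<psi>_range(1)[of n y] by (simp add: abs_mult)
      also have "\<dots> \<le> \<psi> n y * (L1 * ?n) + (\<Lambda> n * ?n) * e n"
        using 1 2 3 \<psi>_range(1)[of n y] \<Lambda>[of n] norm_nonneg[of x]
        by (intro add_mono mult_left_mono mult_mono) auto
      finally show ?thesis by (simp add: algebra_simps)
    qed
    then show ?thesis using N N' by (intro exI[of _ "N \<inter> N'"]) auto
  qed
  \<comment> \<open>Until the partition of unity is exhausted, \<open>P n\<close> is the remaining mass; filling it with \<open>f\<close> makes
    the differences of the weights cancel up to terms \<open>gg - f\<close>.\<close>
  have G_lip: "\<exists>N. open N \<and> x \<in> N \<and> N \<subseteq> patch x \<and> (\<forall>y\<in>N. \<forall>z\<in>N.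
      \<bar>G n y - G n z + (P n y - P n z) * f z\<bar>
        \<le> ((1 - P n y) * L1 + (\<Sum>j<n. e j * \<Lambda> j)) * \<nu> x (crd x y - crd x z))" for n x
  proof (induction n)
    case 0
    then show ?case
      using open_patch patch_self by (intro exI[of _ "patch x"]) (auto simp: G_def P_def)
  next
    case (Suc n)
    then obtain N where N: "open N" "x \<in> N" "N \<subseteq> patch x" "\<And>y z. y \<in> N \<Longrightarrow> z \<in> N \<Longrightarrow>
      \<bar>G n y - G n z + (P n y - P n z) * f z\<bar>
        \<le> ((1 - P n y) * L1 + (\<Sum>j<n. e j * \<Lambda> j)) * \<nu> x (crd x y - crd x z)" by blast
    obtain N' where N': "open N'" "x \<in> N'" "N' \<subseteq> patch x" "\<And>y z. y \<in> N' \<Longrightarrow> z \<in> N' \<Longrightarrow>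
      \<bar>\<psi> n y * gg n y - \<psi> n z * gg n z - (\<psi> n y - \<psi> n z) * f z\<bar>
        \<le> (\<psi> n y * L1 + e n * \<Lambda> n) * \<nu> x (crd x y - crd x z)"
      using step[of x n] by blast
    have "\<bar>G (Suc n) y - G (Suc n) z + (P (Suc n) y - P (Suc n) z) * f z\<bar>
        \<le> ((1 - P (Suc n) y) * L1 + (\<Sum>j<Suc n. e j * \<Lambda> j)) * \<nu> x (crd x y - crd x z)"
      if "y \<in> N \<inter> N'" "z \<in> N \<inter> N'" for y z
    proof -
      have "G (Suc n) y - G (Suc n) z + (P (Suc n) y - P (Suc n) z) * f z =
          (G n y - G n z + (P n y - P n z) * f z) +
          (\<psi> n y * gg n y - \<psi> n z * gg n z - (\<psi> n y - \<psi> n z) * f z)"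
        by (simp add: G_def P_Suc' algebra_simps)
      also have "\<bar>\<dots>\<bar> \<le> ((1 - P n y) * L1 + (\<Sum>j<n. e j * \<Lambda> j)) * \<nu> x (crd x y - crd x z) +
          (\<psi> n y * L1 + e n * \<Lambda> n) * \<nu> x (crd x y - crd x z)"
        using that by (intro order_trans[OF abs_triangle_ineq] add_mono N(4) N'(4)) auto
      also have "\<dots> = ((1 - P (Suc n) y) * L1 + (\<Sum>j<Suc n. e j * \<Lambda> j)) * \<nu> x (crd x y - crd x z)"
        by (simp add: P_Suc' algebra_simps)
      finally show ?thesis .
    qed
    then show ?case using N N' by (intro exI[of _ "N \<inter> N'"]) auto
  qed
  \<comment> \<open>Once \<open>P n\<close> vanishes at a point, the partial sums there no longer
    change; the least index is a convenient choice, and \<open>g_eq\<close> allows any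
    other.\<close>
  define g where "g y = G (LEAST m. P m y = 0) y" for y
  have g_eq: "g y = G n y" if "P n y = 0" for n y
  proof -
    define m where "m = (LEAST m. P m y = 0)"
    have m: "P m y = 0" "m \<le> n" using that unfolding m_def by (auto intro: LeastI Least_le)
    have "G j y = G m y" if "m \<le> j" for j
      using that
    proof (induction j rule: dec_induct)
      case (step j)
      then show ?case using P_mono_0[OF m(1), of j] by (simp add: G_def \<psi>_def)
    qed simp
    from this[OF m(2)] show ?thesis unfolding g_def m_def[symmetric] by (rule sym)
  qed
  have smooth_at_G: "smooth_at (min l k) (G n) x" for n x
  proof -
    have "smooth_at (min l k) (\<lambda>y. P j y * (\<phi> j y * H (idx j y) j (crd (idx j y) y))) x" for j
      by (intro smooth_at_mult smooth_at_P smooth_at_phi_mult H_Ck)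
    then show ?thesis
      unfolding G_def \<psi>_def gg_def by (intro smooth_at_sum) (simp add: mult.assoc)
  qed
  have "smooth_fun (min l k) A g"
  proof (rule smooth_funI)
    fix x
    obtain n N where N: "open N" "x \<in> N" "\<And>y. y \<in> N \<Longrightarrow> P n y = 0"
      by (rule P_vanishes[of x]) blast
    show "smooth_at (min l k) g x"
      by (rule smooth_at_cong[OF N(1,2) _ smooth_at_G[of n]]) (rule g_eq[OF N(3), symmetric])
  qed
  moreover have "\<bar>f x - g x\<bar> \<le> \<eta>" for x
  proof -
    obtain n N where N: "x \<in> N" "\<And>y. y \<in> N \<Longrightarrow> P n y = 0"
      by (rule P_vanishes[of x]) blast
    then show ?thesis
      using G_close[of n x] sum_e[of n] g_eq[of n x] by (simp add: abs_minus_commute)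
  qed
  moreover have "\<exists>N. open N \<and> x \<in> N \<and> N \<subseteq> patch x \<and>
      (\<forall>y\<in>N. \<forall>z\<in>N. \<bar>g y - g z\<bar> \<le> (kap * (C0 * L) + 1) * \<nu> x (crd x y - crd x z))" for x
  proof -
    obtain n N where N: "open N" "x \<in> N" "\<And>y. y \<in> N \<Longrightarrow> P n y = 0"
      by (rule P_vanishes[of x]) blast
    obtain N' where N': "open N'" "x \<in> N'" "N' \<subseteq> patch x" "\<And>y z. y \<in> N' \<Longrightarrow> z \<in> N' \<Longrightarrow>
      \<bar>G n y - G n z + (P n y - P n z) * f z\<bar>
        \<le> ((1 - P n y) * L1 + (\<Sum>j<n. e j * \<Lambda> j)) * \<nu> x (crd x y - crd x z)"
      using G_lip[of x n] by blast
    have "\<bar>g y - g z\<bar> \<le> (kap * (C0 * L) + 1) * \<nu> x (crd x y - crd x z)"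
      if "y \<in> N \<inter> N'" "z \<in> N \<inter> N'" for y z
    proof -
      have "\<bar>g y - g z\<bar> \<le> (L1 + (\<Sum>j<n. e j * \<Lambda> j)) * \<nu> x (crd x y - crd x z)"
        using N'(4)[of y z] that N(3) g_eq[OF N(3), of y] g_eq[OF N(3), of z] by simp
      also have "\<dots> \<le> (L1 + 1) * \<nu> x (crd x y - crd x z)"
        using sum_e\<Lambda>[of n] norm_nonneg by (intro mult_right_mono) auto
      finally show ?thesis by (simp add: L1_def)
    qed
    then show ?thesis using N N' by (intro exI[of _ "N \<inter> N'"]) auto
  qed
  ultimately show ?thesis by (rule that)
qed

end

section \<open>The Finsler distance\<close>

lemma C1_path_on_cong:
  assumes "C1_path_on A s t \<gamma>" "\<And>r. r \<in> {s..t} \<Longrightarrow> \<gamma>' r = \<gamma> r"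
  shows "C1_path_on A s t \<gamma>'"
proof -
  have eq: "{s..t} \<inter> \<gamma>' -` S = {s..t} \<inter> \<gamma> -` S" for S
    using assms(2) by auto
  have "((snd c \<circ> \<gamma>') has_vector_derivative u) (at r within {s..t})"
    if "((snd c \<circ> \<gamma>) has_vector_derivative u) (at r within {s..t})" "r \<in> {s..t}"
    for c :: "('a, 'b) chart" and u r
    by (rule has_vector_derivative_transform[OF that(2) _ that(1)]) (simp add: assms(2))
  moreover have "continuous_on {s..t} \<gamma>'"
    using assms continuous_on_cong[of "{s..t}" "{s..t}" \<gamma>' \<gamma>] by (simp add: C1_path_on_def)
  moreover have "\<exists>u. continuous_on ({s..t} \<inter> \<gamma> -` fst c) u \<and> (\<forall>r\<in>{s..t} \<inter> \<gamma> -` fst c.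
      ((snd c \<circ> \<gamma>) has_vector_derivative u r) (at r within {s..t}))" if "c \<in> A" for c
    using assms(1) that unfolding C1_path_on_def by blast
  ultimately show ?thesis
    unfolding C1_path_on_def eq by (meson IntD1)
qed

lemma has_vector_derivative_cong_open:
  assumes "open S" "t \<in> S" "\<And>r. r \<in> S \<Longrightarrow> f r = g r"
  shows "(f has_vector_derivative u) (at t) \<longleftrightarrow> (g has_vector_derivative u) (at t)"
proof
  show "(f has_vector_derivative u) (at t) \<Longrightarrow> (g has_vector_derivative u) (at t)"
    by (rule has_vector_derivative_transform_within_open[OF _ assms])
  show "(g has_vector_derivative u) (at t) \<Longrightarrow> (f has_vector_derivative u) (at t)"
    by (rule has_vector_derivative_transform_within_open[OF _ assms(1,2) assms(3)[symmetric]])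
qed

text \<open>On an open set of times the derivative within the interval is the two-sided one, so the
  velocity depends neither on the interval nor on the path outside that set.\<close>

lemma velocity_cong_open:
  assumes "open S" "t \<in> S" "S \<subseteq> {a..b}" "S \<subseteq> {a'..b'}" "\<And>r. r \<in> S \<Longrightarrow> \<gamma> r = \<gamma>' r"
  shows "velocity A a b \<gamma> t = velocity A a' b' \<gamma>' t"
proof -
  have at: "at t within {a..b} = at t" "at t within {a'..b'} = at t"
    using assms(1-4) interior_maximal by (intro at_within_interior; blast)+
  have "((snd c \<circ> \<gamma>) has_vector_derivative u) (at t) \<longleftrightarrow> ((snd c \<circ> \<gamma>') has_vector_derivative u) (at t)"
    for c :: "('a, 'b) chart" and u
    by (rule has_vector_derivative_cong_open[OF assms(1,2)]) (simp add: assms(5))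
  then show ?thesis unfolding velocity_def at using assms(2,5) by auto
qed

section \<open>Segments in a patch as paths\<close>

context patches
begin

context
  fixes i y z :: 'm
  assumes yz: "y \<in> patch i" "z \<in> patch i"
begin

definition seg :: "real \<Rightarrow> 'x" where "seg t = crd i y + t *\<^sub>R (crd i z - crd i y)"

lemma seg_image: "t \<in> {0..1} \<Longrightarrow> seg t \<in> crd i ` patch i"
proof -
  assume "t \<in> {0..1}"
  moreover have "seg t = (1 - t) *\<^sub>R crd i y + t *\<^sub>R crd i z"
    by (simp add: seg_def algebra_simps)
  ultimately show ?thesis
    using convexD[OF convex_crd_image imageI[OF yz(1)] imageI[OF yz(2)], of "1 - t" t] by simp
qed

lemma cinv_seg:
  assumes "t \<in> {0..1}"
  shows "cinv (ch i) (seg t) \<in> patch i" "crd i (cinv (ch i) (seg t)) = seg t"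
proof -
  obtain q where "q \<in> patch i" "seg t = crd i q" using seg_image[OF assms] by blast
  then show "cinv (ch i) (seg t) \<in> patch i" "crd i (cinv (ch i) (seg t)) = seg t"
    using cinv_crd[of q i] patch_chart[of i] by auto
qed

lemma cinv_seg_0: "cinv (ch i) (seg 0) = y" and cinv_seg_1: "cinv (ch i) (seg 1) = z"
  using cinv_crd[of y i] cinv_crd[of z i] yz patch_chart[of i] by (auto simp: seg_def)

text \<open>The time shift \<open>b\<close> lets the segment follow a path that ends at time
  \<open>b\<close>.\<close>

lemma seg_derivative:
  assumes "t \<in> {0..1}" "d \<in> A" "cinv (ch i) (seg t) \<in> fst d"
  shows "((\<lambda>s. snd d (cinv (ch i) (seg (s - b)))) has_vector_derivative
      frechet_derivative (transition (ch i) d) (at (seg t)) (crd i z - crd i y)) (at (t + b))"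
proof -
  let ?T = "transition (ch i) d"
  have "(?T has_derivative frechet_derivative ?T (at (snd (ch i) (cinv (ch i) (seg t)))))
      (at (snd (ch i) (cinv (ch i) (seg t))))"
    using cinv_seg(1)[OF assms(1)] patch_chart[of i] assms by (intro transition_has_derivative ch) auto
  then have T: "(?T has_derivative frechet_derivative ?T (at (seg t))) (at (seg t))"
    using cinv_seg(2)[OF assms(1)] by (simp add: crd_def)
  have "((\<lambda>s. seg (s - b)) has_vector_derivative (crd i z - crd i y)) (at (t + b))"
    unfolding seg_def by (auto intro!: derivative_eq_intros)
  then have "((\<lambda>s. seg (s - b)) has_derivative (\<lambda>h. h *\<^sub>R (crd i z - crd i y))) (at (t + b))"
    by (simp add: has_vector_derivative_def)
  from has_derivative_compose[OF this, of ?T "frechet_derivative ?T (at (seg t))"] T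
  have "((\<lambda>s. ?T (seg (s - b))) has_derivative
      (\<lambda>h. frechet_derivative ?T (at (seg t)) (h *\<^sub>R (crd i z - crd i y)))) (at (t + b))"
    by simp
  then show ?thesis
    using linear_cmul[OF has_derivative_linear[OF T]] by (simp add: has_vector_derivative_def transition_def)
qed

lemma seg_C1:
  assumes \<gamma>: "\<And>t. t \<in> {b..b + 1} \<Longrightarrow> \<gamma> t = cinv (ch i) (seg (t - b))"
  shows "C1_path_on A b (b + 1) \<gamma>"
proof (rule C1_path_on_cong[OF _ \<gamma>])
  let ?\<gamma> = "\<lambda>t. cinv (ch i) (seg (t - b))"
  show "C1_path_on A b (b + 1) ?\<gamma>"
    unfolding C1_path_on_def
  proof (intro conjI ballI)
    show "continuous_on {b..b + 1} ?\<gamma>"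
    proof (rule continuous_on_compose2[of "cimage (ch i)" "cinv (ch i)"])
      show "continuous_on (cimage (ch i)) (cinv (ch i))"
        using chart[OF ch(1)[of i]] by (simp add: is_chart_def homeomorphism_def)
      show "continuous_on {b..b + 1} (\<lambda>t. seg (t - b))"
        unfolding seg_def by (intro continuous_intros)
      have "seg t \<in> cimage (ch i)" if "t \<in> {0..1}" for t
        using seg_image[OF that] patch_chart[of i] by (auto simp: cimage_def crd_def)
      then show "(\<lambda>t. seg (t - b)) ` {b..b + 1} \<subseteq> cimage (ch i)" by auto
    qed
    fix d assume d: "d \<in> A"
    let ?T = "transition (ch i) d"
    let ?u = "\<lambda>t. frechet_derivative ?T (at (seg (t - b))) (crd i z - crd i y)"
    let ?S = "{b..b + 1} \<inter> ?\<gamma> -` fst d"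
    have "continuous (at t) ?u" if t: "t \<in> ?S" for t
    proof -
      have t': "t - b \<in> {0..1}" using t by auto
      have "snd (ch i) (?\<gamma> t) \<in> snd (ch i) ` (fst (ch i) \<inter> fst d)"
        using cinv_seg(1)[OF t'] patch_chart[of i] t by auto
      then have mem: "seg (t - b) \<in> snd (ch i) ` (fst (ch i) \<inter> fst d)"
        using cinv_seg(2)[OF t'] by (simp add: crd_def)
      have g: "isCont (\<lambda>s. frechet_derivative ?T (at s) (crd i z - crd i y)) (seg (t - b))"
        by (rule Ck_on_strict_derivative(3)[OF transition_domain[OF ch(1) d] mem transition_Ck[OF ch(1) d] l])
      have "isCont (\<lambda>t. seg (t - b)) t" unfolding seg_def by (intro continuous_intros)
      then show ?thesis using g by (rule isCont_o2)
    qed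
    then have "continuous_on ?S ?u" by (intro continuous_at_imp_continuous_on) auto
    moreover have "((snd d \<circ> ?\<gamma>) has_vector_derivative ?u r) (at r within {b..b + 1})" if "r \<in> ?S" for r
    proof (rule has_vector_derivative_at_within)
      have "r - b \<in> {0..1}" "cinv (ch i) (seg (r - b)) \<in> fst d" using that by auto
      from seg_derivative[OF this(1) d this(2), of b]
      show "((snd d \<circ> ?\<gamma>) has_vector_derivative ?u r) (at r)" by (simp add: comp_def)
    qed
    ultimately show "\<exists>u. continuous_on ?S u \<and>
        (\<forall>r\<in>?S. ((snd d \<circ> ?\<gamma>) has_vector_derivative u r) (at r within {b..b + 1}))"
      by blast
  qed
qed

text \<open>In the chart of the patch the path has constant derivative, so its velocity is the class
  of \<open>crd i z - crd i y\<close>, to which \<open>F_upper\<close> applies. The velocity is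
  taken within \<open>{a..b + 1}\<close>, the domain of an extended path.\<close>

lemma seg_velocity:
  assumes "a \<le> b" "b < t" "t < b + 1" and \<gamma>: "\<And>t. t \<in> {b..b + 1} \<Longrightarrow> \<gamma> t = cinv (ch i) (seg (t - b))"
  shows "F (\<gamma> t, velocity A a (b + 1) \<gamma> t) \<le> K * \<nu> i (crd i z - crd i y)"
proof -
  let ?\<gamma> = "\<lambda>t. cinv (ch i) (seg (t - b))"
  have t: "t - b \<in> {0..1}" using assms by auto
  have x: "\<gamma> t = ?\<gamma> t" "\<gamma> t \<in> fst (ch i)" "snd (ch i) (\<gamma> t) = seg (t - b)"
    using cinv_seg[OF t] patch_chart[of i] assms \<gamma> by (auto simp: crd_def)
  have "velocity A a (b + 1) \<gamma> t = velocity A b (b + 1) ?\<gamma> t"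
    using assms by (intro velocity_cong_open[of "{b<..<b + 1}"]) auto
  also have "\<dots> = dchart_inv A (ch i) (\<gamma> t) (crd i z - crd i y)"
  proof -
    have at: "at t within {b..b + 1} = at t"
      using assms by (intro at_within_interior) auto
    have "((snd d \<circ> ?\<gamma>) has_vector_derivative w) (at t) \<longleftrightarrow>
        w = frechet_derivative (transition (ch i) d) (at (seg (t - b))) (crd i z - crd i y)"
      if "d \<in> A" "?\<gamma> t \<in> fst d" for d w
      using seg_derivative[of "t - b" d b] t that vector_derivative_unique_at by (auto simp: comp_def)
    then show ?thesis
      unfolding velocity_def at using x dchart_inv_mem[OF ch(1) x(2)] by auto
  qed
  finally show ?thesis using F_upper[OF x(2)] by simp
qed

lemma seg_integral:
  assumes "a \<le> b" and \<gamma>: "\<And>t. t \<in> {b..b + 1} \<Longrightarrow> \<gamma> t = cinv (ch i) (seg (t - b))"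
  shows "integral {b..b + 1} (\<lambda>t. F (\<gamma> t, velocity A a (b + 1) \<gamma> t)) \<le> K * \<nu> i (crd i z - crd i y)"
proof -
  let ?f = "\<lambda>t. F (\<gamma> t, velocity A a (b + 1) \<gamma> t)" and ?c = "K * \<nu> i (crd i z - crd i y)"
  have c: "?c \<ge> 0" using K norm_nonneg by simp
  show ?thesis
  proof (cases "?f integrable_on {b..b + 1}")
    case True
    \<comment> \<open>The speed bound is available for interior times only; at the break point
      \<open>b\<close> the velocity may even be the empty set.\<close>
    let ?g = "\<lambda>t. if t \<in> {b, b + 1} then 0 else ?f t"
    have g: "?g integrable_on {b..b + 1}"
      using True by (rule integrable_spike_finite[of "{b, b + 1}", rotated 2]) auto
    have "integral {b..b + 1} ?f = integral {b..b + 1} ?g"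
      by (rule integral_spike[of "{b, b + 1}"]) auto
    also have "\<dots> \<le> integral {b..b + 1} (\<lambda>_. ?c)"
      using g seg_velocity[OF assms(1) _ _ \<gamma>] c by (intro integral_le) auto
    finally show ?thesis by simp
  qed (use c in \<open>simp add: not_integrable_integral\<close>)
qed

end

section \<open>Lipschitz estimate for the Finsler distance\<close>

text \<open>Paths need \<open>a < b\<close>, so the constant path is obtained as a degenerate
  segment. Its length is at most 0, and \<open>ennreal\<close> maps such a number to 0.\<close>

lemma finsler_dist_self: "finsler_dist A F p p = 0"
proof -
  let ?\<gamma> = "\<lambda>t. cinv (ch p) (seg p p p t)"
  have \<gamma>: "?\<gamma> t = cinv (ch p) (seg p p p (t - 0))" for t by simp
  have "C1_path_on A 0 1 ?\<gamma>"
    using seg_C1[OF patch_self patch_self, of 0 ?\<gamma>] by simp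
  then have "piecewise_C1_path A 0 1 ?\<gamma>"
    unfolding piecewise_C1_path_def by (intro exI[of _ "Suc 0"] exI[of _ real]) auto
  moreover have "path_len A F 0 1 ?\<gamma> \<le> 0"
    unfolding path_len_def using seg_integral[OF patch_self patch_self, of 0 0 ?\<gamma>] by (simp add: norm_zero)
  moreover have "?\<gamma> 0 = p" "?\<gamma> 1 = p" using cinv_seg_0[OF patch_self patch_self] cinv_seg_1[OF patch_self patch_self] by auto
  ultimately have "finsler_dist A F p p \<le> ennreal (path_len A F 0 1 ?\<gamma>)"
    unfolding finsler_dist_def by (intro Inf_lower) force
  also have "\<dots> = 0" using \<open>path_len A F 0 1 ?\<gamma> \<le> 0\<close> by (simp add: ennreal_neg)
  finally show ?thesis by simp
qed

lemma piecewise_C1_extend: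
  assumes \<gamma>: "piecewise_C1_path A a b \<gamma>" and \<gamma>': "\<And>t. t \<le> b \<Longrightarrow> \<gamma>' t = \<gamma> t" "C1_path_on A b c \<gamma>'" and "b < c"
  shows "piecewise_C1_path A a c \<gamma>'"
proof -
  obtain n \<tau> where \<tau>: "\<tau> 0 = a" "\<tau> n = b" "\<And>i. i < n \<Longrightarrow> \<tau> i < \<tau> (Suc i)"
    "\<And>i. i < n \<Longrightarrow> C1_path_on A (\<tau> i) (\<tau> (Suc i)) \<gamma>"
    using \<gamma> unfolding piecewise_C1_path_def by metis
  have le: "\<tau> j \<le> b" if "j \<le> n" for j
    using that
  proof (induction rule: inc_induct)
    case (step j)
    then show ?case using \<tau>(3)[of j] by linarith
  qed (simp add: \<tau>(2))
  let ?\<tau> = "\<tau>(Suc n := c)"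
  have "?\<tau> j < ?\<tau> (Suc j) \<and> C1_path_on A (?\<tau> j) (?\<tau> (Suc j)) \<gamma>'" if j: "j < Suc n" for j
  proof (cases "j = n")
    case True
    then show ?thesis using \<gamma>'(2) \<open>b < c\<close> \<tau>(2) by simp
  next
    case False
    then have j: "j < n" using j by simp
    have "C1_path_on A (\<tau> j) (\<tau> (Suc j)) \<gamma>'"
      using le[of "Suc j"] j by (intro C1_path_on_cong[OF \<tau>(4)[OF j] \<gamma>'(1)]) auto
    then show ?thesis using j \<tau>(3) by simp
  qed
  then show ?thesis
    unfolding piecewise_C1_path_def using \<tau>(1) by (intro exI[of _ "Suc n"] exI[of _ ?\<tau>]) simp
qed

text \<open>
  If the speed of the extended path is not integrable, its length is \<open>0\<close> by convention, so the bound
  needs no continuity of \<open>F\<close>.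
\<close>

lemma finsler_dist_step:
  assumes yz: "y \<in> patch i" "z \<in> patch i"
  shows "finsler_dist A F p z \<le> finsler_dist A F p y + ennreal (K * \<nu> i (crd i y - crd i z))"
proof -
  let ?c = "K * \<nu> i (crd i z - crd i y)"
  have c: "?c \<ge> 0" using K norm_nonneg by simp
  have main: "finsler_dist A F p z \<le> ennreal ?c + ennreal (path_len A F a b \<gamma>)"
    if ab: "a < b" and pw: "piecewise_C1_path A a b \<gamma>" and ends: "\<gamma> a = p" "\<gamma> b = y" for a b \<gamma>
  proof -
    define \<gamma>' where "\<gamma>' t = (if t \<le> b then \<gamma> t else cinv (ch i) (seg i y z (t - b)))" for t
    have \<gamma>': "\<gamma>' t = cinv (ch i) (seg i y z (t - b))" if "t \<in> {b..b + 1}" for t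
      using that cinv_seg_0[OF yz] ends by (cases "t = b") (auto simp: \<gamma>'_def)
    have "piecewise_C1_path A a (b + 1) \<gamma>'"
      by (rule piecewise_C1_extend[OF pw _ seg_C1[OF yz \<gamma>']]) (auto simp: \<gamma>'_def)
    moreover have "\<gamma>' a = p" "\<gamma>' (b + 1) = z"
      using ends ab \<gamma>'[of "b + 1"] cinv_seg_1[OF yz] by (auto simp: \<gamma>'_def)
    ultimately have "finsler_dist A F p z \<le> ennreal (path_len A F a (b + 1) \<gamma>')"
      unfolding finsler_dist_def using ab by (intro Inf_lower) force
    also have "\<dots> \<le> ennreal ?c + ennreal (path_len A F a b \<gamma>)"
    proof (cases "(\<lambda>t. F (\<gamma>' t, velocity A a (b + 1) \<gamma>' t)) integrable_on {a..b + 1}")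
      case True
      have "path_len A F a (b + 1) \<gamma>' = integral {a..b} (\<lambda>t. F (\<gamma>' t, velocity A a (b + 1) \<gamma>' t)) +
          integral {b..b + 1} (\<lambda>t. F (\<gamma>' t, velocity A a (b + 1) \<gamma>' t))"
        unfolding path_len_def using True ab by (intro Henstock_Kurzweil_Integration.integral_combine[symmetric]) auto
      also have "integral {a..b} (\<lambda>t. F (\<gamma>' t, velocity A a (b + 1) \<gamma>' t)) = path_len A F a b \<gamma>"
        unfolding path_len_def
      proof (rule integral_spike[of "{a, b}"])
        fix t assume "t \<in> {a..b} - {a, b}"
        then have t: "t \<in> {a<..<b}" by auto
        have "velocity A a b \<gamma> t = velocity A a (b + 1) \<gamma>' t"
          using t by (intro velocity_cong_open[of "{a<..<b}"]) (auto simp: \<gamma>'_def)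
        then show "F (\<gamma> t, velocity A a b \<gamma> t) = F (\<gamma>' t, velocity A a (b + 1) \<gamma>' t)"
          using t by (simp add: \<gamma>'_def)
      qed simp
      also have "integral {b..b + 1} (\<lambda>t. F (\<gamma>' t, velocity A a (b + 1) \<gamma>' t)) \<le> ?c"
        using ab by (intro seg_integral[OF yz] \<gamma>') auto
      finally have "ennreal (path_len A F a (b + 1) \<gamma>') \<le> ennreal (?c + path_len A F a b \<gamma>)"
        by (intro ennreal_leI) simp
      \<comment> \<open>No sign of the old length is at hand; a negative one would be replaced by 0
        under \<open>ennreal\<close>, and the inequality persists.\<close>
      also have "\<dots> \<le> ennreal ?c + ennreal (path_len A F a b \<gamma>)"
        using c by (cases "path_len A F a b \<gamma> \<ge> 0") (auto simp: ennreal_neg intro!: ennreal_leI)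
      finally show ?thesis .
    qed (simp add: path_len_def not_integrable_integral)
    finally show ?thesis .
  qed
  \<comment> \<open>Moving \<open>?c\<close> to the left turns the claim into a lower bound for an
    infimum, which is checked path by path and holds trivially if no path leads to
    \<open>y\<close>.\<close>
  have "finsler_dist A F p z - ennreal ?c \<le> finsler_dist A F p y"
    unfolding finsler_dist_def[of _ _ p y]
  proof (rule Inf_greatest)
    fix e assume "e \<in> {ennreal (path_len A F a b \<gamma>) |a b \<gamma>. a < b \<and> piecewise_C1_path A a b \<gamma> \<and> \<gamma> a = p \<and> \<gamma> b = y}"
    then obtain a b \<gamma> where "e = ennreal (path_len A F a b \<gamma>)" "a < b" "piecewise_C1_path A a b \<gamma>" "\<gamma> a = p" "\<gamma> b = y"
      by blast
    then show "finsler_dist A F p z - ennreal ?c \<le> e"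
      using main by (simp add: ennreal_minus_le_iff)
  qed
  then have "finsler_dist A F p z \<le> ennreal ?c + finsler_dist A F p y"
    by (simp add: ennreal_minus_le_iff)
  then show ?thesis by (simp add: add.commute norm_sym)
qed

text \<open>Truncation makes the distance real-valued even between different components, and a bump
  that vanishes from distance \<open>\<delta>\<close> on does not have to see larger values.\<close>

definition tdist :: "real \<Rightarrow> 'm \<Rightarrow> 'm \<Rightarrow> real" where
  "tdist \<delta> p q = enn2real (min (ennreal \<delta>) (finsler_dist A F p q))"

lemma plip_tdist:
  assumes "\<delta> > 0"
  shows "plip K (tdist \<delta> p)"
  unfolding plip_def
proof (intro allI ballI)
  have e: "ennreal (tdist \<delta> p q) = min (ennreal \<delta>) (finsler_dist A F p q)" for q
    unfolding tdist_def by (rule ennreal_enn2real) (simp add: min_less_iff_disj)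
  have le: "tdist \<delta> p z \<le> tdist \<delta> p y + K * \<nu> i (crd i y - crd i z)" if "y \<in> patch i" "z \<in> patch i" for i y z
  proof -
    have c: "K * \<nu> i (crd i y - crd i z) \<ge> 0" using K norm_nonneg by simp
    have "ennreal (tdist \<delta> p z) \<le> ennreal (tdist \<delta> p y) + ennreal (K * \<nu> i (crd i y - crd i z))"
      unfolding e using finsler_dist_step[OF that, of p]
      by (smt (verit) add_increasing2 min.cobounded1 min.coboundedI2 min_def order_trans zero_le)
    also have "\<dots> = ennreal (tdist \<delta> p y + K * \<nu> i (crd i y - crd i z))"
      using c by (simp add: tdist_def)
    finally show ?thesis using c by (subst (asm) ennreal_le_iff) (auto simp: tdist_def)
  qed
  fix i y z assume "y \<in> patch i" "z \<in> patch i"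
  with le[of y i z] le[of z i y] norm_sym[of i "crd i y" "crd i z"]
  show "\<bar>tdist \<delta> p y - tdist \<delta> p z\<bar> \<le> K * \<nu> i (crd i y - crd i z)" by simp
qed

section \<open>From Lipschitz estimates to bounds on the differential\<close>

text \<open>The derivative along \<open>v\<close> is a limit of difference quotients between
  \<open>crd q q\<close> and \<open>crd q q + t *\<^sub>R v\<close>, to which the Lipschitz estimate
  in the coordinates of the patch \<open>q\<close> applies. \<open>F_lower\<close> bounds
  \<open>\<nu> q v\<close> by \<open>K\<close> on the Finsler unit ball.\<close>

lemma dfun_bound:
  assumes b: "smooth_fun m A b" "1 \<le> m" and N: "open N" "q \<in> N" "N \<subseteq> patch q"
    and lip: "\<And>y z. y \<in> N \<Longrightarrow> z \<in> N \<Longrightarrow> \<bar>b y - b z\<bar> \<le> M * \<nu> q (crd q y - crd q z)" and M: "M \<ge> 0"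
  shows "dfun_norm A F b q \<le> ennreal (K * M)"
  unfolding dfun_norm_def
proof (rule SUP_least, rule ennreal_leI)
  fix a assume "a \<in> {a \<in> tangent_space A q. F (q, a) \<le> 1}"
  then obtain v where v: "a = dchart_inv A (ch q) q v" "F (q, dchart_inv A (ch q) q v) \<le> 1"
    using tangent_space_eq[OF ch(1) ch(2), of q] by auto
  have der: "((b \<circ> cinv d) has_derivative frechet_derivative (b \<circ> cinv d) (at (snd d q))) (at (snd d q))"
    if "d \<in> A" "q \<in> fst d" for d
    using that b unfolding smooth_fun_def
    by (intro Ck_on_strict_derivative(1)[OF chart_open(2) chart_in _ b(2)]) auto
  define D where "D = frechet_derivative (b \<circ> cinv (ch q)) (at (crd q q))"
  have D: "((b \<circ> cinv (ch q)) has_derivative D) (at (crd q q))"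
    unfolding D_def crd_def by (rule der[OF ch])
  \<comment> \<open>\<open>dfun\<close> is a definite description over all representatives of the
    tangent vector, so each of them has to yield \<open>D v\<close>; this is the chain rule for the
    transition map.\<close>
  have "frechet_derivative (b \<circ> cinv d) (at (snd d q)) w = D v" if "(d, w) \<in> a" for d w
  proof -
    let ?T = "transition (ch q) d"
    have d: "d \<in> A" "q \<in> fst d" "w = frechet_derivative ?T (at (crd q q)) v"
      using that dchart_inv_mem[OF ch(1) ch(2)] by (auto simp: v(1) crd_def)
    have T: "(?T has_derivative frechet_derivative ?T (at (crd q q))) (at (crd q q))"
      unfolding crd_def by (rule transition_has_derivative[OF ch(1) d(1) ch(2) d(2)])
    have "((b \<circ> cinv d) has_derivative frechet_derivative (b \<circ> cinv d) (at (snd d q))) (at (?T (crd q q)))"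
      using der[OF d(1,2)] transition_at[OF ch(1) ch(2), of q d] by (simp add: crd_def)
    from diff_chain_at[OF T this]
    have "((b \<circ> cinv (ch q)) has_derivative
        frechet_derivative (b \<circ> cinv d) (at (snd d q)) \<circ> frechet_derivative ?T (at (crd q q))) (at (crd q q))"
    proof (rule has_derivative_transform_within_open)
      show "open (snd (ch q) ` (fst (ch q) \<inter> fst d))" by (rule transition_domain[OF ch(1) d(1)])
      show "crd q q \<in> snd (ch q) ` (fst (ch q) \<inter> fst d)" using ch d by (auto simp: crd_def)
      fix s assume "s \<in> snd (ch q) ` (fst (ch q) \<inter> fst d)"
      then show "(b \<circ> cinv d \<circ> transition (ch q) d) s = (b \<circ> cinv (ch q)) s"
        using cinv_chart[OF ch(1)] cinv_chart[OF d(1)] by (auto simp: transition_def)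
    qed
    from has_derivative_unique[OF this D] show ?thesis
      unfolding d(3) by (metis comp_apply)
  qed
  moreover have "(ch q, v) \<in> a"
    using dchart_inv_mem[OF ch(1) ch(2), of "ch q" v q v] transition_self[OF ch(1) ch(2), of q v] ch by (simp add: v(1))
  ultimately have dfun: "dfun b q a = D v"
    unfolding dfun_def by (intro the_equality) fastforce+
  have "\<bar>D v\<bar> \<le> M * \<nu> q v"
  proof (rule field_le_epsilon)
    fix e :: real assume e: "e > 0"
    define v1 where "v1 = norm v + 1"
    define e' where "e' = e / v1"
    have nv: "v1 > 0" unfolding v1_def using norm_ge_zero[of v] by linarith
    have e': "e' > 0" using e nv by (simp add: e'_def)
    obtain r where r: "r > 0" "\<And>y. norm (y - crd q q) < r \<Longrightarrow>
        norm ((b \<circ> cinv (ch q)) y - (b \<circ> cinv (ch q)) (crd q q) - D (y - crd q q)) \<le> e' * norm (y - crd q q)"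
      using D e' unfolding has_derivative_at_alt by blast
    have "open (crd q ` N)" unfolding crd_def using N patch_chart[of q] by (intro open_chart_image ch) auto
    then obtain s where s: "s > 0" "ball (crd q q) s \<subseteq> crd q ` N"
      using N(2) by (meson imageI openE)
    \<comment> \<open>So small that \<open>t *\<^sub>R v\<close> stays within both radii;
      \<open>v1\<close> is positive even for \<open>v = 0\<close>.\<close>
    define t where "t = min r s / (2 * v1)"
    have t: "t > 0" using r(1) s(1) nv by (simp add: t_def)
    define y where "y = crd q q + t *\<^sub>R v"
    have yq: "y - crd q q = t *\<^sub>R v" by (simp add: y_def)
    have "t * norm v \<le> t * v1" using t by (intro mult_left_mono) (auto simp: v1_def)
    also have "\<dots> = min r s / 2" using nv by (simp add: t_def)
    also have "\<dots> < min r s" using r(1) s(1) by (auto simp: min_def)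
    finally have tv: "norm (t *\<^sub>R v) < min r s" using t by simp
    then have "y \<in> ball (crd q q) s" by (simp add: y_def dist_norm)
    then obtain p where p: "p \<in> N" "y = crd q p" using s(2) by blast
    have "(b \<circ> cinv (ch q)) y = b p" "(b \<circ> cinv (ch q)) (crd q q) = b q"
      using p N patch_chart[of q] ch cinv_crd by auto
    moreover have "\<bar>b p - b q\<bar> \<le> M * (t * \<nu> q v)"
      using lip[OF p(1) N(2)] t yq by (simp add: p(2)[symmetric] norm_scale)
    moreover have "D (y - crd q q) = t * D v"
      unfolding yq using linear_cmul[OF has_derivative_linear[OF D], of t v] by simp
    ultimately have "\<bar>t * D v\<bar> \<le> M * (t * \<nu> q v) + e' * (t * norm v)"
      using r(2)[of y] tv t unfolding yq by simp
    then have "t * \<bar>D v\<bar> \<le> t * (M * \<nu> q v + e' * norm v)"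
      using t by (simp add: abs_mult algebra_simps)
    then have "\<bar>D v\<bar> \<le> M * \<nu> q v + e' * norm v" using t by simp
    also have "e' * norm v \<le> e' * v1" using e' by (intro mult_left_mono) (auto simp: v1_def)
    also have "\<dots> = e" using nv by (simp add: e'_def)
    finally show "\<bar>D v\<bar> \<le> M * \<nu> q v + e" by simp
  qed
  moreover have "\<nu> q v \<le> K"
    using F_lower[OF ch(2), of q v] mult_left_mono[OF v(2), of K] K by linarith
  ultimately show "\<bar>dfun b q a\<bar> \<le> K * M"
    using mult_left_mono[of "\<nu> q v" K M] M by (simp add: dfun mult.commute)
qed

end

section \<open>Bump functions\<close>

context partition
begin

lemma uniformly_bumpable: "uniformly_bumpable (min l k) A F"
proof -
  define M where "M = kap * (C0 * K) + 1"
  define R' where "R' = K * (Ls * 2 * M)"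
  have M: "M \<ge> 0" using kap C0 K by (simp add: M_def)
  have R': "R' \<ge> 0" using K Ls M by (simp add: R'_def)
  have "\<exists>b. smooth_fun (min l k) A b \<and> (\<forall>q. 0 \<le> b q \<and> b q \<le> 1) \<and> b p = 1 \<and>
      (\<forall>q. finsler_dist A F p q \<ge> ennreal \<delta> \<longrightarrow> b q = 0) \<and>
      (SUP q. dfun_norm A F b q) \<le> ennreal ((R' + 2) / \<delta>)"
    if \<delta>: "0 < \<delta>" for p \<delta>
  proof -
    have "\<delta> / 4 > 0" "K \<ge> 0" using \<delta> K by auto
    note approx = plip_smooth_approx[OF plip_tdist[OF \<delta>, of p] this(2) this(1), folded M_def]
    obtain g where g: "smooth_fun (min l k) A g" "\<And>x. \<bar>tdist \<delta> p x - g x\<bar> \<le> \<delta> / 4"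
      "\<And>x. \<exists>N. open N \<and> x \<in> N \<and> N \<subseteq> patch x \<and>
        (\<forall>y\<in>N. \<forall>z\<in>N. \<bar>g y - g z\<bar> \<le> M * \<nu> x (crd x y - crd x z))"
      by (rule approx, rule that)
    \<comment> \<open>The argument of \<open>\<sigma>\<close> falls linearly in \<open>g\<close>,
      from 1 at \<open>\<delta> / 4\<close> to 0 at \<open>3 * \<delta> / 4\<close>. The truncated
      distance is 0 at \<open>p\<close> and \<open>\<delta>\<close> far away, and \<open>g\<close>
      differs from it by at most \<open>\<delta> / 4\<close>, so \<open>b\<close> is 1 at
      \<open>p\<close> and 0 far away.\<close>
    define b where "b q = \<sigma> (- (2 / \<delta>) * g q + 3 / 2)" for q
    have b_smooth: "smooth_fun (min l k) A b"
      unfolding smooth_fun_def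
    proof
      fix c assume c: "c \<in> A"
      have "Ck_on (min l k) (cimage c) (\<lambda>z. - (2 / \<delta>) * (g \<circ> cinv c) z + 3 / 2)"
        by (rule Ck_on_affine_comp[OF chart_open(2)[OF c] bspec[OF g(1)[unfolded smooth_fun_def] c]])
      from Ck_on_compose[OF chart_open(2)[OF c] open_UNIV _ \<sigma>_Ck this]
      show "Ck_on (min l k) (cimage c) (b \<circ> cinv c)" by (simp add: b_def comp_def)
    qed
    have "tdist \<delta> p p = 0" by (simp add: tdist_def finsler_dist_self)
    then have "g p \<le> \<delta> / 4" using g(2)[of p] by linarith
    then have "- (2 / \<delta>) * g p + 3 / 2 \<ge> 1" using \<delta> by (simp add: field_simps)
    then have b1: "b p = 1" unfolding b_def by (rule \<sigma>_1)
    have b0: "b q = 0" if "finsler_dist A F p q \<ge> ennreal \<delta>" for q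
    proof -
      have "tdist \<delta> p q = \<delta>" using that \<delta> by (simp add: tdist_def min_absorb1)
      then have "g q \<ge> 3 * \<delta> / 4" using g(2)[of q] by linarith
      then have "- (2 / \<delta>) * g q + 3 / 2 \<le> 0" using \<delta> by (simp add: field_simps)
      then show ?thesis unfolding b_def by (rule \<sigma>_0)
    qed
    have "dfun_norm A F b q \<le> ennreal ((R' + 2) / \<delta>)" for q
    proof -
      obtain N where N: "open N" "q \<in> N" "N \<subseteq> patch q"
        "\<And>y z. y \<in> N \<Longrightarrow> z \<in> N \<Longrightarrow> \<bar>g y - g z\<bar> \<le> M * \<nu> q (crd q y - crd q z)"
        using g(3)[of q] by blast
      have "\<bar>b y - b z\<bar> \<le> Ls * (2 / \<delta>) * M * \<nu> q (crd q y - crd q z)" if "y \<in> N" "z \<in> N" for y z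
      proof -
        have "\<bar>b y - b z\<bar> \<le> Ls * \<bar>(- (2 / \<delta>) * g y + 3 / 2) - (- (2 / \<delta>) * g z + 3 / 2)\<bar>"
          unfolding b_def by (rule \<sigma>_lip)
        also have "(- (2 / \<delta>) * g y + 3 / 2) - (- (2 / \<delta>) * g z + 3 / 2) = - (2 / \<delta>) * (g y - g z)"
          by (simp add: right_diff_distrib)
        also have "Ls * \<bar>- (2 / \<delta>) * (g y - g z)\<bar> = Ls * (2 / \<delta>) * \<bar>g y - g z\<bar>"
          unfolding abs_mult using \<delta> by simp
        also have "\<dots> \<le> Ls * (2 / \<delta>) * (M * \<nu> q (crd q y - crd q z))"
          using N(4)[OF that] Ls \<delta> by (intro mult_left_mono) auto
        finally show ?thesis by (simp add: mult.assoc)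
      qed
      moreover have "Ls * (2 / \<delta>) * M \<ge> 0" using Ls \<delta> M by simp
      moreover have "1 \<le> min l k" using l k by simp
      ultimately have "dfun_norm A F b q \<le> ennreal (K * (Ls * (2 / \<delta>) * M))"
        using dfun_bound[OF b_smooth _ N(1-3)] by blast
      also have "K * (Ls * (2 / \<delta>) * M) = R' / \<delta>" by (simp add: R'_def)
      also have "ennreal (R' / \<delta>) \<le> ennreal ((R' + 2) / \<delta>)"
        using \<delta> by (intro ennreal_leI divide_right_mono) auto
      finally show ?thesis .
    qed
    then have "(SUP q. dfun_norm A F b q) \<le> ennreal ((R' + 2) / \<delta>)" by (rule SUP_least)
    moreover have "0 \<le> b q \<and> b q \<le> 1" for q by (simp add: b_def \<sigma>_ge \<sigma>_le)
    ultimately show ?thesis using b_smooth b1 b0 by blast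
  qed
  \<comment> \<open>The construction works for every positive \<open>\<delta>\<close>, so any
    \<open>r\<close> will do; adding 2 to \<open>R'\<close> makes the constant exceed 1.\<close>
  then show ?thesis
    unfolding uniformly_bumpable_def using R'
    by (intro exI[of _ "R' + 2"] conjI exI[of _ "1 :: real"]) auto
qed

end

section \<open>Patches from the two alternatives of the hypothesis\<close>

context C1_manifold
begin

text \<open>Both alternatives yield the same data. For a weak-uniform manifold the norm of a patch
  is the Finsler norm at its centre, pulled back to the model space; it changes from point to point,
  so the constant of the approximation property has to be the same for all equivalent norms. For a
  uniform manifold the given norm serves at every point.\<close>

lemma uniform_patch:
  assumes P1: "P1 A F"
    and h: "((\<exists>K\<ge>1. weak_uniform K A F) \<and>
          (\<exists>C\<^sub>0\<ge>1. \<forall>\<nu> :: 'x \<Rightarrow> real. equivalent_norm \<nu> \<longrightarrow> star_property k \<nu> C\<^sub>0)) \<or>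
         ((\<exists>K\<ge>1. uniform K A F) \<and>
          (\<exists>C\<^sub>0\<ge>1. star_property k (norm :: 'x \<Rightarrow> real) C\<^sub>0))"
  obtains K C0 where "1 \<le> K" "1 \<le> C0"
    "\<And>x\<^sub>0. \<exists>c \<nu>. c \<in> A \<and> x\<^sub>0 \<in> fst c \<and> equivalent_norm \<nu> \<and> star_property k \<nu> C0 \<and>
      (\<forall>x\<in>fst c. \<forall>v. \<nu> v \<le> K * F (x, dchart_inv A c x v) \<and> F (x, dchart_inv A c x v) \<le> K * \<nu> v)"
  using h
proof (elim disjE conjE exE)
  fix K C0 assume K: "1 \<le> K" "weak_uniform K A F"
    and C0: "1 \<le> C0" "\<forall>\<nu> :: 'x \<Rightarrow> real. equivalent_norm \<nu> \<longrightarrow> star_property k \<nu> C0"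
  have "\<exists>c \<nu>. c \<in> A \<and> x\<^sub>0 \<in> fst c \<and> equivalent_norm \<nu> \<and> star_property k \<nu> C0 \<and>
      (\<forall>x\<in>fst c. \<forall>v. \<nu> v \<le> K * F (x, dchart_inv A c x v) \<and> F (x, dchart_inv A c x v) \<le> K * \<nu> v)" for x\<^sub>0
  proof -
    obtain c where c: "c \<in> A" "x\<^sub>0 \<in> fst c" "\<And>x v. x \<in> fst c \<Longrightarrow>
        1 / K * F (x\<^sub>0, dchart_inv A c x\<^sub>0 v) \<le> F (x, dchart_inv A c x v) \<and>
        F (x, dchart_inv A c x v) \<le> K * F (x\<^sub>0, dchart_inv A c x\<^sub>0 v)"
      using K(2) unfolding weak_uniform_def by metis
    let ?\<nu> = "\<lambda>v. F (x\<^sub>0, dchart_inv A c x\<^sub>0 v)"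
    have eq: "equivalent_norm ?\<nu>" using P1 c(1,2) unfolding P1_def by blast
    have "?\<nu> v \<le> K * F (x, dchart_inv A c x v) \<and> F (x, dchart_inv A c x v) \<le> K * ?\<nu> v"
      if "x \<in> fst c" for x v
      using c(3)[OF that, of v] K(1) by (simp add: pos_divide_le_eq mult.commute)
    then show ?thesis using c eq C0 by (intro exI[of _ c] exI[of _ ?\<nu>]) auto
  qed
  then show ?thesis using that K(1) C0(1) by blast
next
  fix K C0 assume K: "1 \<le> K" "uniform K A F" and C0: "1 \<le> C0" "star_property k (norm :: 'x \<Rightarrow> real) C0"
  have "\<exists>c \<nu>. c \<in> A \<and> x\<^sub>0 \<in> fst c \<and> equivalent_norm \<nu> \<and> star_property k \<nu> C0 \<and>
      (\<forall>x\<in>fst c. \<forall>v. \<nu> v \<le> K * F (x, dchart_inv A c x v) \<and> F (x, dchart_inv A c x v) \<le> K * \<nu> v)" for x\<^sub>0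
  proof -
    obtain c where c: "c \<in> A" "x\<^sub>0 \<in> fst c" "\<And>x a. x \<in> fst c \<Longrightarrow> a \<in> tangent_space A x \<Longrightarrow>
        1 / K * F (x, a) \<le> norm (dchart c a) \<and> norm (dchart c a) \<le> K * F (x, a)"
      using K(2) unfolding uniform_def by metis
    have "norm v \<le> K * F (x, dchart_inv A c x v) \<and> F (x, dchart_inv A c x v) \<le> K * norm v"
      if x: "x \<in> fst c" for x v
      using c(3)[OF x, of "dchart_inv A c x v"] K(1) tangent_space_eq[OF c(1) x] dchart_dchart_inv[OF c(1) x, of v]
      by (simp add: pos_divide_le_eq mult.commute)
    moreover have "equivalent_norm (norm :: 'x \<Rightarrow> real)"
      unfolding equivalent_norm_def is_norm_def
      by (auto simp: norm_triangle_ineq intro!: exI[of _ "1 :: real"])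
    ultimately show ?thesis using c C0 by (intro exI[of _ c] exI[of _ norm]) auto
  qed
  then show ?thesis using that K(1) C0(1) by blast
qed

text \<open>By regularity the half ball lies in a neighbourhood whose closure is contained in the
  chart domain. A point in the closure of the half ball is therefore still in the chart, where the
  coordinate map is continuous and the inequality passes to the limit.\<close>

lemma patch_radius:
  assumes para: "paracompact TYPE('m)" and c: "c \<in> A" "x\<^sub>0 \<in> fst c" and \<nu>: "equivalent_norm \<nu>"
  obtains r where "r > 0" "\<And>z. \<nu> (z - snd c x\<^sub>0) < r \<Longrightarrow> z \<in> cimage c"
    "closed {x \<in> fst c. \<nu> (snd c x - snd c x\<^sub>0) \<le> r / 2}"
proof -
  obtain N where N: "open N" "x\<^sub>0 \<in> N" "closure N \<subseteq> fst c"
    by (rule paracompact_regular[OF para chart_open(1)[OF c(1)] c(2)])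
  obtain a a' where a: "a > 0" "\<And>v. a * norm v \<le> \<nu> v" "\<And>v. \<nu> v \<le> a' * norm v"
    using \<nu> unfolding equivalent_norm_def by metis
  have Nc: "N \<subseteq> fst c" using N(3) closure_subset by blast
  then have "open (snd c ` N)" by (rule open_chart_image[OF c(1) N(1)])
  then obtain d where d: "d > 0" "ball (snd c x\<^sub>0) d \<subseteq> snd c ` N"
    using N(2) by (meson imageI openE)
  \<comment> \<open>By \<open>a * norm v \<le> \<nu> v\<close>, the \<open>\<nu>\<close>-ball of
    this radius lies in the norm ball of radius \<open>d\<close>.\<close>
  define r where "r = a * d"
  have r: "r > 0" using a(1) d(1) by (simp add: r_def)
  have ball: "z \<in> snd c ` N" if "\<nu> (z - snd c x\<^sub>0) < r" for z
  proof -
    have "a * norm (z - snd c x\<^sub>0) < a * d" using a(2)[of "z - snd c x\<^sub>0"] that by (simp add: r_def)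
    then have "z \<in> ball (snd c x\<^sub>0) d" using a(1) by (simp add: dist_norm norm_minus_commute)
    then show ?thesis using d(2) by blast
  qed
  define S where "S = {x \<in> fst c. \<nu> (snd c x - snd c x\<^sub>0) \<le> r / 2}"
  have cont: "continuous_on (fst c) (snd c)"
    using chart[OF c(1)] by (simp add: is_chart_def homeomorphism_def)
  have S_N: "S \<subseteq> N"
  proof
    fix x assume "x \<in> S"
    then have x: "x \<in> fst c" "\<nu> (snd c x - snd c x\<^sub>0) \<le> r / 2" by (auto simp: S_def)
    then have "snd c x \<in> snd c ` N" using r by (intro ball) simp
    then obtain y where "y \<in> N" "snd c x = snd c y" by blast
    then show "x \<in> N" using cinv_chart[OF c(1) x(1)] cinv_chart[OF c(1), of y] Nc by auto
  qed
  have tri: "\<nu> v \<le> \<nu> w + a' * norm (v - w)" for v w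
  proof -
    have "\<nu> (w + (v - w)) \<le> \<nu> w + \<nu> (v - w)"
      using \<nu> unfolding equivalent_norm_def is_norm_def by blast
    then show ?thesis using a(3)[of "v - w"] by simp
  qed
  have "closure S \<subseteq> S"
  proof
    fix x assume x: "x \<in> closure S"
    then have xc: "x \<in> fst c" using closure_mono[OF S_N] N(3) by blast
    have "\<nu> (snd c x - snd c x\<^sub>0) \<le> r / 2"
    proof (rule field_le_epsilon)
      fix e :: real assume e: "e > 0"
      let ?e = "e / (\<bar>a'\<bar> + 1)"
      let ?O = "{y \<in> fst c. snd c y \<in> ball (snd c x) ?e}"
      have "open ?O" by (rule open_chart_preimage[OF c(1)]) simp
      moreover have "x \<in> ?O" using xc e by simp
      ultimately obtain y where y: "y \<in> S" "y \<in> ?O"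
        using x unfolding closure_iff_nhds_not_empty by blast
      have "\<nu> (snd c x - snd c x\<^sub>0) \<le> \<nu> (snd c y - snd c x\<^sub>0) + a' * norm (snd c x - snd c y)"
        using tri[of "snd c x - snd c x\<^sub>0" "snd c y - snd c x\<^sub>0"] by simp
      also have "a' * norm (snd c x - snd c y) \<le> (\<bar>a'\<bar> + 1) * ?e"
        using y(2) by (intro mult_mono) (auto simp: dist_norm)
      also have "\<dots> = e" by simp
      finally show "\<nu> (snd c x - snd c x\<^sub>0) \<le> r / 2 + e" using y(1) by (simp add: S_def)
    qed
    then show "x \<in> S" using xc by (simp add: S_def)
  qed
  then have "closed S" by (simp add: closure_subset_eq)
  moreover have "z \<in> cimage c" if "\<nu> (z - snd c x\<^sub>0) < r" for z
    using ball[OF that] Nc by (auto simp: cimage_def)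
  ultimately show ?thesis using that r unfolding S_def by blast
qed

end

theorem corollary4p2:
  fixes A :: "('m::t2_space, 'x::banach) chart set"
    and F :: "('m, 'x) finsler"
    and l k :: enat
  assumes "1 \<le> l" and "1 \<le> k"
    and "finsler_manifold l A F"
    and "((\<exists>K\<ge>1. weak_uniform K A F) \<and>
          (\<exists>C\<^sub>0\<ge>1. \<forall>\<nu> :: 'x \<Rightarrow> real. equivalent_norm \<nu> \<longrightarrow> star_property k \<nu> C\<^sub>0)) \<or>
         ((\<exists>K\<ge>1. uniform K A F) \<and>
          (\<exists>C\<^sub>0\<ge>1. star_property k (norm :: 'x \<Rightarrow> real) C\<^sub>0))"
  shows "uniformly_bumpable (min l k) A F"
proof -
  have man: "smooth_structure l A" "paracompact TYPE('m)" "P1 A F"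
    using assms(3) by (auto simp: finsler_manifold_def banach_manifold_def neeb_upmeier_def)
  interpret C1_manifold A l
    by unfold_locales (fact man(1), fact assms(1))
  obtain K C0 where K: "1 \<le> K" "1 \<le> C0"
    and ex: "\<And>x\<^sub>0. \<exists>c \<nu>. c \<in> A \<and> x\<^sub>0 \<in> fst c \<and> equivalent_norm \<nu> \<and> star_property k \<nu> C0 \<and>
      (\<forall>x\<in>fst c. \<forall>v. \<nu> v \<le> K * F (x, dchart_inv A c x v) \<and> F (x, dchart_inv A c x v) \<le> K * \<nu> v)"
    by (rule uniform_patch[OF man(3) assms(4)], rule that)
  \<comment> \<open>Norm and radius depend on the chart, so all three are bundled in one predicate
    and chosen at once for all points.\<close>
  define Q where "Q i c \<nu> r \<longleftrightarrow> c \<in> A \<and> i \<in> fst c \<and> equivalent_norm \<nu> \<and> star_property k \<nu> C0 \<and>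
      (\<forall>x\<in>fst c. \<forall>v. \<nu> v \<le> K * F (x, dchart_inv A c x v) \<and> F (x, dchart_inv A c x v) \<le> K * \<nu> v) \<and>
      r > 0 \<and> (\<forall>z. \<nu> (z - snd c i) < r \<longrightarrow> z \<in> cimage c) \<and>
      closed {x \<in> fst c. \<nu> (snd c x - snd c i) \<le> r / 2}"
    for i :: 'm and c :: "('m, 'x) chart" and \<nu> :: "'x \<Rightarrow> real" and r :: real
  have "\<exists>c \<nu> r. Q i c \<nu> r" for i
  proof -
    obtain c \<nu> where c: "c \<in> A" "i \<in> fst c" "equivalent_norm \<nu>" "star_property k \<nu> C0"
      "\<forall>x\<in>fst c. \<forall>v. \<nu> v \<le> K * F (x, dchart_inv A c x v) \<and> F (x, dchart_inv A c x v) \<le> K * \<nu> v"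
      using ex[of i] by (elim exE conjE)
    obtain r where "r > 0" "\<And>z. \<nu> (z - snd c i) < r \<Longrightarrow> z \<in> cimage c"
      "closed {x \<in> fst c. \<nu> (snd c x - snd c i) \<le> r / 2}"
      by (rule patch_radius[OF man(2) c(1-3)], rule that)
    then have "Q i c \<nu> r" using c unfolding Q_def by simp
    then show ?thesis by blast
  qed
  then obtain ch \<nu> rad where Q: "\<And>i. Q i (ch i) (\<nu> i) (rad i)" by metis
  interpret patches A l F k K C0 ch \<nu> rad
    by unfold_locales (use assms(2) K Q in \<open>simp_all add: Q_def\<close>)
  \<comment> \<open>The points of the manifold index the patches, so it is they that get
    well-ordered; \<open>partition\<close> works with the strict part \<open>W - Id\<close>, which
    is well-founded.\<close>
  obtain W :: "'m rel" where W: "well_order_on UNIV W" using well_order_on by blast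
  have "wf (W - Id)" "\<And>i j. i \<noteq> j \<Longrightarrow> (i, j) \<in> W - Id \<or> (j, i) \<in> W - Id"
    using W by (auto simp: well_order_on_def linear_order_on_def total_on_def)
  moreover obtain \<sigma> L where \<sigma>: "\<And>m. Ck_on m UNIV \<sigma>" "\<And>t. t \<le> 0 \<Longrightarrow> \<sigma> t = 0" "\<And>t. t \<ge> 1 \<Longrightarrow> \<sigma> t = 1"
    "\<And>t. 0 \<le> \<sigma> t" "\<And>t. \<sigma> t \<le> (1 :: real)" "L \<ge> 1" "\<And>s t. \<bar>\<sigma> s - \<sigma> t\<bar> \<le> L * \<bar>s - t\<bar>"
    by (rule smooth_step_exists) blast
  moreover define S where "S i n h \<longleftrightarrow> Ck_on k UNIV h \<and>
      (\<forall>y\<in>patch i. \<bar>level (W - Id) i n y - h (crd i y)\<bar> < (1/2) ^ n / 8) \<and>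
      (\<forall>x y. \<bar>h x - h y\<bar> \<le> C0 * \<nu> i (x - y))" for i n h
  have "\<exists>h. S i n h" for i n
  proof -
    \<comment> \<open>All levels have Lipschitz constant 1, so their smooth versions share the
      constant \<open>C0\<close>.\<close>
    obtain h where "Ck_on k UNIV h" "\<And>y. y \<in> patch i \<Longrightarrow> \<bar>level (W - Id) i n y - h (crd i y)\<bar> < (1/2) ^ n / 8"
      "\<And>x y. \<bar>h x - h y\<bar> \<le> C0 * 1 * \<nu> i (x - y)"
      by (rule patch_approx[OF plip_level[of "W - Id" i n], of "(1/2) ^ n / 8" i]) simp_all
    then show ?thesis unfolding S_def by (intro exI[of _ h]) simp
  qed
  then obtain U where U: "\<And>i n. S i n (U i n)" by metis
  ultimately interpret partition A l F k K C0 ch \<nu> rad "W - Id" \<sigma> L U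
    by unfold_locales (use U in \<open>simp_all add: S_def\<close>)
  show ?thesis by (rule uniformly_bumpable)
qed

end
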